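(* Let $J\subset\mathbb{R}$ be an open interval. If $\gamma:J\to E^N$ is a free time minimizer, then $\gamma$ is a trajectory with zero energy.
   Context: $E$ is a finite dimensional Euclidean space with norm $\|\cdot\|$, $N\geq 2$, and $m_1,\dots,m_N>0$ are masses. For $x=(r_1,\dots,r_N)\in E^N$, the Newtonian potential is $U(x)=\sum_{1\leq i<j\leq N} m_i m_j\|r_i-r_j\|^{-1}\in(0,+\infty]$ (with $U(x)=+\infty$ if $r_i=r_j$ for some $i\ne j$), and $\Omega=\{x\in E^N: U(x)<+\infty\}$. For $v=(v_1,\dots,v_N)\in E^N$, $T(v)=\frac12\sum_i m_i\|v_i\|^2$. The Lagrangian is $L(x,v)=T(v)+U(x)$ and the action of an absolutely continuous curve $\gamma:[a,b]\to E^N$ is $A(\gamma)=\int_a^b L(\gamma(t),\dot\gamma(t))\,dt\in(0,+\infty]$. For $x,y\in E^N$, $\phi(x,y)$ is the infimum of $A(\gamma)$ over all absolutely continuous $\gamma:[a,b]\to E^N$ with $a<b$ arbitrary, $\gamma(a)=x$, $\gamma(b)=y$. A free time minimizer on an interval $J\subset\mathbb{R}$ is a curve $\gamma:J\to E^N$, absolutely continuous on compact subintervals, such that $A(\gamma|_{[a,b]})=\phi(\gamma(a),\gamma(b))$ for every compact subinterval $[a,b]\subset J$ with $a<b$. A trajectory (true motion) is a curve $\gamma=(r_1,\dots,r_N)$ with values in $\Omega$ satisfying Newton's equations $\ddot r_i=\sum_{j\neq i} m_j\|r_i-r_j\|^{-3}(r_j-r_i)$, $i=1,\dots,N$; its energy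 is the constant $h=T(\dot\gamma(t))-U(\gamma(t))$.
   Formalization: The Euclidean space E is assumed to have dimension at least 2; in dimension 1 the claim is false, since for two bodies on a line the zero-energy curve r(t) = c·sgn(t)|t|^(2/3) is a free time minimizer with a collision at t = 0. *)

theory Defs
  imports "HOL-Analysis.Analysis"
begin

(* Configurations in E^N have type ('a, 'n) vec: 'a is the Euclidean space E and 'n indexes the
   bodies, so N = CARD('n). The linear order on 'n serves only to sum over pairs i < j. *)

text \<open>
  Absolute continuity on a compact interval. A member (u, v) of the family \<open>F\<close> stands for the
  subinterval [u, v]; subintervals may share end points but not interior points.
\<close>

definition abs_continuous_on :: "real \<Rightarrow> real \<Rightarrow> (real \<Rightarrow> 'b::real_normed_vector) \<Rightarrow> bool" where
  "abs_continuous_on a b \<gamma> \<longleftrightarrow>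
     (\<forall>\<epsilon>>0. \<exists>\<delta>>0. \<forall>F::(real \<times> real) set.
        finite F \<and> (\<forall>(u, v)\<in>F. a \<le> u \<and> u \<le> v \<and> v \<le> b) \<and>
        pairwise (\<lambda>(u, v) (u', v'). {u<..<v} \<inter> {u'<..<v'} = {}) F \<and>
        (\<Sum>(u, v)\<in>F. v - u) < \<delta>
        \<longrightarrow> (\<Sum>(u, v)\<in>F. norm (\<gamma> v - \<gamma> u)) < \<epsilon>)"

text \<open>
  In \<^typ>\<open>ennreal\<close>, a positive number divided by 0 is \<open>\<infinity>\<close>; so for positive masses the potential is
  infinite exactly at the collisions.
\<close>

definition potential ::
  "('n \<Rightarrow> real) \<Rightarrow> ('a::euclidean_space, 'n::{finite,linorder}) vec \<Rightarrow> ennreal" where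
  "potential m x =
     (\<Sum>(i, j)\<in>{(i, j). i < j}. ennreal (m i * m j) / ennreal (norm (x $ i - x $ j)))"

definition collision_free ::
  "('n \<Rightarrow> real) \<Rightarrow> (('a::euclidean_space, 'n::{finite,linorder}) vec) set" where
  "collision_free m = {x. potential m x < \<infinity>}"

definition kinetic :: "('n \<Rightarrow> real) \<Rightarrow> ('a::euclidean_space, 'n::finite) vec \<Rightarrow> real" where
  "kinetic m v = (1/2) * (\<Sum>i\<in>UNIV. m i * (norm (v $ i))\<^sup>2)"

definition lagrangian ::
  "('n \<Rightarrow> real) \<Rightarrow> ('a::euclidean_space, 'n::{finite,linorder}) vec \<Rightarrow> ('a, 'n) vec \<Rightarrow> ennreal" where
  "lagrangian m x v = ennreal (kinetic m v) + potential m x"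

text \<open>
  An absolutely continuous curve is differentiable almost everywhere; the unspecified value of
  \<^const>\<open>vector_derivative\<close> on the exceptional null set does not affect the integral.
\<close>

definition action ::
  "('n \<Rightarrow> real) \<Rightarrow> real \<Rightarrow> real \<Rightarrow> (real \<Rightarrow> ('a::euclidean_space, 'n::{finite,linorder}) vec) \<Rightarrow> ennreal" where
  "action m a b \<gamma> =
     (\<integral>\<^sup>+t\<in>{a..b}. lagrangian m (\<gamma> t) (vector_derivative \<gamma> (at t within {a..b})) \<partial>lborel)"

definition action_potential ::
  "('n \<Rightarrow> real) \<Rightarrow> ('a::euclidean_space, 'n::{finite,linorder}) vec \<Rightarrow> ('a, 'n) vec \<Rightarrow> ennreal" where
  "action_potential m x y =
     Inf {action m a b \<gamma> | a b \<gamma>. a < b \<and> abs_continuous_on a b \<gamma> \<and> \<gamma> a = x \<and> \<gamma> b = y}"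

definition free_time_minimizer ::
  "('n \<Rightarrow> real) \<Rightarrow> real set \<Rightarrow> (real \<Rightarrow> ('a::euclidean_space, 'n::{finite,linorder}) vec) \<Rightarrow> bool" where
  "free_time_minimizer m J \<gamma> \<longleftrightarrow>
     (\<forall>a b. a < b \<and> {a..b} \<subseteq> J \<longrightarrow>
        abs_continuous_on a b \<gamma> \<and> action m a b \<gamma> = action_potential m (\<gamma> a) (\<gamma> b))"

definition newton_acceleration ::
  "('n \<Rightarrow> real) \<Rightarrow> ('a::euclidean_space, 'n::finite) vec \<Rightarrow> ('a, 'n) vec" where
  "newton_acceleration m x =
     (\<chi> i. \<Sum>j\<in>UNIV - {i}. (m j / norm (x $ i - x $ j) ^ 3) *\<^sub>R (x $ j - x $ i))"

definition trajectory ::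
  "('n \<Rightarrow> real) \<Rightarrow> real set \<Rightarrow> (real \<Rightarrow> ('a::euclidean_space, 'n::{finite,linorder}) vec) \<Rightarrow> bool" where
  "trajectory m J \<gamma> \<longleftrightarrow>
     (\<forall>t\<in>J. \<gamma> t \<in> collision_free m) \<and>
     (\<exists>v. \<forall>t\<in>J. (\<gamma> has_vector_derivative v t) (at t within J) \<and>
        (v has_vector_derivative newton_acceleration m (\<gamma> t)) (at t within J))"

(* Meaningful for x in collision_free m, since enn2real \<infinity> = 0. *)
definition energy ::
  "('n \<Rightarrow> real) \<Rightarrow> ('a::euclidean_space, 'n::{finite,linorder}) vec \<Rightarrow> ('a, 'n) vec \<Rightarrow> real" where
  "energy m x v = kinetic m v - enn2real (potential m x)"

end

theory Submission
  imports Defs "HOL-Real_Asymp.Real_Asymp"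
begin

text \<open>
  Collisions are excluded by averaging over competitors (Marchal's idea). If \<open>r\<^sub>i\<close> and \<open>r\<^sub>j\<close> meet at
  time \<open>t\<^sub>0\<close>, replace \<open>r\<^sub>i\<close> by \<open>r\<^sub>i + \<phi> \<xi>\<close>, where \<open>\<phi>\<close> vanishes at the end points and \<open>\<xi>\<close> is a random vector
  in a fixed plane whose law is the Poisson kernel \<open>h / (2 \<pi> (\<bar>\<xi>\<bar>\<^sup>2 + h\<^sup>2)\<^sup>3\<^sup>/\<^sup>2)\<close> cut off at \<open>\<bar>\<xi>\<bar> \<approx> 1\<close>.
  Without the cut-off, the average of \<open>1 / \<bar>x + \<phi> \<xi>\<bar>\<close> is at most both \<open>1 / \<bar>x\<bar>\<close> and \<open>1 / (\<phi> h)\<close>, in every dimension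
  at least two. The cut-off and the kinetic energy of the perturbation cost \<open>O(h)\<close>. On the other hand
  \<open>\<bar>r\<^sub>i - r\<^sub>j\<bar>\<close> is \<open>o(\<bar>t - t\<^sub>0\<bar>\<^sup>1\<^sup>/\<^sup>2)\<close> because the action is finite, so \<open>\<bar>r\<^sub>i - r\<^sub>j\<bar>\<close> stays below a multiple of \<open>h\<close>
  on a time interval much longer than \<open>h\<^sup>2\<close>, and the average gains much more than \<open>h\<close>. Neither the
  isolation of collisions nor a blow-up is needed.

  Away from collisions, Newton's equation follows from one first variation, and the energy vanishes because
  reparametrizations \<open>\<gamma>(r t)\<close> are admissible competitors. The measure-theoretic basis is the fundamental
  theorem of calculus for absolutely continuous curves.
\<close>

section \<open>Nonoverlapping families and variation\<close>

text \<open>Gain and cost are compared at one scale. On a window of half-width \<open>l\<close>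
  around the collision the pair stays within \<open>sqrt (l * \<eta>)\<close>, where \<eta> bounds
  the integral of the squared relative speed there, and \<open>h\<close> is taken of that order. The
  gain is a multiple of \<open>l / h\<close>, the cost a multiple of \<open>h\<close>; as
  \<open>h^2\<close> is a multiple of \<open>l * \<eta>\<close>, the length \<open>l\<close> cancels
  and a small \<eta> gives the contradiction. The cut-off cannot be avoided: the Poisson kernel has
  infinite second moment, whereas its restriction to a square of side 2 has second moment
  \<open>O(h)\<close> and loses mass \<open>O(h)\<close>. The cut-off is imposed on the inequality
  between the actions; afterwards the potential terms, being nonnegative, are averaged over the
  whole plane again. The plane requires \<open>DIM('a) \<ge> 2\<close>; on a line, bodies cannot
  exchange their order without colliding. Minimality is an equation in \<open>ennreal\<close>, so
  finiteness of the action has to come from an explicit curve, whose end points may themselves be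
  collisions.\<close>

definition nonoverlapping :: "real \<Rightarrow> real \<Rightarrow> (real \<times> real) set \<Rightarrow> bool" where
  "nonoverlapping a b F \<longleftrightarrow> finite F \<and> (\<forall>(u, v)\<in>F. a \<le> u \<and> u \<le> v \<and> v \<le> b) \<and>
     pairwise (\<lambda>(u, v) (u', v'). {u<..<v} \<inter> {u'<..<v'} = {}) F"

text \<open>For the identity this is the total length of a nonoverlapping family, so both sides of
  the epsilon-delta condition are values of one functional.\<close>

definition var_sum :: "(real \<Rightarrow> 'b::real_normed_vector) \<Rightarrow> (real \<times> real) set \<Rightarrow> real" where
  "var_sum f F = (\<Sum>(u, v)\<in>F. norm (f v - f u))"

lemma var_sum_id:
  assumes "nonoverlapping a b F"
  shows "(\<Sum>(u, v)\<in>F. v - u) = var_sum (\<lambda>x::real. x) F"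
  unfolding var_sum_def using assms by (auto simp: nonoverlapping_def intro!: sum.cong)

lemma abs_continuous_on_altdef:
  "abs_continuous_on a b f \<longleftrightarrow>
     (\<forall>\<epsilon>>0. \<exists>\<delta>>0. \<forall>F. nonoverlapping a b F \<and> var_sum (\<lambda>x::real. x) F < \<delta> \<longrightarrow> var_sum f F < \<epsilon>)"
proof -
  have "nonoverlapping a b F \<and> var_sum (\<lambda>x::real. x) F < \<delta> \<longleftrightarrow>
        finite F \<and> (\<forall>(u, v)\<in>F. a \<le> u \<and> u \<le> v \<and> v \<le> b) \<and>
        pairwise (\<lambda>(u, v) (u', v'). {u<..<v} \<inter> {u'<..<v'} = {}) F \<and>
        (\<Sum>(u, v)\<in>F. v - u) < \<delta>" for F \<delta>
    using var_sum_id[of a b F] by (auto simp: nonoverlapping_def)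
  then show ?thesis
    unfolding abs_continuous_on_def var_sum_def[of f] by simp
qed

lemma abs_continuous_onD:
  assumes "abs_continuous_on a b f" "0 < \<epsilon>"
  obtains \<delta> where "0 < \<delta>"
    "\<And>F. nonoverlapping a b F \<Longrightarrow> var_sum (\<lambda>x::real. x) F < \<delta> \<Longrightarrow> var_sum f F < \<epsilon>"
  using assms unfolding abs_continuous_on_altdef by blast

lemma nonoverlapping_singleton: "a \<le> u \<Longrightarrow> u \<le> v \<Longrightarrow> v \<le> b \<Longrightarrow> nonoverlapping a b {(u, v)}"
  by (auto simp: nonoverlapping_def)

lemma nonoverlapping_mono:
  "nonoverlapping a b F \<Longrightarrow> a' \<le> a \<Longrightarrow> b \<le> b' \<Longrightarrow> nonoverlapping a' b' F"
  unfolding nonoverlapping_def by fastforce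

lemma nonoverlapping_interiors_disjnt:
  assumes "nonoverlapping a b F"
  shows "disjoint_family_on (\<lambda>(u, v). {u<..<v}) F"
  using assms unfolding nonoverlapping_def pairwise_def disjoint_family_on_def by fast

text \<open>The interiors are disjoint subsets of \<open>U\<close>, so their lengths add up to at
  most its measure. \<open>U\<close> will be the whole interval or a small open set around a null
  set.\<close>

lemma nonoverlapping_length_le_measure:
  assumes F: "nonoverlapping a b F" and U: "U \<in> fmeasurable lborel"
    and sub: "\<And>u v. (u, v) \<in> F \<Longrightarrow> {u<..<v} \<subseteq> U"
  shows "var_sum (\<lambda>x::real. x) F \<le> measure lborel U"
proof -
  have fin: "finite F" and F0: "\<And>p. p \<in> F \<Longrightarrow> fst p \<le> snd p"
    using F by (auto simp: nonoverlapping_def)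
  have "var_sum (\<lambda>x::real. x) F = (\<Sum>p\<in>F. measure lborel ((\<lambda>(u, v). {u<..<v}) p))"
    unfolding var_sum_def using F by (intro sum.cong) (auto simp: nonoverlapping_def)
  also have "\<dots> = measure lborel (\<Union>p\<in>F. (\<lambda>(u, v). {u<..<v}) p)"
    using fin nonoverlapping_interiors_disjnt[OF F]
    by (intro measure_finite_Union[symmetric]) (auto simp: case_prod_unfold emeasure_lborel_Ioo F0)
  also have "\<dots> \<le> measure lborel U"
  proof (rule measure_mono_fmeasurable)
    show "(\<Union>p\<in>F. (\<lambda>(u, v). {u<..<v}) p) \<subseteq> U"
      using sub by fast
    show "(\<Union>p\<in>F. (\<lambda>(u, v). {u<..<v}) p) \<in> sets lborel"
      using fin by (intro sets.finite_UN) auto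
  qed fact
  finally show ?thesis .
qed

lemma nonoverlapping_length_le:
  assumes F: "nonoverlapping a b F" and ab: "a \<le> b"
  shows "var_sum (\<lambda>x::real. x) F \<le> b - a"
proof -
  have "var_sum (\<lambda>x::real. x) F \<le> measure lborel {a..b}"
  proof (rule nonoverlapping_length_le_measure[OF F])
    show "{u<..<v} \<subseteq> {a..b}" if "(u, v) \<in> F" for u v
      using F that unfolding nonoverlapping_def by fastforce
  qed (simp add: fmeasurable_cbox flip: box_real)
  then show ?thesis using ab by simp
qed

text \<open>Degenerate intervals are discarded, so that clamping is injective on the remaining ones.\<close>

definition clamp_family :: "real \<Rightarrow> real \<Rightarrow> (real \<times> real) set \<Rightarrow> (real \<times> real) set" where
  "clamp_family c d F =
     (\<lambda>(u, v). (max c (min d u), max c (min d v))) ` {(u, v)\<in>F. max c (min d u) < max c (min d v)}"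

text \<open>Clamping intersects the family with the window \<open>{c..d}\<close>. The second part
  sums over all of \<open>F\<close>, the discarded members contributing 0, so that sums for
  different windows can be compared term by term.\<close>

lemma clamp_family:
  assumes F: "nonoverlapping a b F" and cd: "c \<le> d"
  shows "nonoverlapping c d (clamp_family c d F)"
    and "var_sum f (clamp_family c d F) =
         (\<Sum>(u, v)\<in>F. norm (f (max c (min d v)) - f (max c (min d u))))"
proof -
  define p where "p x = max c (min d x)" for x
  define F1 where "F1 = {(u, v)\<in>F. p u < p v}"
  let ?q = "\<lambda>(u, v). (p u, p v)"
  have fin: "finite F" using F by (simp add: nonoverlapping_def)
  have cf: "clamp_family c d F = ?q ` F1"
    by (simp add: clamp_family_def F1_def p_def)
  have sub: "{p u<..<p v} \<subseteq> {u<..<v}" for u v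
    using cd by (auto simp: p_def max_def min_def split: if_splits)
  have disj: "{p u<..<p v} \<inter> {p u'<..<p v'} = {}" if "(u, v) \<in> F" "(u', v') \<in> F" "(u, v) \<noteq> (u', v')"
    for u v u' v'
  proof -
    have "{u<..<v} \<inter> {u'<..<v'} = {}"
      using that F unfolding nonoverlapping_def pairwise_def by fast
    with sub[of u v] sub[of u' v'] show ?thesis by blast
  qed
  \<comment> \<open>A clamped interval that is kept has nonempty interior, so two members with the
    same image would overlap.\<close>
  have inj: "inj_on ?q F1"
  proof (rule inj_onI)
    fix x y assume xy: "x \<in> F1" "y \<in> F1" "?q x = ?q y"
    obtain u v u' v' where [simp]: "x = (u, v)" "y = (u', v')" by (cases x, cases y)
    show "x = y"
    proof (rule ccontr)
      assume "x \<noteq> y"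
      then have "{p u<..<p v} \<inter> {p u'<..<p v'} = {}"
        using xy disj[of u v u' v'] by (auto simp: F1_def)
      moreover have "p u = p u'" "p v = p v'" "p u < p v"
        using xy by (auto simp: F1_def)
      ultimately show False by simp
    qed
  qed
  show "nonoverlapping c d (clamp_family c d F)"
    unfolding nonoverlapping_def
  proof (intro conjI)
    show "finite (clamp_family c d F)"
      using fin by (auto simp: cf F1_def intro: finite_subset)
    show "\<forall>(u, v)\<in>clamp_family c d F. c \<le> u \<and> u \<le> v \<and> v \<le> d"
      using cd by (auto simp: cf F1_def p_def)
    show "pairwise (\<lambda>(u, v) (u', v'). {u<..<v} \<inter> {u'<..<v'} = {}) (clamp_family c d F)"
      unfolding cf pairwise_def using disj by (fastforce simp: F1_def)
  qed
  have "var_sum f (clamp_family c d F) = (\<Sum>(u, v)\<in>F1. norm (f (p v) - f (p u)))"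
    unfolding var_sum_def cf by (subst sum.reindex[OF inj]) (auto intro!: sum.cong)
  also have "\<dots> = (\<Sum>(u, v)\<in>F. norm (f (p v) - f (p u)))"
  proof (rule sum.mono_neutral_left[OF fin])
    show "\<forall>i\<in>F - F1. (case i of (u, v) \<Rightarrow> norm (f (p v) - f (p u))) = 0"
    proof safe
      fix u v assume uv: "(u, v) \<in> F" "(u, v) \<notin> F1"
      have "u \<le> v" using F uv by (auto simp: nonoverlapping_def)
      then have "p u \<le> p v" by (auto simp: p_def max_def min_def)
      with uv have "p u = p v" by (auto simp: F1_def)
      then show "norm (f (p v) - f (p u)) = 0" by simp
    qed
  qed (auto simp: F1_def)
  finally show "var_sum f (clamp_family c d F) =
      (\<Sum>(u, v)\<in>F. norm (f (max c (min d v)) - f (max c (min d u))))"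
    by (simp add: p_def)
qed

lemma clamp_family_length_le:
  assumes F: "nonoverlapping a b F" and cd: "c \<le> d"
  shows "var_sum (\<lambda>x::real. x) (clamp_family c d F) \<le> var_sum (\<lambda>x::real. x) F"
  unfolding clamp_family(2)[OF F cd]
  unfolding var_sum_def using F cd by (intro sum_mono) (auto simp: nonoverlapping_def max_def min_def)

text \<open>Only members containing \<open>c\<close> are cut; for them the triangle inequality at
  \<open>c\<close> applies.\<close>

lemma var_sum_split:
  assumes F: "nonoverlapping a b F" and c: "a \<le> c" "c \<le> b"
  shows "var_sum f F \<le> var_sum f (clamp_family a c F) + var_sum f (clamp_family c b F)"
  unfolding clamp_family(2)[OF F c(1)] clamp_family(2)[OF F c(2)]
  unfolding var_sum_def sum.distrib[symmetric]
proof (rule sum_mono, clarify)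
  fix u v assume "(u, v) \<in> F"
  then have uv: "a \<le> u" "u \<le> v" "v \<le> b" using F by (auto simp: nonoverlapping_def)
  consider "v \<le> c" | "c \<le> u" | "u \<le> c" "c \<le> v" using uv by linarith
  then show "norm (f v - f u) \<le> norm (f (max a (min c v)) - f (max a (min c u))) +
      norm (f (max c (min b v)) - f (max c (min b u)))"
  proof cases
    case 3
    have "norm (f v - f u) \<le> norm (f c - f u) + norm (f v - f c)"
      using norm_triangle_ineq[of "f c - f u" "f v - f c"] by simp
    moreover have "max a (min c v) = c" "max a (min c u) = u" "max c (min b v) = v" "max c (min b u) = c"
      using 3 uv c by auto
    ultimately show ?thesis by simp
  next
    case 1
    then have "max a (min c v) = v" "max a (min c u) = u" "max c (min b v) = c" "max c (min b u) = c"
      using uv c by auto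
    then show ?thesis by simp
  next
    case 2
    then have "max a (min c v) = c" "max a (min c u) = c" "max c (min b v) = v" "max c (min b u) = u"
      using uv c by auto
    then show ?thesis by simp
  qed
qed

lemma abs_continuous_on_glue:
  assumes "abs_continuous_on a c f" "abs_continuous_on c b f" and c: "a \<le> c" "c \<le> b"
  shows "abs_continuous_on a b f"
  unfolding abs_continuous_on_altdef
proof (intro allI impI)
  fix \<epsilon> :: real assume "0 < \<epsilon>"
  then have e: "0 < \<epsilon> / 2" by simp
  from abs_continuous_onD[OF assms(1) e] obtain \<delta>1 where 1: "0 < \<delta>1"
    "\<And>F. nonoverlapping a c F \<Longrightarrow> var_sum (\<lambda>x::real. x) F < \<delta>1 \<Longrightarrow> var_sum f F < \<epsilon> / 2" by blast
  from abs_continuous_onD[OF assms(2) e] obtain \<delta>2 where 2: "0 < \<delta>2"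
    "\<And>F. nonoverlapping c b F \<Longrightarrow> var_sum (\<lambda>x::real. x) F < \<delta>2 \<Longrightarrow> var_sum f F < \<epsilon> / 2" by blast
  show "\<exists>\<delta>>0. \<forall>F. nonoverlapping a b F \<and> var_sum (\<lambda>x::real. x) F < \<delta> \<longrightarrow> var_sum f F < \<epsilon>"
  proof (intro exI[of _ "min \<delta>1 \<delta>2"] conjI allI impI)
    fix F assume F: "nonoverlapping a b F \<and> var_sum (\<lambda>x::real. x) F < min \<delta>1 \<delta>2"
    then have F1: "nonoverlapping a b F" by simp
    have "var_sum f (clamp_family a c F) < \<epsilon> / 2"
      using 1(2)[OF clamp_family(1)[OF F1 c(1)]] clamp_family_length_le[OF F1 c(1)] F by simp
    moreover have "var_sum f (clamp_family c b F) < \<epsilon> / 2"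
      using 2(2)[OF clamp_family(1)[OF F1 c(2)]] clamp_family_length_le[OF F1 c(2)] F by simp
    ultimately show "var_sum f F < \<epsilon>"
      using var_sum_split[OF F1 c, of f] by simp
  qed (use 1 2 in auto)
qed

lemma abs_continuous_on_subinterval:
  assumes "abs_continuous_on a b f" "a \<le> a'" "b' \<le> b"
  shows "abs_continuous_on a' b' f"
  using assms unfolding abs_continuous_on_altdef by (meson nonoverlapping_mono)

text \<open>Lipschitz functions, linear images, products and changes of a function outside the
  interval all reduce to this comparison, which is why \<open>g\<close> may take values in another
  space.\<close>

lemma abs_continuous_on_dominated:
  fixes f :: "real \<Rightarrow> 'b::real_normed_vector" and g :: "real \<Rightarrow> 'c::real_normed_vector"
  assumes g: "abs_continuous_on a b g" and C: "0 < C"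
    and le: "\<And>u v. a \<le> u \<Longrightarrow> u \<le> v \<Longrightarrow> v \<le> b \<Longrightarrow> norm (f v - f u) \<le> C * norm (g v - g u)"
  shows "abs_continuous_on a b f"
  unfolding abs_continuous_on_altdef
proof (intro allI impI)
  fix \<epsilon> :: real assume "0 < \<epsilon>"
  then have e: "0 < \<epsilon> / C" using C by simp
  from abs_continuous_onD[OF g e] obtain \<delta> where \<delta>: "0 < \<delta>"
    "\<And>F. nonoverlapping a b F \<Longrightarrow> var_sum (\<lambda>x::real. x) F < \<delta> \<Longrightarrow> var_sum g F < \<epsilon> / C" by blast
  have "var_sum f F < \<epsilon>" if F: "nonoverlapping a b F" "var_sum (\<lambda>x::real. x) F < \<delta>" for F
  proof -
    have "var_sum f F \<le> C * var_sum g F"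
      unfolding var_sum_def sum_distrib_left using F(1) le
      by (intro sum_mono) (auto simp: nonoverlapping_def)
    also have "\<dots> < \<epsilon>" using \<delta>(2)[OF F] C by (simp add: field_simps)
    finally show ?thesis .
  qed
  with \<delta>(1) show "\<exists>\<delta>>0. \<forall>F. nonoverlapping a b F \<and> var_sum (\<lambda>x::real. x) F < \<delta> \<longrightarrow> var_sum f F < \<epsilon>"
    by blast
qed

lemma abs_continuous_on_id: "abs_continuous_on a b (\<lambda>x::real. x)"
  unfolding abs_continuous_on_altdef by blast

lemma abs_continuous_on_lipschitz:
  assumes "\<And>u v. a \<le> u \<Longrightarrow> u \<le> v \<Longrightarrow> v \<le> b \<Longrightarrow> norm (f v - f u) \<le> C * (v - u)"
  shows "abs_continuous_on a b f"
proof (rule abs_continuous_on_dominated[OF abs_continuous_on_id, where C="max C 1"])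
  fix u v :: real assume *: "a \<le> u" "u \<le> v" "v \<le> b"
  have "C * (v - u) \<le> max C 1 * (v - u)" using * by (intro mult_right_mono) auto
  then show "norm (f v - f u) \<le> max C 1 * norm (v - u)" using assms[OF *] * by simp
qed auto

lemma abs_continuous_on_add:
  assumes "abs_continuous_on a b f" "abs_continuous_on a b g"
  shows "abs_continuous_on a b (\<lambda>x. f x + g x)"
  unfolding abs_continuous_on_altdef
proof (intro allI impI)
  fix \<epsilon> :: real assume "0 < \<epsilon>"
  then have e: "0 < \<epsilon> / 2" by simp
  from abs_continuous_onD[OF assms(1) e] obtain \<delta>1 where 1: "0 < \<delta>1"
    "\<And>F. nonoverlapping a b F \<Longrightarrow> var_sum (\<lambda>x::real. x) F < \<delta>1 \<Longrightarrow> var_sum f F < \<epsilon> / 2" by blast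
  from abs_continuous_onD[OF assms(2) e] obtain \<delta>2 where 2: "0 < \<delta>2"
    "\<And>F. nonoverlapping a b F \<Longrightarrow> var_sum (\<lambda>x::real. x) F < \<delta>2 \<Longrightarrow> var_sum g F < \<epsilon> / 2" by blast
  show "\<exists>\<delta>>0. \<forall>F. nonoverlapping a b F \<and> var_sum (\<lambda>x::real. x) F < \<delta> \<longrightarrow> var_sum (\<lambda>x. f x + g x) F < \<epsilon>"
  proof (intro exI[of _ "min \<delta>1 \<delta>2"] conjI allI impI)
    fix F assume F: "nonoverlapping a b F \<and> var_sum (\<lambda>x::real. x) F < min \<delta>1 \<delta>2"
    have "var_sum (\<lambda>x. f x + g x) F \<le> var_sum f F + var_sum g F"
      unfolding var_sum_def sum.distrib[symmetric]
    proof (rule sum_mono, clarify)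
      fix u v show "norm (f v + g v - (f u + g u)) \<le> norm (f v - f u) + norm (g v - g u)"
        by (metis add_diff_add norm_triangle_ineq)
    qed
    with F 1(2)[of F] 2(2)[of F] show "var_sum (\<lambda>x. f x + g x) F < \<epsilon>" by simp
  qed (use 1 2 in auto)
qed

lemma abs_continuous_on_bounded_linear:
  assumes f: "abs_continuous_on a b f" and "bounded_linear L"
  shows "abs_continuous_on a b (\<lambda>x. L (f x))"
proof -
  interpret bounded_linear L by fact
  obtain K where K: "K > 0" "\<And>x. norm (L x) \<le> norm x * K" using pos_bounded by blast
  show ?thesis
    by (rule abs_continuous_on_dominated[OF f K(1)]) (metis K(2) diff mult.commute)
qed

lemma abs_continuous_on_imp_continuous_on:
  assumes "abs_continuous_on a b f"
  shows "continuous_on {a..b} f"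
  unfolding continuous_on_iff
proof (intro ballI allI impI)
  fix x e :: real assume x: "x \<in> {a..b}" and e: "0 < e"
  from abs_continuous_onD[OF assms e] obtain \<delta> where \<delta>: "0 < \<delta>"
    "\<And>F. nonoverlapping a b F \<Longrightarrow> var_sum (\<lambda>x::real. x) F < \<delta> \<Longrightarrow> var_sum f F < e" by blast
  have *: "norm (f v - f u) < e" if "a \<le> u" "u \<le> v" "v \<le> b" "v - u < \<delta>" for u v
    using \<delta>(2)[OF nonoverlapping_singleton[OF that(1-3)]] that by (simp add: var_sum_def)
  show "\<exists>d>0. \<forall>x'\<in>{a..b}. dist x' x < d \<longrightarrow> dist (f x') (f x) < e"
  proof (intro exI[of _ \<delta>] conjI ballI impI)
    fix x' assume "x' \<in> {a..b}" "dist x' x < \<delta>"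
    then show "dist (f x') (f x) < e"
      using *[of x x'] *[of x' x] x
      by (cases "x \<le> x'") (auto simp: dist_norm norm_minus_commute)
  qed (use \<delta> in auto)
qed

section \<open>Total variation of an absolutely continuous curve\<close>

definition variation :: "(real \<Rightarrow> 'b::real_normed_vector) \<Rightarrow> real \<Rightarrow> real \<Rightarrow> real" where
  "variation f a b = (SUP F\<in>Collect (nonoverlapping a b). var_sum f F)"

lemma nonoverlapping_empty: "nonoverlapping a b {}"
  by (simp add: nonoverlapping_def)

text \<open>Induction over windows of length \<open>\<delta> / 2\<close>, on each of which the
  variation sums stay below 1; finitely many windows exhaust the interval.\<close>

lemma abs_continuous_on_bounded_variation:
  assumes f: "abs_continuous_on a b f"
  shows "bdd_above (var_sum f ` Collect (nonoverlapping a b))"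
proof -
  from abs_continuous_onD[OF f zero_less_one] obtain \<delta> where \<delta>: "0 < \<delta>"
    "\<And>F. nonoverlapping a b F \<Longrightarrow> var_sum (\<lambda>x::real. x) F < \<delta> \<Longrightarrow> var_sum f F < 1" by blast
  have *: "var_sum f F \<le> real n" if "a \<le> c" "c \<le> b" "c \<le> a + real n * (\<delta> / 2)" "nonoverlapping a c F"
    for n c F
    using that
  proof (induction n arbitrary: c F)
    case 0
    then have "c = a" by simp
    have "var_sum f F = 0"
      unfolding var_sum_def
    proof (rule sum.neutral, clarify)
      fix u v assume "(u, v) \<in> F"
      then have "u = v" using 0 \<open>c = a\<close> by (fastforce simp: nonoverlapping_def)
      then show "norm (f v - f u) = 0" by simp
    qed
    then show ?case by simp
  next
    case (Suc n)
    define d where "d = max a (c - \<delta> / 2)"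
    have d: "a \<le> d" "d \<le> c" "d \<le> a + real n * (\<delta> / 2)" "c - d \<le> \<delta> / 2"
      using Suc.prems(1-3) \<delta>(1) by (auto simp: d_def max_def algebra_simps add_divide_distrib)
    note F = Suc.prems(4)
    have "var_sum f (clamp_family a d F) \<le> real n"
      using Suc.IH[OF d(1) _ d(3) clamp_family(1)[OF F d(1)]] d(2) Suc.prems(2) by linarith
    moreover have "var_sum f (clamp_family d c F) < 1"
    proof (rule \<delta>(2))
      show "nonoverlapping a b (clamp_family d c F)"
        using nonoverlapping_mono[OF clamp_family(1)[OF F d(2)] d(1) Suc.prems(2)] .
      show "var_sum (\<lambda>x::real. x) (clamp_family d c F) < \<delta>"
        using nonoverlapping_length_le[OF clamp_family(1)[OF F d(2)] d(2)] d(4) \<delta>(1) by linarith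
    qed
    ultimately show ?case using var_sum_split[OF F d(1,2), of f] by simp
  qed
  show ?thesis
  proof (cases "a \<le> b")
    case True
    obtain n :: nat where "(b - a) / (\<delta> / 2) \<le> real n" using real_arch_simple by blast
    then have "b \<le> a + real n * (\<delta> / 2)" using \<delta>(1) by (simp add: field_simps)
    then show ?thesis using *[of b n] True by (intro bdd_aboveI[of _ "real n"]) auto
  next
    case False
    then have "F = {}" if "nonoverlapping a b F" for F
    proof -
      have "p \<notin> F" for p
        using that False by (cases p) (force simp: nonoverlapping_def)
      then show ?thesis by blast
    qed
    then show ?thesis by (intro bdd_aboveI[of _ "var_sum f {}"]) auto
  qed
qed

lemma var_sum_le_variation:
  assumes "abs_continuous_on a b f" "nonoverlapping a b F"
  shows "var_sum f F \<le> variation f a b"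
  unfolding variation_def using assms abs_continuous_on_bounded_variation
  by (intro cSUP_upper) auto

lemma variation_le:
  assumes "\<And>F. nonoverlapping a b F \<Longrightarrow> var_sum f F \<le> B"
  shows "variation f a b \<le> B"
  unfolding variation_def using assms nonoverlapping_empty by (intro cSUP_least) auto

lemma variation_nonneg: "abs_continuous_on a b f \<Longrightarrow> 0 \<le> variation f a b"
  using var_sum_le_variation[OF _ nonoverlapping_empty, of a b f] by (simp add: var_sum_def)

lemma variation_approx:
  assumes "0 < \<epsilon>"
  obtains F where "nonoverlapping a b F" "variation f a b < var_sum f F + \<epsilon>"
proof -
  have "\<exists>F. nonoverlapping a b F \<and> variation f a b < var_sum f F + \<epsilon>"
  proof (rule ccontr)
    assume "\<not> ?thesis"
    then have "variation f a b \<le> variation f a b - \<epsilon>"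
      by (intro variation_le) (force simp: not_less)
    with assms show False by simp
  qed
  with that show thesis by blast
qed

text \<open>Members of different families have disjoint interiors, but a degenerate pair could
  belong to several families; such pairs are removed so that the union is disjoint. One
  \<open>H\<close> has to serve every function, and the identity is listed separately because of its
  type.\<close>

lemma var_sum_Union:
  fixes G :: "'i \<Rightarrow> (real \<times> real) set" and f :: "real \<Rightarrow> 'b::real_normed_vector"
  assumes fin: "finite I" and G: "\<And>i. i \<in> I \<Longrightarrow> nonoverlapping (l i) (r i) (G i)"
    and lr: "\<And>i. i \<in> I \<Longrightarrow> a \<le> l i \<and> l i \<le> r i \<and> r i \<le> b"
    and disj: "\<And>i j. i \<in> I \<Longrightarrow> j \<in> I \<Longrightarrow> i \<noteq> j \<Longrightarrow> {l i<..<r i} \<inter> {l j<..<r j} = {}"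
  obtains H where "nonoverlapping a b H"
    "\<And>f::real \<Rightarrow> 'b. var_sum f H = (\<Sum>i\<in>I. var_sum f (G i))"
    "var_sum (\<lambda>x::real. x) H = (\<Sum>i\<in>I. var_sum (\<lambda>x::real. x) (G i))"
proof -
  define G' where "G' i = {(u, v)\<in>G i. u < v}" for i
  have sumG': "var_sum f (G' i) = var_sum f (G i)" if "i \<in> I" for f :: "real \<Rightarrow> 'c::real_normed_vector" and i
    unfolding var_sum_def using G[OF that]
    by (intro sum.mono_neutral_left) (force simp: G'_def nonoverlapping_def)+
  have Gi: "finite (G i)" "\<And>u v. (u, v) \<in> G i \<Longrightarrow> l i \<le> u \<and> u \<le> v \<and> v \<le> r i"
    "\<And>u v u' v'. (u, v) \<in> G i \<Longrightarrow> (u', v') \<in> G i \<Longrightarrow> (u, v) \<noteq> (u', v') \<Longrightarrow> {u<..<v} \<inter> {u'<..<v'} = {}"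
    if "i \<in> I" for i
    using G[OF that] unfolding nonoverlapping_def pairwise_def by fast+
  have between: "{u<..<v} \<subseteq> {l i<..<r i}" if "i \<in> I" "(u, v) \<in> G i" for i u v
    using Gi(2)[OF that] by auto
  have cross: "{u<..<v} \<inter> {u'<..<v'} = {}" if "i \<in> I" "j \<in> I" "i \<noteq> j" "(u, v) \<in> G i" "(u', v') \<in> G j"
    for i j u v u' v'
    using between[OF that(1,4)] between[OF that(2,5)] disj[OF that(1-3)] by blast
  have finG': "finite (G' i)" if "i \<in> I" for i
    using Gi(1)[OF that] by (auto simp: G'_def intro: finite_subset)
  have disjG': "G' i \<inter> G' j = {}" if ij: "i \<in> I" "j \<in> I" "i \<noteq> j" for i j
  proof (rule ccontr)
    assume "G' i \<inter> G' j \<noteq> {}"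
    then obtain u v where "(u, v) \<in> G i" "(u, v) \<in> G j" "u < v" by (auto simp: G'_def)
    with cross[OF ij] show False by fastforce
  qed
  have no: "nonoverlapping a b (\<Union>i\<in>I. G' i)"
    unfolding nonoverlapping_def
  proof (intro conjI)
    show "finite (\<Union>i\<in>I. G' i)" using fin finG' by blast
    show "\<forall>(u, v)\<in>\<Union>i\<in>I. G' i. a \<le> u \<and> u \<le> v \<and> v \<le> b"
      using Gi(2) lr unfolding G'_def by fastforce
    show "pairwise (\<lambda>(u, v) (u', v'). {u<..<v} \<inter> {u'<..<v'} = {}) (\<Union>i\<in>I. G' i)"
      unfolding pairwise_def
    proof (intro ballI impI)
      fix x y assume xy: "x \<in> (\<Union>i\<in>I. G' i)" "y \<in> (\<Union>i\<in>I. G' i)" "x \<noteq> y"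
      obtain u v u' v' where [simp]: "x = (u, v)" "y = (u', v')" by (cases x, cases y)
      obtain i j where ij: "i \<in> I" "(u, v) \<in> G i" "j \<in> I" "(u', v') \<in> G j"
        using xy by (auto simp: G'_def)
      show "(case x of (u, v) \<Rightarrow> \<lambda>(u', v'). {u<..<v} \<inter> {u'<..<v'} = {}) y"
        using cross[of i j u v u' v'] Gi(3)[of i u v u' v'] ij xy(3) by (cases "i = j") auto
    qed
  qed
  have sum: "var_sum f (\<Union>i\<in>I. G' i) = (\<Sum>i\<in>I. var_sum f (G i))" for f :: "real \<Rightarrow> 'c::real_normed_vector"
  proof -
    have "var_sum f (\<Union>i\<in>I. G' i) = (\<Sum>i\<in>I. var_sum f (G' i))"
      unfolding var_sum_def using fin finG' disjG' by (intro sum.UNION_disjoint) auto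
    then show ?thesis by (simp add: sumG')
  qed
  show thesis using that[OF no sum sum] .
qed

text \<open>Cutting a family at \<open>c\<close> gives one inequality, joining nearly optimal
  families on both sides the other.\<close>

lemma variation_additive:
  fixes f :: "real \<Rightarrow> 'b::real_normed_vector"
  assumes f: "abs_continuous_on a b f" and c: "a \<le> c" "c \<le> b"
  shows "variation f a b = variation f a c + variation f c b"
proof (rule antisym)
  have f1: "abs_continuous_on a c f" and f2: "abs_continuous_on c b f"
    using abs_continuous_on_subinterval[OF f] c by auto
  show "variation f a b \<le> variation f a c + variation f c b"
  proof (rule variation_le)
    fix F assume F: "nonoverlapping a b F"
    show "var_sum f F \<le> variation f a c + variation f c b"
      using var_sum_split[OF F c, of f] var_sum_le_variation[OF f1 clamp_family(1)[OF F c(1)]]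
        var_sum_le_variation[OF f2 clamp_family(1)[OF F c(2)]] by linarith
  qed
  have "variation f a c + variation f c b \<le> variation f a b + \<epsilon>" if "0 < \<epsilon>" for \<epsilon>
  proof -
    obtain F where F: "nonoverlapping a c F" "variation f a c < var_sum f F + \<epsilon> / 2"
      using variation_approx[of "\<epsilon> / 2"] \<open>0 < \<epsilon>\<close> by (metis half_gt_zero)
    obtain G where G: "nonoverlapping c b G" "variation f c b < var_sum f G + \<epsilon> / 2"
      using variation_approx[of "\<epsilon> / 2"] \<open>0 < \<epsilon>\<close> by (metis half_gt_zero)
    obtain H where H: "nonoverlapping a b H"
      "\<And>g::real \<Rightarrow> 'b. var_sum g H = (\<Sum>i\<in>{True, False}. var_sum g (if i then F else G))"
      by (rule var_sum_Union[where I="{True, False}" and G="\<lambda>i. if i then F else G"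
            and l="\<lambda>i. if i then a else c" and r="\<lambda>i. if i then c else b" and a=a and b=b])
         (use F(1) G(1) c in \<open>auto split: if_splits\<close>)
    show ?thesis using var_sum_le_variation[OF f H(1)] F(2) G(2) by (simp add: H(2))
  qed
  then show "variation f a c + variation f c b \<le> variation f a b"
    by (rule field_le_epsilon)
qed

lemma norm_diff_le_variation:
  assumes "abs_continuous_on a b f" "a \<le> b"
  shows "norm (f b - f a) \<le> variation f a b"
  using var_sum_le_variation[OF assms(1) nonoverlapping_singleton[of a a b b]] assms(2)
  by (simp add: var_sum_def)

text \<open>Each member of a short family is replaced by a family inside it that nearly attains its
  variation. The result is not longer, so the \<delta> belonging to \<open>\<epsilon> / 2\<close>
  for \<open>f\<close> works.\<close>

lemma abs_continuous_on_variation: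
  fixes f :: "real \<Rightarrow> 'b::real_normed_vector"
  assumes f: "abs_continuous_on a b f"
  shows "abs_continuous_on a b (variation f a)"
  unfolding abs_continuous_on_altdef
proof (intro allI impI)
  fix \<epsilon> :: real assume "0 < \<epsilon>"
  then have e: "0 < \<epsilon> / 2" by simp
  from abs_continuous_onD[OF f e] obtain \<delta> where \<delta>: "0 < \<delta>"
    "\<And>F. nonoverlapping a b F \<Longrightarrow> var_sum (\<lambda>x::real. x) F < \<delta> \<Longrightarrow> var_sum f F < \<epsilon> / 2" by blast
  have "var_sum (variation f a) F < \<epsilon>" if F: "nonoverlapping a b F" "var_sum (\<lambda>x::real. x) F < \<delta>" for F
  proof -
    have F': "finite F" "\<And>p. p \<in> F \<Longrightarrow> a \<le> fst p \<and> fst p \<le> snd p \<and> snd p \<le> b"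
      using F(1) by (auto simp: nonoverlapping_def)
    have eq: "norm (variation f a v - variation f a u) = variation f u v" if "(u, v) \<in> F" for u v
    proof -
      have uv: "a \<le> u" "u \<le> v" "v \<le> b" using F'(2)[OF that] by auto
      have "variation f a v = variation f a u + variation f u v"
        using abs_continuous_on_subinterval[OF f] uv by (intro variation_additive) auto
      moreover have "0 \<le> variation f u v"
        using abs_continuous_on_subinterval[OF f] uv by (intro variation_nonneg) auto
      ultimately show ?thesis by simp
    qed
    \<comment> \<open>An equal share of \<open>\<epsilon> / 2\<close> for each member; the added 1
      covers the empty family.\<close>
    define \<eta> where "\<eta> = \<epsilon> / 2 / (real (card F) + 1)"
    have \<eta>: "0 < \<eta>" "real (card F) * \<eta> < \<epsilon> / 2" using e by (auto simp: \<eta>_def field_simps)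
    have "\<forall>p. \<exists>G. nonoverlapping (fst p) (snd p) G \<and> variation f (fst p) (snd p) < var_sum f G + \<eta>"
      using variation_approx[OF \<eta>(1)] by metis
    then obtain G where G: "\<And>p. nonoverlapping (fst p) (snd p) (G p)"
      "\<And>p. variation f (fst p) (snd p) < var_sum f (G p) + \<eta>" by metis
    obtain H where H: "nonoverlapping a b H" "\<And>g::real \<Rightarrow> 'b. var_sum g H = (\<Sum>i\<in>F. var_sum g (G i))"
      "var_sum (\<lambda>x::real. x) H = (\<Sum>i\<in>F. var_sum (\<lambda>x::real. x) (G i))"
    proof (rule var_sum_Union[where I=F and G=G and l=fst and r=snd and a=a and b=b])
      show "{fst i<..<snd i} \<inter> {fst j<..<snd j} = {}" if "i \<in> F" "j \<in> F" "i \<noteq> j" for i j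
        using that F(1) unfolding nonoverlapping_def pairwise_def by (auto simp: case_prod_unfold)
    qed (use F' G in auto)
    have "var_sum (\<lambda>x::real. x) H \<le> var_sum (\<lambda>x::real. x) F"
      unfolding H(3) var_sum_def[of _ F]
    proof (rule sum_mono)
      fix p assume "p \<in> F"
      then show "var_sum (\<lambda>x::real. x) (G p) \<le> (case p of (u, v) \<Rightarrow> norm (v - u))"
        using nonoverlapping_length_le[OF G(1)[of p]] F'(2)[of p] by (auto simp: case_prod_unfold)
    qed
    then have 1: "(\<Sum>p\<in>F. var_sum f (G p)) < \<epsilon> / 2" using \<delta>(2)[OF H(1)] F(2) H(2) by simp
    have "var_sum (variation f a) F = (\<Sum>p\<in>F. variation f (fst p) (snd p))"
      unfolding var_sum_def using eq by (intro sum.cong) auto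
    also have "\<dots> \<le> (\<Sum>p\<in>F. var_sum f (G p) + \<eta>)" by (intro sum_mono less_imp_le G(2))
    also have "\<dots> < \<epsilon>" using 1 \<eta>(2) by (simp add: sum.distrib)
    finally show ?thesis .
  qed
  with \<delta>(1) show "\<exists>\<delta>>0. \<forall>F. nonoverlapping a b F \<and> var_sum (\<lambda>x::real. x) F < \<delta> \<longrightarrow> var_sum (variation f a) F < \<epsilon>"
    by blast
qed

section \<open>Lebesgue differentiation and absolutely continuous functions\<close>

text \<open>The passage from epsilon-delta to measures: \<open>N\<close> is covered by
  nonoverlapping closed intervals inside an open set of length below \<delta>, and finitely many of
  them carry little Stieltjes mass by absolute continuity.\<close>

lemma interval_measure_null_sets:
  fixes F :: "real \<Rightarrow> real"
  assumes ab: "a < b" and mono: "\<And>x y. x \<le> y \<Longrightarrow> F x \<le> F y" and cont: "continuous_on UNIV F"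
    and ac: "abs_continuous_on a b F" and N: "N \<in> null_sets lborel" "N \<subseteq> {a..b}"
  shows "N \<in> null_sets (interval_measure F)"
proof -
  let ?\<mu> = "interval_measure F"
  have Nb: "N \<in> sets borel" using N by auto
  have Icc: "emeasure ?\<mu> {u..v} = ennreal (F v - F u)" if "u \<le> v" for u v
    by (rule emeasure_interval_measure_Icc[OF that mono cont])
  have "emeasure ?\<mu> N \<le> ennreal e" if e: "0 < e" for e
  proof -
    from abs_continuous_onD[OF ac e] obtain \<delta> where \<delta>: "0 < \<delta>"
      "\<And>D. nonoverlapping a b D \<Longrightarrow> var_sum (\<lambda>x::real. x) D < \<delta> \<Longrightarrow> var_sum F D < e" by blast
    obtain U where U: "open U" "N \<subseteq> U" "emeasure lborel (U - N) < ennreal \<delta>"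
      using outer_regular_lborel[of N \<delta>] Nb \<delta>(1) by blast
    have "emeasure lborel U \<le> emeasure lborel (U - N) + emeasure lborel N"
      using U Nb by (metis Diff_partition Un_commute borel_open emeasure_subadditive sets.Diff sets_lborel)
    then have Ulen: "emeasure lborel U < ennreal \<delta>"
      using N(1) U(3) by (simp add: null_sets_def)
    have Ufm: "U \<in> fmeasurable lborel"
      using U(1) Ulen by (intro fmeasurableI) (auto simp: less_top[symmetric] dest: order.strict_trans)
    have Um: "measure lborel U < \<delta>"
      using Ulen Ufm \<delta>(1) by (metis emeasure_eq_measure2 ennreal_less_iff measure_nonneg)
    \<comment> \<open>With this gauge every box that \<open>covering_lemma\<close> attaches to a
      point of \<open>N\<close> lies inside \<open>U\<close>.\<close>
    have gauge: "gauge (\<lambda>x. if x \<in> U then U else UNIV)"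
      using U(1) by (auto simp: gauge_def)
    obtain \<D> where \<D>: "countable \<D>" "\<Union>\<D> \<subseteq> cbox a b"
      "\<And>K. K \<in> \<D> \<Longrightarrow> interior K \<noteq> {} \<and> (\<exists>c d. K = cbox c d)"
      "pairwise (\<lambda>A B. interior A \<inter> interior B = {}) \<D>"
      "\<And>K. K \<in> \<D> \<Longrightarrow> \<exists>x \<in> N \<inter> K. K \<subseteq> (if x \<in> U then U else UNIV)"
      "N \<subseteq> \<Union>\<D>"
      by (rule covering_lemma[OF _ _ gauge, of N a b]) (use N(2) ab in auto)
    have DU: "K \<subseteq> U" if "K \<in> \<D>" for K using \<D>(5)[OF that] U(2) by (auto split: if_splits)
    have Kiv: "\<exists>c d. c < d \<and> K = {c..d}" if KD: "K \<in> \<D>" for K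
    proof -
      obtain c d where K: "K = {c..d}" "interior K \<noteq> {}" using \<D>(3)[OF KD] by (metis box_real(2))
      then have "c < d" by (auto simp: interior_atLeastAtMost_real)
      with K show ?thesis by blast
    qed
    \<comment> \<open>Absolute continuity speaks of finite families only; the countable union is
      reached afterwards through \<open>measure_UN_bound\<close>.\<close>
    have bound: "measure ?\<mu> (\<Union>K\<in>\<D>'. K) \<le> e" if D': "\<D>' \<subseteq> \<D>" "finite \<D>'" for \<D>'
    proof -
      define P where "P = {(c, d). c < d \<and> {c..d} \<in> \<D>'}"
      have inj: "inj_on (\<lambda>(c, d). {c..d}) P"
        by (rule inj_onI) (auto simp: P_def Icc_eq_Icc)
      have img: "(\<lambda>(c, d). {c..d}) ` P = \<D>'"
        using Kiv D' unfolding P_def image_def by fast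
      have finP: "finite P" using inj img D'(2) by (metis finite_imageD)
      have nP: "nonoverlapping a b P"
        unfolding nonoverlapping_def
      proof (intro conjI finP)
        show "\<forall>(u, v)\<in>P. a \<le> u \<and> u \<le> v \<and> v \<le> b"
        proof clarify
          fix u v assume "(u, v) \<in> P"
          then have "u < v" "{u..v} \<in> \<D>" using D' by (auto simp: P_def)
          then have "{u..v} \<subseteq> cbox a b" using \<D>(2) by blast
          with \<open>u < v\<close> show "a \<le> u \<and> u \<le> v \<and> v \<le> b" by simp
        qed
        show "pairwise (\<lambda>(u, v) (u', v'). {u<..<v} \<inter> {u'<..<v'} = {}) P"
        proof (rule pairwiseI)
          fix x y assume xy: "x \<in> P" "y \<in> P" "x \<noteq> y"
          obtain u v u' v' where [simp]: "x = (u, v)" "y = (u', v')" by (cases x, cases y)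
          have "x = y" if "{u..v} = {u'..v'}" using inj_onD[OF inj _ xy(1,2)] that by simp
          then have "{u..v} \<noteq> {u'..v'}" using xy(3) by blast
          moreover have "{u..v} \<in> \<D>" "{u'..v'} \<in> \<D>" using D' xy by (auto simp: P_def)
          ultimately have "interior {u..v} \<inter> interior {u'..v'} = {}"
            using pairwiseD[OF \<D>(4)] by blast
          then show "(case x of (u, v) \<Rightarrow> \<lambda>(u', v'). {u<..<v} \<inter> {u'<..<v'} = {}) y"
            by (simp add: interior_atLeastAtMost_real)
        qed
      qed
      have "var_sum (\<lambda>x::real. x) P \<le> measure lborel U"
      proof (rule nonoverlapping_length_le_measure[OF nP Ufm])
        fix u v assume "(u, v) \<in> P"
        then have "{u..v} \<subseteq> U" using DU D' by (auto simp: P_def)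
        then show "{u<..<v} \<subseteq> U" by auto
      qed
      then have "var_sum F P < e" using \<delta>(2)[OF nP] Um by simp
      moreover have "measure ?\<mu> (\<Union>K\<in>\<D>'. K) \<le> var_sum F P"
      proof -
        have "(\<Union>K\<in>\<D>'. K) = (\<Union>p\<in>P. {fst p..snd p})"
          unfolding img[symmetric] by (simp add: case_prod_unfold)
        moreover have "measure ?\<mu> (\<Union>p\<in>P. {fst p..snd p}) \<le> (\<Sum>p\<in>P. measure ?\<mu> {fst p..snd p})"
        proof (rule measure_subadditive_finite[OF finP])
          fix p assume "p \<in> P"
          then have "fst p \<le> snd p" by (auto simp: P_def)
          then show "emeasure ?\<mu> {fst p..snd p} \<noteq> \<infinity>" by (simp add: Icc)
        qed auto
        ultimately have "measure ?\<mu> (\<Union>K\<in>\<D>'. K) \<le> (\<Sum>p\<in>P. measure ?\<mu> {fst p..snd p})"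
          by simp
        also have "\<dots> = var_sum F P"
          unfolding var_sum_def
          by (intro sum.cong) (auto simp: P_def measure_def Icc mono less_imp_le)
        finally show ?thesis .
      qed
      ultimately show ?thesis by simp
    qed
    have fm: "K \<in> fmeasurable ?\<mu>" if "K \<in> \<D>" for K
      using Kiv[OF that] Icc by (auto intro!: fmeasurableI)
    have "(\<Union>K\<in>\<D>. K) \<in> fmeasurable ?\<mu>" "measure ?\<mu> (\<Union>K\<in>\<D>. K) \<le> e"
      using fmeasurable_UN_bound[OF \<D>(1) fm bound] measure_UN_bound[OF \<D>(1) fm bound] e by auto
    then have "emeasure ?\<mu> (\<Union>K\<in>\<D>. K) \<le> ennreal e"
      by (simp add: emeasure_eq_measure2 ennreal_leI)
    moreover have "emeasure ?\<mu> N \<le> emeasure ?\<mu> (\<Union>K\<in>\<D>. K)"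
      using \<D>(6) \<open>(\<Union>K\<in>\<D>. K) \<in> fmeasurable ?\<mu>\<close> by (intro emeasure_mono) auto
    ultimately show ?thesis by simp
  qed
  then have "emeasure ?\<mu> N \<le> 0 + ennreal e" if "0 < e" for e using that by simp
  then have "emeasure ?\<mu> N \<le> 0" by (rule ennreal_le_epsilon)
  then show ?thesis using Nb by (auto simp: null_sets_def)
qed

text \<open>The density is the Radon-Nikodym derivative of the Stieltjes measure of
  \<open>F\<close>. Constancy outside \<open>{a..b}\<close> makes that measure finite and lets
  absolute continuity on \<open>{a..b}\<close> suffice.\<close>

lemma mono_abs_continuous_density:
  fixes F :: "real \<Rightarrow> real"
  assumes ab: "a < b" and mono: "\<And>x y. x \<le> y \<Longrightarrow> F x \<le> F y" and cont: "continuous_on UNIV F"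
    and ac: "abs_continuous_on a b F" and left: "\<And>x. x \<le> a \<Longrightarrow> F x = F a" and right: "\<And>x. b \<le> x \<Longrightarrow> F x = F b"
  obtains g :: "real \<Rightarrow> real" where "integrable lborel g" "\<And>u v. u \<le> v \<Longrightarrow> F v - F u = (LINT x:{u..v}|lborel. g x)"
proof -
  let ?\<mu> = "interval_measure F"
  have Icc: "emeasure ?\<mu> {u..v} = ennreal (F v - F u)" if "u \<le> v" for u v
    by (rule emeasure_interval_measure_Icc[OF that mono cont])
  have out: "- {a..b} \<in> null_sets ?\<mu>"
  proof -
    have Ioc: "emeasure ?\<mu> {u<..v} = ennreal (F v - F u)" if "u \<le> v" for u v
      using cont by (intro emeasure_interval_measure_Ioc[OF that mono])
        (auto simp: continuous_on_eq_continuous_within intro: continuous_within_subset)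
    have "{..a} = (\<Union>n::nat. {a - real n<..a})"
    proof (intro equalityI subsetI)
      fix x assume x: "x \<in> {..a}"
      obtain n :: nat where "a - x < real n" using reals_Archimedean2 by blast
      then have "x \<in> {a - real n<..a}" using x by auto
      then show "x \<in> (\<Union>n::nat. {a - real n<..a})" by blast
    qed auto
    moreover have "(\<Union>n::nat. {a - real n<..a}) \<in> null_sets ?\<mu>"
    proof (rule null_sets_UN)
      fix n :: nat
      show "{a - real n<..a} \<in> null_sets ?\<mu>"
        using left[of "a - real n"] by (simp add: null_sets_def Ioc)
    qed
    moreover have "{b<..} = (\<Union>n::nat. {b<..b + real n})"
    proof (intro equalityI subsetI)
      fix x assume x: "x \<in> {b<..}"
      obtain n :: nat where "x - b < real n" using reals_Archimedean2 by blast
      then have "x \<in> {b<..b + real n}" using x by auto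
      then show "x \<in> (\<Union>n::nat. {b<..b + real n})" by blast
    qed auto
    moreover have "(\<Union>n::nat. {b<..b + real n}) \<in> null_sets ?\<mu>"
    proof (rule null_sets_UN)
      fix n :: nat
      show "{b<..b + real n} \<in> null_sets ?\<mu>"
        using right[of "b + real n"] by (simp add: null_sets_def Ioc)
    qed
    ultimately have "{..a} \<union> {b<..} \<in> null_sets ?\<mu>" by (auto intro: null_sets.Un)
    then show ?thesis by (rule null_sets_subset) auto
  qed
  have "absolutely_continuous lborel ?\<mu>"
    unfolding absolutely_continuous_def
  proof
    fix N assume N: "N \<in> null_sets (lborel::real measure)"
    have "N \<inter> {a..b} \<in> null_sets lborel" using N by (intro null_set_Int2) auto
    then have "N \<inter> {a..b} \<in> null_sets ?\<mu>"
      by (intro interval_measure_null_sets[OF ab mono cont ac]) auto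
    moreover have "N \<inter> (- {a..b}) \<in> null_sets ?\<mu>"
      using N out by (intro null_set_Int1) auto
    ultimately have "(N \<inter> {a..b}) \<union> (N \<inter> (- {a..b})) \<in> null_sets ?\<mu>" by (rule null_sets.Un)
    then show "N \<in> null_sets ?\<mu>" by (simp add: Int_Un_distrib[symmetric])
  qed
  then obtain f where f: "f \<in> borel_measurable borel" and dens: "density lborel f = ?\<mu>"
    using sigma_finite_measure.Radon_Nikodym[OF sigma_finite_lborel, of ?\<mu>] by auto
  have em: "emeasure ?\<mu> A = (\<integral>\<^sup>+x. f x * indicator A x \<partial>lborel)" if "A \<in> sets borel" for A
    unfolding dens[symmetric] using that f by (subst emeasure_density) auto
  have "emeasure ?\<mu> UNIV = emeasure ?\<mu> {a..b} + emeasure ?\<mu> (- {a..b})"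
    by (subst plus_emeasure) (auto simp: Compl_partition)
  also have "\<dots> < \<infinity>" using out ab by (simp add: Icc null_sets_def)
  finally have fin: "(\<integral>\<^sup>+x. f x \<partial>lborel) < \<infinity>" using em[of UNIV] by simp
  \<comment> \<open>The density is \<open>ennreal\<close>-valued; its finite integral excludes
    infinite values almost everywhere, so \<open>enn2real\<close> loses nothing.\<close>
  then have AEf: "AE x in lborel. f x \<noteq> \<infinity>"
    using f by (intro nn_integral_noteq_infinite) auto
  then have AEf': "AE x in lborel. f x = ennreal (enn2real (f x))"
    by eventually_elim (auto simp: less_top)
  have "integrable lborel (\<lambda>x. enn2real (f x))"
  proof (rule integrableI_nonneg)
    have "(\<integral>\<^sup>+x. ennreal (enn2real (f x)) \<partial>lborel) = (\<integral>\<^sup>+x. f x \<partial>lborel)"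
      using AEf' by (intro nn_integral_cong_AE) (auto elim: eventually_mono)
    with fin show "(\<integral>\<^sup>+x. ennreal (enn2real (f x)) \<partial>lborel) < \<infinity>" by simp
  qed (use f in auto)
  moreover have "F v - F u = (LINT x:{u..v}|lborel. enn2real (f x))" if uv: "u \<le> v" for u v
  proof -
    have "(LINT x:{u..v}|lborel. enn2real (f x)) = enn2real (\<integral>\<^sup>+x. ennreal (indicator {u..v} x *\<^sub>R enn2real (f x)) \<partial>lborel)"
      unfolding set_lebesgue_integral_def using f by (intro integral_eq_nn_integral) auto
    also have "(\<integral>\<^sup>+x. ennreal (indicator {u..v} x *\<^sub>R enn2real (f x)) \<partial>lborel) =
      (\<integral>\<^sup>+x. f x * indicator {u..v} x \<partial>lborel)"
      using AEf' by (intro nn_integral_cong_AE) (auto elim!: eventually_mono split: split_indicator)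
    also have "\<dots> = ennreal (F v - F u)" using em[of "{u..v}"] Icc[OF uv] by simp
    finally show ?thesis using mono[OF uv] by simp
  qed
  ultimately show thesis by (rule that)
qed

text \<open>Outer regularity puts \<open>A\<close> into an open set of small \<nu>-measure. Vitali's
  lemma selects disjoint balls in it, each heavy compared with its radius, whose fivefold
  enlargements cover the exceptional points; their total length is therefore small.\<close>

lemma null_density_balls:
  fixes \<nu> :: "real measure"
  assumes fin: "finite_measure \<nu>" and sets: "sets \<nu> = sets borel" and A: "A \<in> null_sets \<nu>" and e: "0 < e"
  shows "negligible {x\<in>A. \<forall>d>0. \<exists>r. 0 < r \<and> r < d \<and> e * r < measure \<nu> (ball x r)}"
    (is "negligible ?B")
  unfolding negligible_outer_le
proof (intro allI impI)
  fix \<epsilon> :: real assume \<epsilon>: "0 < \<epsilon>"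
  interpret finite_measure \<nu> by fact
  have Ab: "A \<in> sets borel" using A sets by auto
  \<comment> \<open>A fivefold enlarged ball of radius \<open>r\<close> has length
    \<open>10 * r\<close>, whence the 10.\<close>
  define \<eta> where "\<eta> = \<epsilon> * e / 10"
  have \<eta>: "0 < \<eta>" using \<epsilon> e by (simp add: \<eta>_def)
  have "(INF U \<in> {U. A \<subseteq> U \<and> open U}. emeasure \<nu> U) = 0"
    using outer_regular[OF sets _ Ab] A by (simp add: null_sets_def)
  also have "0 < ennreal \<eta>" using \<eta> by simp
  finally obtain U where U: "A \<subseteq> U" "open U" "emeasure \<nu> U < ennreal \<eta>"
    by (auto simp: INF_less_iff)
  have Um: "measure \<nu> U < \<eta>" using U(3) \<eta> by (simp add: emeasure_eq_measure ennreal_less_iff)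
  define K where "K = {(x, r). x \<in> ?B \<and> 0 < r \<and> r < 1 \<and> ball x r \<subseteq> U \<and> e * r < measure \<nu> (ball x r)}"
  have cov: "?B \<subseteq> (\<Union>i\<in>K. ball (fst i) (snd i))"
  proof
    fix x assume x: "x \<in> ?B"
    then have "x \<in> U" using U(1) by blast
    then obtain d where d: "0 < d" "ball x d \<subseteq> U" using U(2) openE by blast
    from x have "\<forall>d>0. \<exists>r. 0 < r \<and> r < d \<and> e * r < measure \<nu> (ball x r)" by simp
    then have "\<exists>r. 0 < r \<and> r < min d 1 \<and> e * r < measure \<nu> (ball x r)" using d(1) by (metis min_less_iff_conj zero_less_one)
    then obtain r where r: "0 < r" "r < min d 1" "e * r < measure \<nu> (ball x r)"
      by blast
    then have "(x, r) \<in> K" using x d(2) by (auto simp: K_def)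
    then show "x \<in> (\<Union>i\<in>K. ball (fst i) (snd i))" using r by force
  qed
  have Kd: "0 < snd i" "ball (fst i) (snd i) \<subseteq> U" "e * snd i < measure \<nu> (ball (fst i) (snd i))" if "i \<in> K" for i
    using that by (cases i, simp add: K_def)+
  have K1: "\<And>i. i \<in> K \<Longrightarrow> 0 < snd i \<and> snd i \<le> 1"
    unfolding K_def by fastforce
  obtain C where C: "countable C" "C \<subseteq> K"
     "pairwise (\<lambda>i j. disjnt (ball (fst i) (snd i)) (ball (fst j) (snd j))) C"
     "?B \<subseteq> (\<Union>i\<in>C. ball (fst i) (5 * snd i))"
    by (rule Vitali_covering_lemma_balls[OF cov K1]) (assumption | rule that)+
  have fm: "ball (fst i) (5 * snd i) \<in> lmeasurable" if "i \<in> C" for i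
    by simp
  have bound: "measure lebesgue (\<Union>i\<in>I. ball (fst i) (5 * snd i)) \<le> \<epsilon>" if I: "I \<subseteq> C" "finite I" for I
  proof -
    have Ki: "0 < snd i" "ball (fst i) (snd i) \<subseteq> U" "e * snd i < measure \<nu> (ball (fst i) (snd i))" if "i \<in> I" for i
      using Kd[of i] that I C(2) by blast+
    have "measure lebesgue (\<Union>i\<in>I. ball (fst i) (5 * snd i)) \<le> (\<Sum>i\<in>I. measure lebesgue (ball (fst i) (5 * snd i)))"
      by (rule measure_UNION_le[OF I(2)]) simp
    also have "\<dots> \<le> (\<Sum>i\<in>I. (10 / e) * measure \<nu> (ball (fst i) (snd i)))"
    proof (rule sum_mono)
      fix i assume i: "i \<in> I"
      have "measure lebesgue (ball (fst i) (5 * snd i)) = 10 * snd i"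
        using Ki(1)[OF i] by (simp add: ball_eq_greaterThanLessThan)
      then show "measure lebesgue (ball (fst i) (5 * snd i)) \<le> (10 / e) * measure \<nu> (ball (fst i) (snd i))"
        using Ki(3)[OF i] e by (simp add: field_simps)
    qed
    also have "\<dots> = (10 / e) * measure \<nu> (\<Union>i\<in>I. ball (fst i) (snd i))"
    proof -
      have "disjoint_family_on (\<lambda>i. ball (fst i) (snd i)) I"
        unfolding disjoint_family_on_def using pairwiseD[OF C(3)] I(1) by (meson disjnt_def subsetD)
      then have "measure \<nu> (\<Union>i\<in>I. ball (fst i) (snd i)) = (\<Sum>i\<in>I. measure \<nu> (ball (fst i) (snd i)))"
        by (intro finite_measure_finite_Union I(2)) (auto simp: sets)
      then show ?thesis by (simp add: sum_distrib_left)
    qed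
    also have "\<dots> \<le> (10 / e) * measure \<nu> U"
      using e Ki(2) U(2) by (intro mult_left_mono finite_measure_mono) (auto simp: sets)
    also have "\<dots> \<le> (10 / e) * \<eta>" using Um e by (intro mult_left_mono) auto
    also have "\<dots> = \<epsilon>" using e by (simp add: \<eta>_def)
    finally show ?thesis .
  qed
  show "\<exists>T. ?B \<subseteq> T \<and> T \<in> lmeasurable \<and> measure lebesgue T \<le> \<epsilon>"
    using C(4) fmeasurable_UN_bound[OF C(1) fm bound] measure_UN_bound[OF C(1) fm bound] \<epsilon> by blast
qed

lemma set_integral_Icc_split:
  fixes g :: "real \<Rightarrow> 'e::euclidean_space"
  assumes g: "integrable lborel g" and uv: "a \<le> u" "u \<le> v"
  shows "(LINT x:{a..v}|lborel. g x) = (LINT x:{a..u}|lborel. g x) + (LINT x:{u..v}|lborel. g x)"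
proof -
  have si: "set_integrable lborel {p..q} g" for p q
    using set_integrable_subset[of lborel UNIV g "{p..q}"] g by (simp add: set_integrable_def)
  have "(LINT x:{a..v}|lborel. g x) = (LINT x:{a..<u} \<union> {u..v}|lborel. g x)"
    using uv by (simp add: ivl_disj_un)
  also have "\<dots> = (LINT x:{a..<u}|lborel. g x) + (LINT x:{u..v}|lborel. g x)"
    by (rule set_integral_Un) (auto intro: set_integrable_subset[OF si[of a u]] si)
  also have "(LINT x:{a..<u}|lborel. g x) = (LINT x:{a..u}|lborel. g x)"
  proof -
    have "AE y in lborel. indicator {a..<u} y *\<^sub>R g y = indicator {a..u} y *\<^sub>R g y"
      using AE_lborel_singleton[of u] by eventually_elim (auto split: split_indicator)
    then show ?thesis
      unfolding set_lebesgue_integral_def using g by (intro integral_cong_AE) auto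
  qed
  finally show ?thesis .
qed

text \<open>The part of \<open>s * g\<close> above a level \<open>q\<close> is the density of a
  measure vanishing where \<open>s * g \<le> q\<close>, so by \<open>null_density_balls\<close> its
  averages tend to 0 at almost every such point. Levels just above \<open>s * g x\<close> then bound
  the difference quotients at \<open>x\<close>.\<close>

lemma indefinite_integral_derivative_AE:
  fixes g :: "real \<Rightarrow> real"
  assumes g: "integrable lborel g"
  shows "AE x in lborel. a < x \<and> x < b \<longrightarrow>
    ((\<lambda>t. LINT y:{a..t}|lborel. g y) has_real_derivative g x) (at x)"
proof -
  have [measurable]: "g \<in> borel_measurable borel" using g by simp
  have si: "set_integrable lborel {u..v} g" for u v
    using set_integrable_subset[of lborel UNIV g "{u..v}"] g by (simp add: set_integrable_def)
  text \<open>The excess of \<open>s * g\<close> over the level \<open>q\<close>; the signs \<open>s = 1\<close> and \<open>s = -1\<close> give the upper and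
    the lower bound on the difference quotients.\<close>
  define k where "k s q x = indicator {a-1..b+1} x * max 0 (s * g x - q)" for s q x :: real
  have k_meas[measurable]: "k s q \<in> borel_measurable borel" for s q unfolding k_def by measurable
  have k_nonneg: "0 \<le> k s q x" for s q x by (simp add: k_def)
  have k_int: "integrable lborel (k s q)" for s q
  proof (rule Bochner_Integration.integrable_bound)
    have "integrable lborel (indicator {a-1..b+1} :: real \<Rightarrow> real)" by (intro integrable_real_indicator) (auto simp: less_top[symmetric] emeasure_lborel_Icc_eq)
    then show "integrable lborel (\<lambda>x. \<bar>s * g x\<bar> + indicator {a-1..b+1} x * \<bar>q\<bar>)"
      using g by (auto intro!: Bochner_Integration.integrable_add integrable_abs integrable_mult_right integrable_mult_left)
    show "AE x in lborel. norm (k s q x) \<le> norm (\<bar>s * g x\<bar> + indicator {a-1..b+1} x * \<bar>q\<bar>)"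
      by (rule AE_I2) (auto simp: k_def split: split_indicator)
  qed simp
  define \<nu> where "\<nu> s q = density lborel (\<lambda>x. ennreal (k s q x))" for s q
  have \<nu>_emeasure: "emeasure (\<nu> s q) A = (\<integral>\<^sup>+x. ennreal (k s q x) * indicator A x \<partial>lborel)"
    if "A \<in> sets borel" for s q A
    unfolding \<nu>_def using that by (subst emeasure_density) auto
  have \<nu>_fin: "finite_measure (\<nu> s q)" for s q
  proof (rule finite_measureI)
    have "(\<integral>\<^sup>+x. ennreal (k s q x) \<partial>lborel) = ennreal (LINT x|lborel. k s q x)"
      by (intro nn_integral_eq_integral k_int) (simp add: k_nonneg)
    then show "emeasure (\<nu> s q) (space (\<nu> s q)) \<noteq> \<infinity>"
      using \<nu>_emeasure[of UNIV s q] by (simp add: \<nu>_def)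
  qed
  have \<nu>_sets: "sets (\<nu> s q) = sets borel" for s q by (simp add: \<nu>_def)
  have \<nu>_null: "{x. s * g x \<le> q} \<in> null_sets (\<nu> s q)" for s q
  proof -
    have "emeasure (\<nu> s q) {x. s * g x \<le> q} = (\<integral>\<^sup>+x. 0 \<partial>(lborel :: real measure))"
      by (subst \<nu>_emeasure, measurable, intro nn_integral_cong) (auto simp: k_def split: split_indicator)
    then show ?thesis by (auto simp: null_sets_def \<nu>_sets)
  qed
  have \<nu>_measure: "(LINT x:{u..v}|lborel. k s q x) = measure (\<nu> s q) {u..v}" for s q u v
  proof -
    have "(LINT x:{u..v}|lborel. k s q x) = enn2real (\<integral>\<^sup>+x. ennreal (indicator {u..v} x *\<^sub>R k s q x) \<partial>lborel)"
      unfolding set_lebesgue_integral_def by (intro integral_eq_nn_integral) (auto simp: k_nonneg)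
    also have "(\<integral>\<^sup>+x. ennreal (indicator {u..v} x *\<^sub>R k s q x) \<partial>lborel) = emeasure (\<nu> s q) {u..v}"
      by (subst \<nu>_emeasure) (auto intro!: nn_integral_cong split: split_indicator)
    finally show ?thesis by (simp add: measure_def)
  qed
  define bad where "bad s q e = {x\<in>{x. s * g x \<le> q}. \<forall>d>0. \<exists>r. 0 < r \<and> r < d \<and> e * r < measure (\<nu> s q) (ball x r)}"
    for s q e
  \<comment> \<open>Rational levels and reciprocals of integers keep the exceptional set a countable
    union.\<close>
  let ?Bad = "\<Union>s\<in>{1, -1}. \<Union>q\<in>\<rat>. \<Union>n::nat. bad s q (1 / real (Suc n))"
  have "bad s q (1 / real (Suc n)) \<in> null_sets lebesgue" for s q n
    unfolding bad_def negligible_iff_null_sets[symmetric]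
    by (rule null_density_balls[OF \<nu>_fin \<nu>_sets \<nu>_null]) simp
  then have "?Bad \<in> null_sets lebesgue"
    by (intro null_sets_UN' countable_rat) auto
  then have "AE x in lebesgue. x \<notin> ?Bad"
    by (rule AE_not_in)
  then have "AE x in lborel. x \<notin> ?Bad" by (simp add: AE_completion_iff)
  then show ?thesis
  proof eventually_elim
    fix x assume x: "x \<notin> ?Bad"
    show "a < x \<and> x < b \<longrightarrow> ((\<lambda>t. LINT y:{a..t}|lborel. g y) has_real_derivative g x) (at x)"
    proof
      assume ab: "a < x \<and> x < b"
      let ?I = "\<lambda>u v. LINT y:{u..v}|lborel. g y"
      have upper: "\<exists>d>0. \<forall>u v. u \<le> v \<and> v - u < d \<and> (u = x \<or> v = x) \<longrightarrow> s * ?I u v \<le> (s * g x + \<epsilon>) * (v - u)"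
        if s: "s \<in> {1, -1}" and \<epsilon>: "0 < \<epsilon>" for s \<epsilon>
      proof -
        \<comment> \<open>Half of \<epsilon> goes to the level. The other half goes to the excess,
          measured on a ball of radius \<open>2 * (v - u)\<close>, whence the quarter below.\<close>
        obtain q where q: "q \<in> \<rat>" "s * g x < q" "q < s * g x + \<epsilon> / 2"
          using Rats_dense_in_real[of "s * g x" "s * g x + \<epsilon> / 2"] \<epsilon> by auto
        obtain n where n: "1 / real (Suc n) < \<epsilon> / 4"
          using nat_approx_posE[of "\<epsilon> / 4"] \<epsilon> by auto
        have "x \<notin> bad s q (1 / real (Suc n))" using x s q(1) by blast
        then have "\<not> (\<forall>d>0. \<exists>r. 0 < r \<and> r < d \<and> 1 / real (Suc n) * r < measure (\<nu> s q) (ball x r))"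
          using q(2) unfolding bad_def by simp
        then obtain d where d: "0 < d" "\<And>r. 0 < r \<Longrightarrow> r < d \<Longrightarrow> measure (\<nu> s q) (ball x r) \<le> 1 / real (Suc n) * r"
          by (meson not_less)
        show ?thesis
        \<comment> \<open>Length below \<open>d / 2\<close> makes the radius
          \<open>2 * (v - u)\<close> admissible; length below 1 keeps the interval inside
          \<open>{a-1..b+1}\<close>, where \<open>k\<close> is not cut off.\<close>
        proof (intro exI[of _ "min (d / 2) 1"] conjI allI impI)
          fix u v assume uv: "u \<le> v \<and> v - u < min (d / 2) 1 \<and> (u = x \<or> v = x)"
          show "s * ?I u v \<le> (s * g x + \<epsilon>) * (v - u)"
          proof (cases "u = v")
            case True
            have "AE y in lborel. indicator {v..v} y *\<^sub>R g y = 0"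
              using AE_lborel_singleton[of v] by eventually_elim auto
            then have "?I v v = 0"
              unfolding set_lebesgue_integral_def by (rule integral_eq_zero_AE)
            then show ?thesis using True by simp
          next
            case False
            then have lt: "u < v" using uv by simp
            have sik: "set_integrable lborel {u..v} (k s q)"
              using set_integrable_subset[of lborel UNIV "k s q" "{u..v}"] k_int by (simp add: set_integrable_def)
            have "integrable lborel (indicator {u..v} :: real \<Rightarrow> real)"
              by (intro integrable_real_indicator) (auto simp: emeasure_lborel_Icc_eq)
            then have sic: "set_integrable lborel {u..v} (\<lambda>y. q)"
              unfolding set_integrable_def by simp
            have "(LINT y:{u..v}|lborel. q) = q * (v - u)"
              using lt by (simp add: set_lebesgue_integral_def)
            then have int_add: "(LINT y:{u..v}|lborel. q + k s q y) = q * (v - u) + measure (\<nu> s q) {u..v}"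
              using set_integral_add(2)[OF sic sik] by (simp only: \<nu>_measure)
            have "s * ?I u v = (LINT y:{u..v}|lborel. s * g y)"
              by (simp add: set_integral_mult_right)
            also have "\<dots> \<le> (LINT y:{u..v}|lborel. q + k s q y)"
            proof (rule set_integral_mono)
              show "set_integrable lborel {u..v} (\<lambda>y. s * g y)" using si by (rule set_integrable_mult_right)
              show "set_integrable lborel {u..v} (\<lambda>y. q + k s q y)"
                using sik sic by (intro set_integral_add)
              show "s * g y \<le> q + k s q y" if "y \<in> {u..v}" for y
                using that uv ab by (auto simp: k_def)
            qed
            also have "\<dots> = q * (v - u) + measure (\<nu> s q) {u..v}"
              by (rule int_add)
            also have "measure (\<nu> s q) {u..v} \<le> measure (\<nu> s q) (ball x (2 * (v - u)))"
              using \<nu>_sets lt uv by (intro finite_measure.finite_measure_mono[OF \<nu>_fin]) (auto simp: dist_real_def)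
            also have "\<dots> \<le> 1 / real (Suc n) * (2 * (v - u))"
              using d(2)[of "2 * (v - u)"] lt uv by simp
            also have "\<dots> \<le> (\<epsilon> / 4) * (2 * (v - u))"
              using n lt by (intro mult_right_mono) auto
            also have "q * (v - u) + (\<epsilon> / 4) * (2 * (v - u)) = (q + \<epsilon> / 2) * (v - u)"
              by (simp add: field_simps)
            also have "\<dots> \<le> (s * g x + \<epsilon>) * (v - u)"
              using q(3) lt by (intro mult_right_mono) auto
            finally show ?thesis by simp
          qed
        qed (use d in auto)
      qed
      have I_diff: "?I a v - ?I a u = ?I u v" if "a \<le> u" "u \<le> v" for u v
        using set_integral_Icc_split[OF g that] by simp
      show "((\<lambda>t. ?I a t) has_real_derivative g x) (at x)"
        unfolding has_field_derivative_iff LIM_eq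
      proof (intro allI impI)
        fix \<epsilon> :: real assume \<epsilon>: "0 < \<epsilon>"
        obtain d1 where d1: "0 < d1" "\<And>u v. u \<le> v \<and> v - u < d1 \<and> (u = x \<or> v = x) \<Longrightarrow> ?I u v \<le> (g x + \<epsilon> / 2) * (v - u)"
          using upper[of 1 "\<epsilon> / 2"] \<epsilon> by auto
        obtain d2 where d2: "0 < d2" "\<And>u v. u \<le> v \<and> v - u < d2 \<and> (u = x \<or> v = x) \<Longrightarrow> - ?I u v \<le> (- g x + \<epsilon> / 2) * (v - u)"
          using upper[of "-1" "\<epsilon> / 2"] \<epsilon> by auto
        have key: "\<bar>?I u v / (v - u) - g x\<bar> \<le> \<epsilon> / 2" if "u < v" "v - u < min d1 d2" "u = x \<or> v = x" for u v
        proof -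
          have "?I u v / (v - u) \<le> g x + \<epsilon> / 2" 
            using d1(2)[of u v] that by (simp add: field_simps)
          moreover have "g x - \<epsilon> / 2 \<le> ?I u v / (v - u)"
            using d2(2)[of u v] that by (simp add: field_simps)
          ultimately show ?thesis by linarith
        qed
        show "\<exists>s>0. \<forall>y. y \<noteq> x \<and> norm (y - x) < s \<longrightarrow> norm ((?I a y - ?I a x) / (y - x) - g x) < \<epsilon>"
        proof (intro exI[of _ "min (min d1 d2) (x - a)"] conjI allI impI)
          fix y assume y: "y \<noteq> x \<and> norm (y - x) < min (min d1 d2) (x - a)"
          show "norm ((?I a y - ?I a x) / (y - x) - g x) < \<epsilon>"
          proof (cases "x < y")
            case True
            then show ?thesis using key[of x y] I_diff[of x y] y ab \<epsilon> by auto
          next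
            case False
            then have "(?I a y - ?I a x) / (y - x) = ?I y x / (x - y)"
              using I_diff[of y x] y by (simp add: field_simps)
            then show ?thesis using key[of y x] False y \<epsilon> by auto
          qed
        qed (use d1 d2 ab in auto)
      qed
    qed
  qed
qed

text \<open>Jordan decomposition \<open>f = V - (V - f)\<close>, with \<open>V\<close> the variation
  from \<open>a\<close>: both terms are nondecreasing and absolutely continuous, so each has a
  density.\<close>

lemma abs_continuous_on_FTC_real:
  fixes f :: "real \<Rightarrow> real"
  assumes f: "abs_continuous_on a b f" and ab: "a < b"
  obtains g where "integrable lborel g" "\<And>t. t \<in> {a..b} \<Longrightarrow> f t = f a + (LINT x:{a..t}|lborel. g x)"
    "AE x in lborel. a < x \<and> x < b \<longrightarrow> (f has_real_derivative g x) (at x)"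
proof -
  \<comment> \<open>Clamping the argument extends a function on \<open>{a..b}\<close> by constants,
    as \<open>mono_abs_continuous_density\<close> demands.\<close>
  define c where "c x = max a (min b x)" for x
  have c: "c x \<in> {a..b}" "x \<le> y \<Longrightarrow> c x \<le> c y" "x \<in> {a..b} \<Longrightarrow> c x = x" for x y
    using ab by (auto simp: c_def)
  have c_out: "x \<le> a \<Longrightarrow> c x = a" "b \<le> x \<Longrightarrow> c x = b" for x
    using ab by (auto simp: c_def)
  have c_cont: "continuous_on UNIV c" unfolding c_def by (intro continuous_intros)
  let ?V = "variation f a"
  have incr: "\<bar>f v - f u\<bar> \<le> ?V v - ?V u" if "a \<le> u" "u \<le> v" "v \<le> b" for u v
  proof -
    have "?V v = ?V u + variation f u v"
      using abs_continuous_on_subinterval[OF f] that by (intro variation_additive) auto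
    moreover have "norm (f v - f u) \<le> variation f u v"
      using abs_continuous_on_subinterval[OF f] that by (intro norm_diff_le_variation) auto
    ultimately show ?thesis by simp
  qed
  have density: "\<exists>g. integrable lborel g \<and> (\<forall>u v. a \<le> u \<and> u \<le> v \<and> v \<le> b \<longrightarrow> h v - h u = (LINT x:{u..v}|lborel. g x))"
    if ac: "abs_continuous_on a b h" and mono: "\<And>u v. a \<le> u \<Longrightarrow> u \<le> v \<Longrightarrow> v \<le> b \<Longrightarrow> h u \<le> h v"
    for h :: "real \<Rightarrow> real"
  proof -
    obtain g where g: "integrable lborel g" "\<And>u v. u \<le> v \<Longrightarrow> h (c v) - h (c u) = (LINT x:{u..v}|lborel. g x)"
    proof (rule mono_abs_continuous_density[OF ab, of "\<lambda>x. h (c x)"])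
      show "h (c x) \<le> h (c y)" if "x \<le> y" for x y
        using mono[of "c x" "c y"] c(1)[of x] c(1)[of y] c(2)[OF that] by auto
      show "continuous_on UNIV (\<lambda>x. h (c x))"
        by (rule continuous_on_compose2[OF abs_continuous_on_imp_continuous_on[OF ac] c_cont]) (use c(1) in auto)
      show "abs_continuous_on a b (\<lambda>x. h (c x))"
        by (rule abs_continuous_on_dominated[OF ac zero_less_one]) (simp add: c(3))
    qed (use c_out in auto)
    show ?thesis using g(1) g(2)[of u v for u v] c(3) by (intro exI[of _ g]) force
  qed
  have "?V u \<le> ?V v" if "a \<le> u" "u \<le> v" "v \<le> b" for u v
    using incr[OF that] by linarith
  from density[OF abs_continuous_on_variation[OF f] this]
  obtain g1 where g1: "integrable lborel g1"
    "\<forall>u v. a \<le> u \<and> u \<le> v \<and> v \<le> b \<longrightarrow> ?V v - ?V u = (LINT x:{u..v}|lborel. g1 x)"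
    by blast
  have W: "abs_continuous_on a b (\<lambda>x. ?V x + - f x)"
    by (intro abs_continuous_on_add abs_continuous_on_variation f
        abs_continuous_on_bounded_linear[OF f] bounded_linear_minus bounded_linear_ident)
  have "?V u + - f u \<le> ?V v + - f v" if "a \<le> u" "u \<le> v" "v \<le> b" for u v
    using incr[OF that] by linarith
  from density[OF W this]
  obtain g2 where g2: "integrable lborel g2"
    "\<forall>u v. a \<le> u \<and> u \<le> v \<and> v \<le> b \<longrightarrow> (?V v + - f v) - (?V u + - f u) = (LINT x:{u..v}|lborel. g2 x)"
    by blast
  define g where "g x = g1 x - g2 x" for x
  have g_int: "integrable lborel g" using Bochner_Integration.integrable_diff[OF g1(1) g2(1)] by (simp add: g_def[abs_def])
  have f_eq: "f t = f a + (LINT x:{a..t}|lborel. g x)" if t: "t \<in> {a..b}" for t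
  proof -
    have "set_integrable lborel {a..t} g1" "set_integrable lborel {a..t} g2"
      using set_integrable_subset[of lborel UNIV g1 "{a..t}"] set_integrable_subset[of lborel UNIV g2 "{a..t}"]
        g1(1) g2(1) by (auto simp: set_integrable_def)
    then have "(LINT x:{a..t}|lborel. g x) = (LINT x:{a..t}|lborel. g1 x) - (LINT x:{a..t}|lborel. g2 x)"
      unfolding g_def by (rule set_integral_diff)
    then show ?thesis using g1(2)[rule_format, of a t] g2(2)[rule_format, of a t] t by simp
  qed
  have "AE x in lborel. a < x \<and> x < b \<longrightarrow> (f has_real_derivative g x) (at x)"
    using indefinite_integral_derivative_AE[OF g_int, of a b]
  proof eventually_elim
    case (elim x)
    show ?case
    proof
      assume x: "a < x \<and> x < b"
      then have "((\<lambda>t. f a + (LINT y:{a..t}|lborel. g y)) has_real_derivative 0 + g x) (at x)"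
        using elim by (intro DERIV_add DERIV_const) auto
      then have "((\<lambda>t. f a + (LINT y:{a..t}|lborel. g y)) has_real_derivative g x) (at x)"
        by simp
      then show "(f has_real_derivative g x) (at x)"
        by (rule has_field_derivative_transform_within_open[where S="{a<..<b}"]) (use x in \<open>auto simp: f_eq[symmetric]\<close>)
    qed
  qed
  then show thesis using that g_int f_eq by blast
qed

text \<open>Coordinate by coordinate; the finitely many exceptional null sets are united.\<close>

theorem abs_continuous_on_FTC:
  fixes f :: "real \<Rightarrow> 'e::euclidean_space"
  assumes f: "abs_continuous_on a b f" and ab: "a < b"
  shows "\<exists>g. integrable lborel g \<and> (\<forall>t\<in>{a..b}. f t = f a + (LINT x:{a..t}|lborel. g x)) \<and>
    (AE x in lborel. a < x \<and> x < b \<longrightarrow> (f has_vector_derivative g x) (at x))"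
proof -
  define P where "P k g \<longleftrightarrow> integrable lborel g \<and> (\<forall>t\<in>{a..b}. f t \<bullet> k = f a \<bullet> k + (LINT x:{a..t}|lborel. g x)) \<and>
    (AE x in lborel. a < x \<and> x < b \<longrightarrow> ((\<lambda>t. f t \<bullet> k) has_real_derivative g x) (at x))" for k and g :: "real \<Rightarrow> real"
  have "\<exists>g. P k g" for k
    unfolding P_def
    by (rule abs_continuous_on_FTC_real[OF abs_continuous_on_bounded_linear[OF f bounded_linear_inner_left[of k]] ab]) blast
  then obtain G where G': "\<forall>k. P k (G k)" using choice[of P] by blast
  have G: "\<And>k. integrable lborel (G k)"
    "\<And>k t. t \<in> {a..b} \<Longrightarrow> f t \<bullet> k = f a \<bullet> k + (LINT x:{a..t}|lborel. G k x)"
    "\<And>k. AE x in lborel. a < x \<and> x < b \<longrightarrow> ((\<lambda>t. f t \<bullet> k) has_real_derivative G k x) (at x)"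
    using G' unfolding P_def by blast+
  define g where "g x = (\<Sum>k\<in>Basis. G k x *\<^sub>R k)" for x
  have gk: "g x \<bullet> k = G k x" if "k \<in> Basis" for x k
    using that by (simp add: g_def)
  have g_int: "integrable lborel g"
    unfolding g_def[abs_def] using G(1) by (intro Bochner_Integration.integrable_sum integrable_scaleR_left) auto
  have "f t = f a + (LINT x:{a..t}|lborel. g x)" if t: "t \<in> {a..b}" for t
  proof (rule euclidean_eqI)
    fix k :: 'e assume k: "k \<in> Basis"
    have "set_integrable lborel {a..t} g"
      using set_integrable_subset[of lborel UNIV g "{a..t}"] g_int by (auto simp: set_integrable_def)
    then have "(LINT x:{a..t}|lborel. g x) \<bullet> k = (LINT x:{a..t}|lborel. G k x)"
      unfolding set_lebesgue_integral_def set_integrable_def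
      by (subst integral_inner_left[symmetric]) (auto simp: gk[OF k])
    then show "f t \<bullet> k = (f a + (LINT x:{a..t}|lborel. g x)) \<bullet> k"
      using G(2)[OF t, of k] by (simp add: inner_add_left)
  qed
  moreover have "AE x in lborel. a < x \<and> x < b \<longrightarrow> (f has_vector_derivative g x) (at x)"
  proof -
    have "AE x in lborel. \<forall>k\<in>(Basis::'e set). a < x \<and> x < b \<longrightarrow> ((\<lambda>t. f t \<bullet> k) has_real_derivative G k x) (at x)"
      using G(3) by (intro AE_finite_allI) auto
    then show ?thesis
    proof eventually_elim
      case (elim x)
      show ?case
      proof
        assume "a < x \<and> x < b"
        then have "((\<lambda>t. f t \<bullet> k) has_derivative (\<lambda>h. (h *\<^sub>R g x) \<bullet> k)) (at x)" if "k \<in> Basis" for k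
          using elim that by (auto simp: has_field_derivative_def gk mult_commute_abs)
        then show "(f has_vector_derivative g x) (at x)"
          unfolding has_vector_derivative_def by (subst has_derivative_componentwise_within) auto
      qed
    qed
  qed
  ultimately show ?thesis using g_int by blast
qed

section \<open>Curves of finite action\<close>

text \<open>A monotone \<open>f\<close> sends the members to intervals with disjoint interiors
  inside \<open>{f a..f b}\<close>, so lengths can be compared as measures.\<close>

lemma var_sum_mono_le:
  fixes f :: "real \<Rightarrow> real"
  assumes F: "nonoverlapping a b F" and ab: "a \<le> b"
    and mono: "\<And>u v. a \<le> u \<Longrightarrow> u \<le> v \<Longrightarrow> v \<le> b \<Longrightarrow> f u \<le> f v"
  shows "var_sum f F \<le> f b - f a"
proof -
  have fin: "finite F" using F by (simp add: nonoverlapping_def)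
  have uv: "a \<le> fst p" "fst p \<le> snd p" "snd p \<le> b" if "p \<in> F" for p
    using F that by (auto simp: nonoverlapping_def)
  have le: "f (fst p) \<le> f (snd p)" if "p \<in> F" for p
    using mono uv[OF that] by simp
  have disj: "disjoint_family_on (\<lambda>p. {f (fst p)<..<f (snd p)}) F"
    unfolding disjoint_family_on_def
  proof (intro ballI impI)
    fix p q assume pq: "p \<in> F" "q \<in> F" "p \<noteq> q"
    have d: "{fst p<..<snd p} \<inter> {fst q<..<snd q} = {}"
      using F pq unfolding nonoverlapping_def pairwise_def by (auto simp: case_prod_unfold)
    consider "fst p = snd p" | "fst q = snd q" | "snd p \<le> fst q" | "snd q \<le> fst p"
    proof -
      have False if "fst p < snd p" "fst q < snd q" "fst q < snd p" "fst p < snd q"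
      proof -
        obtain z where "max (fst p) (fst q) < z" "z < min (snd p) (snd q)"
          using dense[of "max (fst p) (fst q)" "min (snd p) (snd q)"] \<open>fst p < snd p\<close> \<open>fst q < snd q\<close>
            \<open>fst q < snd p\<close> \<open>fst p < snd q\<close> by auto
        then have "z \<in> {fst p<..<snd p} \<inter> {fst q<..<snd q}" by simp
        with d show False by blast
      qed
      then show thesis using that uv(2)[OF pq(1)] uv(2)[OF pq(2)] by fastforce
    qed
    then show "{f (fst p)<..<f (snd p)} \<inter> {f (fst q)<..<f (snd q)} = {}"
    proof cases
      case 3
      then have "f (snd p) \<le> f (fst q)" using mono uv[OF pq(1)] uv[OF pq(2)] by simp
      then show ?thesis by auto
    next
      case 4
      then have "f (snd q) \<le> f (fst p)" using mono uv[OF pq(1)] uv[OF pq(2)] by simp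
      then show ?thesis by auto
    qed auto
  qed
  have "var_sum f F = (\<Sum>p\<in>F. measure lborel {f (fst p)<..<f (snd p)})"
    unfolding var_sum_def using le by (intro sum.cong) (auto simp: case_prod_unfold)
  also have "\<dots> = measure lborel (\<Union>p\<in>F. {f (fst p)<..<f (snd p)})"
    using fin disj le by (intro measure_finite_Union[symmetric]) (auto simp: emeasure_lborel_Ioo)
  also have "\<dots> \<le> measure lborel {f a..f b}"
  proof (rule measure_mono_fmeasurable)
    show "(\<Union>p\<in>F. {f (fst p)<..<f (snd p)}) \<subseteq> {f a..f b}"
    proof (intro UN_least)
      fix p assume "p \<in> F"
      then have "f a \<le> f (fst p)" "f (snd p) \<le> f b" using mono uv[OF \<open>p \<in> F\<close>] by auto
      then show "{f (fst p)<..<f (snd p)} \<subseteq> {f a..f b}" by auto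
    qed
    show "(\<Union>p\<in>F. {f (fst p)<..<f (snd p)}) \<in> sets lborel"
      using fin by (intro sets.finite_UN) auto
  qed (simp add: fmeasurable_cbox flip: box_real)
  also have "\<dots> = f b - f a" using mono[of a b] ab by simp
  finally show ?thesis .
qed

text \<open>Near the end points the variation of a monotone function is at most its increment, so
  absolute continuity is required only on inner intervals. This covers powers whose derivative is
  unbounded at an end point.\<close>

lemma abs_continuous_on_mono:
  fixes f :: "real \<Rightarrow> real"
  assumes ab: "a \<le> b" and mono: "\<And>u v. a \<le> u \<Longrightarrow> u \<le> v \<Longrightarrow> v \<le> b \<Longrightarrow> f u \<le> f v"
    and inner: "\<And>\<epsilon>. 0 < \<epsilon> \<Longrightarrow> \<exists>c d. a \<le> c \<and> c \<le> d \<and> d \<le> b \<and> abs_continuous_on c d f \<and> f c - f a < \<epsilon> \<and> f b - f d < \<epsilon>"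
  shows "abs_continuous_on a b f"
  unfolding abs_continuous_on_altdef
proof (intro allI impI)
  fix \<epsilon> :: real assume "0 < \<epsilon>"
  then have e: "0 < \<epsilon> / 3" by simp
  from inner[OF e] obtain c d where cd: "a \<le> c" "c \<le> d" "d \<le> b" "abs_continuous_on c d f"
    "f c - f a < \<epsilon> / 3" "f b - f d < \<epsilon> / 3" by blast
  from abs_continuous_onD[OF cd(4) e] obtain \<delta> where \<delta>: "0 < \<delta>"
    "\<And>F. nonoverlapping c d F \<Longrightarrow> var_sum (\<lambda>x::real. x) F < \<delta> \<Longrightarrow> var_sum f F < \<epsilon> / 3" by blast
  have cb: "c \<le> b" using cd by simp
  have "var_sum f F < \<epsilon>" if F: "nonoverlapping a b F" "var_sum (\<lambda>x::real. x) F < \<delta>" for F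
  proof -
    let ?G = "clamp_family c b F"
    note G = clamp_family(1)[OF F(1) cb]
    have "var_sum f F \<le> var_sum f (clamp_family a c F) + var_sum f ?G"
      by (rule var_sum_split[OF F(1) cd(1) cb])
    moreover have "var_sum f ?G \<le> var_sum f (clamp_family c d ?G) + var_sum f (clamp_family d b ?G)"
      by (rule var_sum_split[OF G cd(2,3)])
    moreover have "var_sum f (clamp_family a c F) \<le> f c - f a"
      using clamp_family(1)[OF F(1) cd(1)] cd by (intro var_sum_mono_le mono) auto
    moreover have "var_sum f (clamp_family d b ?G) \<le> f b - f d"
      using clamp_family(1)[OF G cd(3)] cd by (intro var_sum_mono_le mono) auto
    moreover have "var_sum f (clamp_family c d ?G) < \<epsilon> / 3"
      using clamp_family(1)[OF G cd(2)] clamp_family_length_le[OF G cd(2)]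
        clamp_family_length_le[OF F(1) cb] F(2) by (intro \<delta>(2)) auto
    ultimately show ?thesis using cd(5,6) by linarith
  qed
  with \<delta>(1) show "\<exists>\<delta>>0. \<forall>F. nonoverlapping a b F \<and> var_sum (\<lambda>x::real. x) F < \<delta> \<longrightarrow> var_sum f F < \<epsilon>"
    by blast
qed

text \<open>The derivative decreases, so its value at \<open>c\<close> bounds it to the right of
  \<open>c\<close>.\<close>

lemma powr_three_quarters_lipschitz:
  fixes c u v :: real
  assumes "0 < c" "c \<le> u" "u \<le> v"
  shows "\<bar>v powr (3/4) - u powr (3/4)\<bar> \<le> (3/4) * c powr (-1/4) * (v - u)"
proof (cases "u = v")
  case False
  then have "u < v" using assms by simp
  have der: "((\<lambda>x. x powr (3/4)) has_real_derivative (3/4) * x powr (3/4 - 1)) (at x)" if "u \<le> x" "x \<le> v" for x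
    using assms that by (intro has_real_derivative_powr) auto
  obtain z where z: "u < z" "z < v" "v powr (3/4) - u powr (3/4) = (v - u) * ((3/4) * z powr (3/4 - 1))"
    using MVT2[OF \<open>u < v\<close> der] by blast
  have "\<bar>v powr (3/4) - u powr (3/4)\<bar> = (v - u) * ((3/4) * z powr (3/4 - 1))"
    unfolding z(3) using \<open>u < v\<close> by (intro abs_of_nonneg mult_nonneg_nonneg) auto
  also have "z powr (3/4 - 1) \<le> c powr (3/4 - 1)"
    using z assms by (intro powr_mono2') auto
  finally show ?thesis using \<open>u < v\<close> by (simp add: mult_ac)
qed simp

lemma small_power_three_quarters:
  fixes \<epsilon> :: real
  assumes "0 < \<epsilon>"
  obtains c where "0 < c" "c < 1" "c powr (3/4) < \<epsilon>"
proof -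
  define c where "c = min (1/2) ((\<epsilon>/2) powr (4/3))"
  have "c powr (3/4) \<le> ((\<epsilon>/2) powr (4/3)) powr (3/4)"
    using assms by (intro powr_mono2) (auto simp: c_def)
  also have "\<dots> < \<epsilon>" using assms by (simp add: powr_powr)
  finally show thesis using assms by (intro that[of c]) (auto simp: c_def)
qed

lemma abs_continuous_on_powr_left: "abs_continuous_on (-1) 0 (\<lambda>t. (1 + t) powr (3/4))"
proof (rule abs_continuous_on_mono)
  fix \<epsilon> :: real assume "0 < \<epsilon>"
  then obtain c where c: "0 < c" "c < 1" "c powr (3/4) < \<epsilon>"
    using small_power_three_quarters by blast
  have "abs_continuous_on (c - 1) 0 (\<lambda>t. (1 + t) powr (3/4))"
    using powr_three_quarters_lipschitz[OF c(1), of "1 + u" "1 + v" for u v]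
    by (intro abs_continuous_on_lipschitz[where C="(3/4) * c powr (-1/4)"]) force
  then show "\<exists>c d. - 1 \<le> c \<and> c \<le> d \<and> d \<le> 0 \<and> abs_continuous_on c d (\<lambda>t. (1 + t) powr (3/4)) \<and>
      (1 + c) powr (3/4) - (1 + - 1) powr (3/4) < \<epsilon> \<and> (1 + 0) powr (3/4) - (1 + d) powr (3/4) < \<epsilon>"
    using c \<open>0 < \<epsilon>\<close> by (intro exI[of _ "c - 1"] exI[of _ 0]) auto
qed (auto intro: powr_mono2)

lemma abs_continuous_on_powr_right: "abs_continuous_on 0 1 (\<lambda>t. (1 - t) powr (3/4))"
proof -
  have "abs_continuous_on 0 1 (\<lambda>t. - ((1 - t) powr (3/4)))"
  proof (rule abs_continuous_on_mono)
    fix \<epsilon> :: real assume "0 < \<epsilon>"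
    then obtain c where c: "0 < c" "c < 1" "c powr (3/4) < \<epsilon>"
    using small_power_three_quarters by blast
    have "abs_continuous_on 0 (1 - c) (\<lambda>t. - ((1 - t) powr (3/4)))"
      using powr_three_quarters_lipschitz[OF c(1), of "1 - v" "1 - u" for u v]
      by (intro abs_continuous_on_lipschitz[where C="(3/4) * c powr (-1/4)"]) force
    then show "\<exists>c d. 0 \<le> c \<and> c \<le> d \<and> d \<le> 1 \<and> abs_continuous_on c d (\<lambda>t. - ((1 - t) powr (3/4))) \<and>
        - ((1 - c) powr (3/4)) - - ((1 - 0) powr (3/4)) < \<epsilon> \<and> - ((1 - 1) powr (3/4)) - - ((1 - d) powr (3/4)) < \<epsilon>"
      using c \<open>0 < \<epsilon>\<close> by (intro exI[of _ 0] exI[of _ "1 - c"]) auto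
  qed (auto intro: powr_mono2)
  from abs_continuous_on_bounded_linear[OF this bounded_linear_minus[OF bounded_linear_ident]]
  show ?thesis by simp
qed

section \<open>Joining two arbitrary configurations by a curve of finite action\<close>

lemma two_basis_vectors:
  assumes "DIM('a::euclidean_space) \<ge> 2"
  obtains e1 e2 :: "'a::euclidean_space" where "e1 \<in> Basis" "e2 \<in> Basis" "e1 \<noteq> e2"
proof -
  obtain e1 :: 'a where e1: "e1 \<in> Basis" using nonempty_Basis by blast
  have "Basis \<noteq> {e1}" using assms by (metis card.empty card_insert_disjoint empty_iff finite.emptyI not_less_eq_eq numeral_2_eq_2 One_nat_def le_refl)
  then obtain e2 where "e2 \<in> Basis" "e2 \<noteq> e1" using e1 by blast
  with e1 that show thesis by blast
qed

text \<open>At a collision division by zero makes the term 0, so agreement with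
  \<open>potential\<close> is restricted to collision-free configurations.\<close>

definition real_potential :: "('n \<Rightarrow> real) \<Rightarrow> ('a::euclidean_space, 'n::{finite,linorder}) vec \<Rightarrow> real" where
  "real_potential m x = (\<Sum>(i, j)\<in>{(i, j). i < j}. m i * m j / norm (x $ i - x $ j))"

lemma potential_eq_real_potential:
  fixes m :: "'n::{finite,linorder} \<Rightarrow> real" and x :: "('a::euclidean_space, 'n) vec"
  assumes m: "\<And>i. m i > 0" and x: "\<And>i j. i \<noteq> j \<Longrightarrow> x $ i \<noteq> x $ j"
  shows "potential m x = ennreal (real_potential m x)"
proof -
  have "potential m x = (\<Sum>(i, j)\<in>{(i, j). i < j}. ennreal (m i * m j / norm (x $ i - x $ j)))"
    unfolding potential_def
  proof (rule sum.cong, simp, clarify)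
    fix i j :: 'n assume "i < j"
    then have "0 < norm (x $ i - x $ j)" using x[of i j] by simp
    then show "ennreal (m i * m j) / ennreal (norm (x $ i - x $ j)) = ennreal (m i * m j / norm (x $ i - x $ j))"
      using m[of i] m[of j] by (intro divide_ennreal) auto
  qed
  also have "\<dots> = ennreal (real_potential m x)"
    unfolding real_potential_def using m
    by (subst sum_ennreal[symmetric]) (auto simp: case_prod_unfold less_imp_le intro!: divide_nonneg_nonneg mult_nonneg_nonneg)
  finally show ?thesis .
qed

lemma real_potential_nonneg:
  assumes "\<And>i. m i > 0" shows "0 \<le> real_potential m x"
  unfolding real_potential_def using assms
  by (intro sum_nonneg) (auto simp: case_prod_unfold less_imp_le intro!: divide_nonneg_nonneg mult_nonneg_nonneg)

lemma collision_free_iff: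
  fixes m :: "'n::{finite,linorder} \<Rightarrow> real" and x :: "('a::euclidean_space, 'n) vec"
  assumes m: "\<And>i. m i > 0"
  shows "x \<in> collision_free m \<longleftrightarrow> (\<forall>i j. i \<noteq> j \<longrightarrow> x $ i \<noteq> x $ j)"
proof
  assume cf: "x \<in> collision_free m"
  have ne: "x $ i \<noteq> x $ j" if "i < j" for i j
  proof
    assume eq: "x $ i = x $ j"
    have "ennreal (m i * m j) / ennreal (norm (x $ i - x $ j)) = top"
      using m[of i] m[of j] eq by (simp add: ennreal_divide_zero)
    then have "potential m x = top"
      unfolding potential_def using that by (subst ennreal_sum_eq_top) force+
    with cf show False by (simp add: collision_free_def)
  qed
  show "\<forall>i j. i \<noteq> j \<longrightarrow> x $ i \<noteq> x $ j"
    using ne by (metis linorder_neqE)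
next
  assume "\<forall>i j. i \<noteq> j \<longrightarrow> x $ i \<noteq> x $ j"
  then show "x \<in> collision_free m"
    using potential_eq_real_potential[OF m, of x] by (simp add: collision_free_def)
qed

lemma kinetic_nonneg: "(\<And>i. m i > 0) \<Longrightarrow> 0 \<le> kinetic m v"
  unfolding kinetic_def by (auto intro!: mult_nonneg_nonneg sum_nonneg simp: less_imp_le)

lemma kinetic_scaleR: "kinetic m (c *\<^sub>R v) = c\<^sup>2 * kinetic m v"
  unfolding kinetic_def by (simp add: power_mult_distrib sum_distrib_left algebra_simps)

text \<open>A pair that coincides at \<open>x\<close> separates linearly in \<open>s\<close>; the
  distance of any other pair is bounded below on the compact segment. Either way it is at least a
  multiple of \<open>s\<close>.\<close>

lemma generic_segment_potential_bound:
  fixes x w :: "('a::euclidean_space, 'n::{finite,linorder}) vec"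
  assumes m: "\<And>i. m i > 0"
    and ne: "\<And>i j s. i \<noteq> j \<Longrightarrow> 0 < s \<Longrightarrow> s \<le> 1 \<Longrightarrow> (x + s *\<^sub>R (w - x)) $ i \<noteq> (x + s *\<^sub>R (w - x)) $ j"
  shows "\<exists>C\<ge>0. \<forall>s. 0 < s \<longrightarrow> s \<le> 1 \<longrightarrow> potential m (x + s *\<^sub>R (w - x)) \<le> ennreal (C / s)"
proof -
  have "\<exists>C>0. \<forall>s. 0 < s \<and> s \<le> 1 \<longrightarrow> C * s \<le> norm ((x + s *\<^sub>R (w - x)) $ i - (x + s *\<^sub>R (w - x)) $ j)"
    if ij: "i \<noteq> j" for i j
  proof (cases "x $ i = x $ j")
    case True
    have "w $ i - w $ j \<noteq> 0" using ne[OF ij, of 1] by simp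
    moreover have "(x + s *\<^sub>R (w - x)) $ i - (x + s *\<^sub>R (w - x)) $ j = s *\<^sub>R (w $ i - w $ j)" for s
      using True by (simp add: algebra_simps)
    ultimately show ?thesis by (intro exI[of _ "norm (w $ i - w $ j)"]) auto
  next
    case False
    let ?f = "\<lambda>s. norm ((x + s *\<^sub>R (w - x)) $ i - (x + s *\<^sub>R (w - x)) $ j)"
    have "continuous_on {0..1} ?f" by (intro continuous_intros)
    then obtain s0 where s0: "s0 \<in> {0..1}" "\<And>s. s \<in> {0..1} \<Longrightarrow> ?f s0 \<le> ?f s"
      using continuous_attains_inf[of "{0..1::real}" ?f] by auto
    have "0 < ?f s0"
      using s0(1) ne[OF ij, of s0] False by (cases "s0 = 0") auto
    moreover have "?f s0 * s \<le> ?f s" if "0 < s \<and> s \<le> 1" for s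
    proof -
      have "?f s0 * s \<le> ?f s0" using that by (intro mult_left_le) auto
      also have "\<dots> \<le> ?f s" using that by (intro s0(2)) auto
      finally show ?thesis .
    qed
    ultimately show ?thesis by blast
  qed
  then obtain C where C: "\<And>i j. i \<noteq> j \<Longrightarrow> 0 < C i j"
    "\<And>i j s. i \<noteq> j \<Longrightarrow> 0 < s \<Longrightarrow> s \<le> 1 \<Longrightarrow> C i j * s \<le> norm ((x + s *\<^sub>R (w - x)) $ i - (x + s *\<^sub>R (w - x)) $ j)"
    by metis
  define B where "B = (\<Sum>(i, j)\<in>{(i, j). i < j}. m i * m j / C i j)"
  show ?thesis
  proof (intro exI[of _ B] conjI allI impI)
    show "0 \<le> B" unfolding B_def using m C(1)
      by (intro sum_nonneg) (auto simp: case_prod_unfold less_imp_le intro!: divide_nonneg_pos mult_nonneg_nonneg)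
    fix s :: real assume s: "0 < s" "s \<le> 1"
    have "potential m (x + s *\<^sub>R (w - x)) = ennreal (real_potential m (x + s *\<^sub>R (w - x)))"
      using ne s by (intro potential_eq_real_potential m) auto
    also have "real_potential m (x + s *\<^sub>R (w - x)) \<le> (\<Sum>(i, j)\<in>{(i, j). i < j}. m i * m j / C i j / s)"
      unfolding real_potential_def
    proof (rule sum_mono, clarify)
      fix i j :: 'n assume "i < j"
      then have ij: "i \<noteq> j" by simp
      have A: "0 < C i j * s" using C(1)[OF ij] s by simp
      have B: "0 < norm ((x + s *\<^sub>R (w - x)) $ i - (x + s *\<^sub>R (w - x)) $ j)"
        using A C(2)[OF ij s] by linarith
      have "m i * m j / norm ((x + s *\<^sub>R (w - x)) $ i - (x + s *\<^sub>R (w - x)) $ j) \<le> m i * m j / (C i j * s)"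
        by (rule divide_left_mono[OF C(2)[OF ij s] mult_nonneg_nonneg[OF less_imp_le[OF m] less_imp_le[OF m]] mult_pos_pos[OF B A]])
      then show "m i * m j / norm ((x + s *\<^sub>R (w - x)) $ i - (x + s *\<^sub>R (w - x)) $ j) \<le> m i * m j / C i j / s"
        by simp
    qed
    also have "\<dots> = B / s" unfolding B_def sum_divide_distrib by (simp add: case_prod_unfold)
    finally show "potential m (x + s *\<^sub>R (w - x)) \<le> ennreal (B / s)" by (simp add: ennreal_leI)
  qed
qed

text \<open>Supplies the common midpoint of a curve from \<open>x\<close> to \<open>y\<close>. The
  case \<open>s = 0\<close> is left out because \<open>x\<close> and \<open>y\<close> may be
  collisions.\<close>

lemma generic_configuration:
  fixes x y :: "('a::euclidean_space, 'n::{finite,linorder}) vec"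
  assumes dim: "DIM('a) \<ge> 2"
  obtains w :: "('a, 'n) vec" where
    "\<And>z i j s. z \<in> {x, y} \<Longrightarrow> i \<noteq> j \<Longrightarrow> 0 < s \<Longrightarrow> s \<le> 1 \<Longrightarrow> (z + s *\<^sub>R (w - z)) $ i \<noteq> (z + s *\<^sub>R (w - z)) $ j"
proof -
  obtain e1 e2 :: 'a where e: "e1 \<in> Basis" "e2 \<in> Basis" "e1 \<noteq> e2" using two_basis_vectors[OF dim] by blast
  have ee: "e1 \<bullet> e1 = 1" "e2 \<bullet> e2 = 1" "e1 \<bullet> e2 = 0" "e2 \<bullet> e1 = 0"
    using e by (auto simp: inner_Basis)
  obtain r :: "'n \<Rightarrow> nat" where r: "inj r"
    using finite_imp_inj_to_nat_seg[of "UNIV :: 'n set"] by auto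
  define S where "S = (\<lambda>(z, i, j). ((z $ i - z $ j) \<bullet> e2) / ((z $ i - z $ j) \<bullet> e1)) ` ({x, y} \<times> UNIV \<times> UNIV)"
  have "finite S" unfolding S_def by simp
  then have "bdd_above S" by (rule bdd_above_finite)
  then obtain B where B: "\<And>q. q \<in> S \<Longrightarrow> q \<le> B" by (auto simp: bdd_above_def)
  \<comment> \<open>The maximum with 0 makes \<open>K\<close> positive, so that the numbers
    \<open>a i\<close> are distinct.\<close>
  define K where "K = max B 0 + 1"
  have K: "K > 0" "\<And>q. q \<in> S \<Longrightarrow> q < K" using B by (force simp: K_def)+
  define a where "a i = K * real (r i)" for i
  have a: "a i \<noteq> a j" "K \<le> a i + a j" if "i \<noteq> j" for i j
  proof -
    have "r i \<noteq> r j" using r that by (auto dest: injD)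
    then show "a i \<noteq> a j" using K by (simp add: a_def)
    have "1 \<le> real (r i) + real (r j)" using \<open>r i \<noteq> r j\<close> by linarith
    then have "K * 1 \<le> K * (real (r i) + real (r j))" using K by (intro mult_left_mono) auto
    then show "K \<le> a i + a j" by (simp add: a_def algebra_simps)
  qed
  text \<open>Points on a parabola: the chord between two of them has slope \<open>a i + a j \<ge> K\<close>, steeper than every
    relative position occurring in \<open>x\<close> and \<open>y\<close>.\<close>
  define w :: "('a, 'n) vec" where "w = (\<chi> i. a i *\<^sub>R e1 + (a i)\<^sup>2 *\<^sub>R e2)"
  show thesis
  proof (rule that[of w], rule notI)
    fix z i j and s :: real
    assume z: "z \<in> {x, y}" and ij: "i \<noteq> j" and s: "0 < s" "s \<le> 1"
      and eq: "(z + s *\<^sub>R (w - z)) $ i = (z + s *\<^sub>R (w - z)) $ j"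
    define p where "p = (z $ i - z $ j) \<bullet> e1"
    define q where "q = (z $ i - z $ j) \<bullet> e2"
    have "((z + s *\<^sub>R (w - z)) $ i - (z + s *\<^sub>R (w - z)) $ j) \<bullet> e1 = 0" using eq by simp
    then have 1: "(1 - s) * p + s * (a i - a j) = 0"
      by (simp add: w_def p_def ee inner_simps algebra_simps)
    have "((z + s *\<^sub>R (w - z)) $ i - (z + s *\<^sub>R (w - z)) $ j) \<bullet> e2 = 0" using eq by simp
    then have 2: "(1 - s) * q + s * ((a i)\<^sup>2 - (a j)\<^sup>2) = 0"
      by (simp add: w_def q_def ee inner_simps algebra_simps)
    \<comment> \<open>The first coordinate rules out \<open>s = 1\<close> and \<open>p = 0\<close>,
      so the slope \<open>q / p\<close> is a genuine quotient.\<close>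
    have nz: "s * (a i - a j) \<noteq> 0" using a(1)[OF ij] s by simp
    with 1 have p: "1 - s \<noteq> 0" "p \<noteq> 0" by auto
    have "(1 - s) * q = (a i + a j) * ((1 - s) * p)"
    proof -
      have "(1 - s) * q = - (s * ((a i)\<^sup>2 - (a j)\<^sup>2))" using 2 by linarith
      also have "\<dots> = (a i + a j) * (- (s * (a i - a j)))" by (simp add: power2_eq_square algebra_simps)
      also have "- (s * (a i - a j)) = (1 - s) * p" using 1 by linarith
      finally show ?thesis .
    qed
    then have "q = (a i + a j) * p" using p(1) by simp
    then have "q / p = a i + a j" using p(2) by simp
    moreover have "q / p \<in> S" unfolding S_def p_def q_def using z by (intro image_eqI[of _ _ "(z, i, j)"]) auto
    ultimately show False using K(2) a(2)[OF ij] by fastforce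
  qed
qed

text \<open>The singular bound for one half of the curve is integrated over all of
  \<open>{-1..1}\<close>, so that the bounds for the two halves can simply be added.\<close>

lemma nn_integral_powr_left: "(\<integral>\<^sup>+t\<in>{-1..1}. ennreal ((1 + t) powr (-3/4)) \<partial>lborel) < \<infinity>"
proof -
  have "((\<lambda>t. (1 + t) powr (-3/4)) has_integral (4 * (1 + 1) powr (1/4) - 4 * (1 + - 1) powr (1/4))) {-1..1::real}"
  proof (rule fundamental_theorem_of_calculus_interior)
    show "continuous_on {-1..1} (\<lambda>t::real. 4 * (1 + t) powr (1/4))"
      by (intro continuous_on_mult continuous_on_const continuous_on_powr' continuous_on_add continuous_on_id) auto
    fix t :: real assume "t \<in> {-1<..<1}"
    then have "((\<lambda>t. 4 * (1 + t) powr (1/4)) has_real_derivative (1 + t) powr (-3/4)) (at t)"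
      by (auto intro!: derivative_eq_intros simp: powr_diff powr_minus field_simps)
    then show "((\<lambda>t. 4 * (1 + t) powr (1/4)) has_vector_derivative (1 + t) powr (-3/4)) (at t)"
      by (simp add: has_real_derivative_iff_has_vector_derivative)
  qed simp
  from nn_integral_has_integral_lebesgue'[OF _ this] show ?thesis by simp
qed

lemma nn_integral_powr_right: "(\<integral>\<^sup>+t\<in>{-1..1}. ennreal ((1 - t) powr (-3/4)) \<partial>lborel) < \<infinity>"
proof -
  have "(\<integral>\<^sup>+t\<in>{-1..1}. ennreal ((1 + t) powr (-3/4)) \<partial>lborel) =
    (\<integral>\<^sup>+t. ennreal ((1 + (0 + (-1) * t)) powr (-3/4)) * indicator {-1..1} (0 + (-1) * t) \<partial>lborel)"
    by (subst nn_integral_real_affine[where c="-1" and t=0]) auto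
  also have "\<dots> = (\<integral>\<^sup>+t\<in>{-1..1}. ennreal ((1 - t) powr (-3/4)) \<partial>lborel)"
    by (intro nn_integral_cong) (auto split: split_indicator)
  finally show ?thesis using nn_integral_powr_left by simp
qed

lemma vector_derivative_within_interior:
  fixes f :: "real \<Rightarrow> 'e::euclidean_space"
  assumes "(f has_vector_derivative d) (at t)" "a < t" "t < b"
  shows "vector_derivative f (at t within {a..b}) = d"
  using assms
  by (intro vector_derivative_within_closed_interval has_vector_derivative_at_within[OF assms(1)]) auto

text \<open>Along \<open>x + s^(3/4) (w - x)\<close> the kinetic energy is of order
  \<open>s^(-1/2)\<close> and the potential at most of order \<open>s^(-3/4)\<close>, both
  integrable. This works for exponents strictly between 1/2 and 1: at uniform speed the potential
  could grow like \<open>1 / s\<close>, which is not integrable.\<close>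

theorem action_potential_finite:
  fixes m :: "'n::{finite,linorder} \<Rightarrow> real" and x y :: "('a::euclidean_space, 'n) vec"
  assumes dim: "DIM('a) \<ge> 2" and m: "\<And>i. m i > 0"
  shows "action_potential m x y < \<infinity>"
proof -
  obtain w :: "('a, 'n) vec" where w:
    "\<And>z i j s. z \<in> {x, y} \<Longrightarrow> i \<noteq> j \<Longrightarrow> 0 < s \<Longrightarrow> s \<le> 1 \<Longrightarrow> (z + s *\<^sub>R (w - z)) $ i \<noteq> (z + s *\<^sub>R (w - z)) $ j"
    using generic_configuration[OF dim, of x y] by blast
  have wx: "\<And>i j s. i \<noteq> j \<Longrightarrow> 0 < s \<Longrightarrow> s \<le> 1 \<Longrightarrow> (x + s *\<^sub>R (w - x)) $ i \<noteq> (x + s *\<^sub>R (w - x)) $ j"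
    and wy: "\<And>i j s. i \<noteq> j \<Longrightarrow> 0 < s \<Longrightarrow> s \<le> 1 \<Longrightarrow> (y + s *\<^sub>R (w - y)) $ i \<noteq> (y + s *\<^sub>R (w - y)) $ j"
    by (rule w; simp)+
  obtain C1 where C1: "0 \<le> C1" "\<And>s. 0 < s \<Longrightarrow> s \<le> 1 \<Longrightarrow> potential m (x + s *\<^sub>R (w - x)) \<le> ennreal (C1 / s)"
    using generic_segment_potential_bound[of m x w, OF m wx] by blast
  obtain C2 where C2: "0 \<le> C2" "\<And>s. 0 < s \<Longrightarrow> s \<le> 1 \<Longrightarrow> potential m (y + s *\<^sub>R (w - y)) \<le> ennreal (C2 / s)"
    using generic_segment_potential_bound[of m y w, OF m wy] by blast
  \<comment> \<open>From \<open>x\<close> to \<open>w\<close> during \<open>{-1..0}\<close>, from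
    \<open>w\<close> to \<open>y\<close> during \<open>{0..1}\<close>.\<close>
  define c where "c t = (if t \<le> 0 then x + ((1 + t) powr (3/4)) *\<^sub>R (w - x) else y + ((1 - t) powr (3/4)) *\<^sub>R (w - y))"
    for t :: real
  define K where "K = max (9/16 * kinetic m (w - x) + C1) (9/16 * kinetic m (w - y) + C2)"
  have K0: "0 \<le> K" using C1 kinetic_nonneg[of m "w - x", OF m] by (auto simp: K_def le_max_iff_disj)
  have ac: "abs_continuous_on (-1) 1 c"
  proof (rule abs_continuous_on_glue[where c=0])
    have ac0: "abs_continuous_on (-1) 0 (\<lambda>t. x + ((1 + t) powr (3/4)) *\<^sub>R (w - x))"
      by (intro abs_continuous_on_add abs_continuous_on_bounded_linear[OF abs_continuous_on_powr_left bounded_linear_scaleR_left]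
           abs_continuous_on_lipschitz[where C=0]) auto
    show "abs_continuous_on (-1) 0 c"
      by (rule abs_continuous_on_dominated[OF ac0 zero_less_one]) (simp add: c_def)
    have ac1: "abs_continuous_on 0 1 (\<lambda>t. y + ((1 - t) powr (3/4)) *\<^sub>R (w - y))"
      by (intro abs_continuous_on_add abs_continuous_on_bounded_linear[OF abs_continuous_on_powr_right bounded_linear_scaleR_left]
           abs_continuous_on_lipschitz[where C=0]) auto
    have "c t = y + ((1 - t) powr (3/4)) *\<^sub>R (w - y)" if "0 \<le> t" for t
      using that by (auto simp: c_def)
    then show "abs_continuous_on 0 1 c"
      by (intro abs_continuous_on_dominated[OF ac1 zero_less_one]) simp
  qed auto
  \<comment> \<open>For \<open>s \<le> 1\<close> the kinetic singularity is weaker than the bound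
    for the potential and is absorbed into it.\<close>
  have L1: "lagrangian m (z + (s powr (3/4)) *\<^sub>R (w - z)) (r *\<^sub>R (w - z)) \<le> ennreal (K * s powr (-3/4))"
    if s: "0 < s" "s \<le> 1" and r: "r\<^sup>2 = 9/16 * s powr (-1/2)"
      and CC: "\<And>s. 0 < s \<Longrightarrow> s \<le> 1 \<Longrightarrow> potential m (z + s *\<^sub>R (w - z)) \<le> ennreal (CC / s)"
      "0 \<le> CC" "9/16 * kinetic m (w - z) + CC \<le> K" for z s r CC
  proof -
    have "potential m (z + (s powr (3/4)) *\<^sub>R (w - z)) \<le> ennreal (CC / s powr (3/4))"
      using s powr_le1[of "3/4" s] by (intro CC) auto
    also have "CC / s powr (3/4) = CC * s powr (-3/4)" by (simp add: powr_minus field_simps)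
    finally have U: "potential m (z + (s powr (3/4)) *\<^sub>R (w - z)) \<le> ennreal (CC * s powr (-3/4))" .
    have "kinetic m (r *\<^sub>R (w - z)) = 9/16 * kinetic m (w - z) * s powr (-1/2)"
      by (simp add: kinetic_scaleR r)
    also have "\<dots> \<le> 9/16 * kinetic m (w - z) * s powr (-3/4)"
      using s kinetic_nonneg[of m "w - z", OF m] by (intro mult_left_mono powr_mono') auto
    finally have T: "kinetic m (r *\<^sub>R (w - z)) \<le> 9/16 * kinetic m (w - z) * s powr (-3/4)" .
    have "lagrangian m (z + (s powr (3/4)) *\<^sub>R (w - z)) (r *\<^sub>R (w - z)) \<le>
        ennreal (9/16 * kinetic m (w - z) * s powr (-3/4)) + ennreal (CC * s powr (-3/4))"
      unfolding lagrangian_def by (intro add_mono U ennreal_leI T)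
    also have "\<dots> = ennreal ((9/16 * kinetic m (w - z) + CC) * s powr (-3/4))"
      using kinetic_nonneg[of m "w - z", OF m] CC(2) by (subst ennreal_plus[symmetric]) (auto simp: algebra_simps)
    also have "\<dots> \<le> ennreal (K * s powr (-3/4))"
      using CC(3) by (intro ennreal_leI mult_right_mono) auto
    finally show ?thesis .
  qed
  have pw2: "(r * s powr (-1/4))\<^sup>2 = 9/16 * s powr (-1/2)" if "r\<^sup>2 = 9/16" for r s :: real
    using that by (simp add: power_mult_distrib power2_eq_square[of "s powr _"] powr_add[symmetric])
  \<comment> \<open>The end points and the corner at 0 are excluded; being a null set they do not
    affect the integral.\<close>
  have L: "lagrangian m (c t) (vector_derivative c (at t within {-1..1})) \<le>
      ennreal (K * (1 + t) powr (-3/4)) + ennreal (K * (1 - t) powr (-3/4))"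
    if t: "t \<in> {-1<..<1} - {0}" for t
  proof (cases "t < 0")
    case True
    then have t': "-1 < t" "t < 0" using t by auto
    have "((\<lambda>t. x + ((1 + t) powr (3/4)) *\<^sub>R (w - x)) has_vector_derivative ((3/4) * (1 + t) powr (-1/4)) *\<^sub>R (w - x)) (at t)"
      using t' by (auto intro!: derivative_eq_intros simp: has_real_derivative_iff_has_vector_derivative[symmetric])
    then have "(c has_vector_derivative ((3/4) * (1 + t) powr (-1/4)) *\<^sub>R (w - x)) (at t)"
      by (rule has_vector_derivative_transform_within_open[where S="{-1<..<0}"]) (use t' in \<open>auto simp: c_def\<close>)
    then have "vector_derivative c (at t within {-1..1}) = ((3/4) * (1 + t) powr (-1/4)) *\<^sub>R (w - x)"
      using t' by (simp add: vector_derivative_within_interior)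
    moreover have "c t = x + ((1 + t) powr (3/4)) *\<^sub>R (w - x)" using t' by (simp add: c_def)
    moreover have "lagrangian m (x + ((1 + t) powr (3/4)) *\<^sub>R (w - x)) (((3/4) * (1 + t) powr (-1/4)) *\<^sub>R (w - x))
        \<le> ennreal (K * (1 + t) powr (-3/4))"
      using t' C1 by (intro L1 pw2) (auto simp: K_def power2_eq_square)
    ultimately show ?thesis by (simp add: add_increasing2)
  next
    case False
    then have t': "0 < t" "t < 1" using t by auto
    have "((\<lambda>t. y + ((1 - t) powr (3/4)) *\<^sub>R (w - y)) has_vector_derivative ((-3/4) * (1 - t) powr (-1/4)) *\<^sub>R (w - y)) (at t)"
      using t' by (auto intro!: derivative_eq_intros simp: has_real_derivative_iff_has_vector_derivative[symmetric])
    then have "(c has_vector_derivative ((-3/4) * (1 - t) powr (-1/4)) *\<^sub>R (w - y)) (at t)"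
      by (rule has_vector_derivative_transform_within_open[where S="{0<..<1}"]) (use t' in \<open>auto simp: c_def\<close>)
    then have "vector_derivative c (at t within {-1..1}) = ((-3/4) * (1 - t) powr (-1/4)) *\<^sub>R (w - y)"
      using t' by (simp add: vector_derivative_within_interior)
    moreover have "c t = y + ((1 - t) powr (3/4)) *\<^sub>R (w - y)" using t' by (simp add: c_def)
    moreover have "lagrangian m (y + ((1 - t) powr (3/4)) *\<^sub>R (w - y)) (((-3/4) * (1 - t) powr (-1/4)) *\<^sub>R (w - y))
        \<le> ennreal (K * (1 - t) powr (-3/4))"
      using t' C2 by (intro L1 pw2) (auto simp: K_def power2_eq_square)
    ultimately show ?thesis by (simp add: add_increasing)
  qed
  have "action m (-1) 1 c \<le> (\<integral>\<^sup>+t. ennreal K * (ennreal ((1 + t) powr (-3/4)) * indicator {-1..1} t) +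
      ennreal K * (ennreal ((1 - t) powr (-3/4)) * indicator {-1..1} t) \<partial>lborel)"
    unfolding action_def
  proof (rule nn_integral_mono_AE)
    have "AE t in lborel. t \<noteq> (-1::real) \<and> t \<noteq> 0 \<and> t \<noteq> 1"
      using AE_lborel_singleton[of "-1::real"] AE_lborel_singleton[of "0::real"] AE_lborel_singleton[of "1::real"]
      by eventually_elim auto
    then show "AE t in lborel. lagrangian m (c t) (vector_derivative c (at t within {-1..1})) * indicator {-1..1} t \<le>
      ennreal K * (ennreal ((1 + t) powr (-3/4)) * indicator {-1..1} t) +
      ennreal K * (ennreal ((1 - t) powr (-3/4)) * indicator {-1..1} t)"
    proof eventually_elim
      case (elim t)
      show ?case
      proof (cases "t \<in> {-1..1}")
        case True
        then show ?thesis using L[of t] elim K0 by (simp add: ennreal_mult)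
      qed simp
    qed
  qed
  also have "\<dots> = ennreal K * (\<integral>\<^sup>+t\<in>{-1..1}. ennreal ((1 + t) powr (-3/4)) \<partial>lborel) +
      ennreal K * (\<integral>\<^sup>+t\<in>{-1..1}. ennreal ((1 - t) powr (-3/4)) \<partial>lborel)"
    by (subst nn_integral_add) (auto simp: nn_integral_cmult)
  also have "\<dots> < \<infinity>"
    using nn_integral_powr_left nn_integral_powr_right by (simp add: ennreal_mult_less_top)
  finally have fin: "action m (-1) 1 c < \<infinity>" .
  have "action_potential m x y \<le> action m (-1) 1 c"
    unfolding action_potential_def
    by (rule Inf_lower) (use ac in \<open>force simp: c_def\<close>)
  with fin show ?thesis by (rule le_less_trans[rotated])
qed

section \<open>The planar Poisson kernel\<close>

lemma nn_integral_FTC_UNIV: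
  fixes f F :: "real \<Rightarrow> real"
  assumes f[measurable]: "f \<in> borel_measurable borel" and F: "\<And>x. DERIV F x :> f x" and nn: "\<And>x. 0 \<le> f x"
    and top: "(F \<longlongrightarrow> T) at_top" and bot: "(F \<longlongrightarrow> S) at_bot"
  shows "(\<integral>\<^sup>+x. ennreal (f x) \<partial>lborel) = ennreal (T - S)"
proof -
  have mono: "F x \<le> F y" if "x \<le> y" for x y
    using that F nn by (intro DERIV_nonneg_imp_nondecreasing[of x y F]) blast+
  have 1: "(\<integral>\<^sup>+x. ennreal (f x) * indicator {0..} x \<partial>lborel) = ennreal (T - F 0)"
    by (rule nn_integral_FTC_atLeast[OF f F nn top])
  have "(\<integral>\<^sup>+x. ennreal (f x) * indicator {..0} x \<partial>lborel) =
      (\<integral>\<^sup>+x. ennreal (f (0 + (-1) * x)) * indicator {..0} (0 + (-1) * x) \<partial>lborel)"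
    by (subst nn_integral_real_affine[where c="-1" and t=0]) auto
  also have "\<dots> = (\<integral>\<^sup>+x. ennreal (f (- x)) * indicator {0..} x \<partial>lborel)"
    by (intro nn_integral_cong) (auto split: split_indicator)
  also have "\<dots> = ennreal (- S - (- F (- 0)))"
  proof (rule nn_integral_FTC_atLeast)
    show "((\<lambda>x. - F (- x)) has_real_derivative f (- x)) (at x)" for x
    proof -
      have "((\<lambda>x. F (- x)) has_real_derivative f (- x) * (- 1)) (at x)"
        by (rule DERIV_chain2[OF F]) (auto intro!: derivative_eq_intros)
      from DERIV_minus[OF this] show ?thesis by simp
    qed
    show "((\<lambda>x. - F (- x)) \<longlongrightarrow> - S) at_top"
      using bot by (intro tendsto_minus) (simp add: filterlim_at_bot_mirror)
  qed (auto simp: nn)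
  finally have 2: "(\<integral>\<^sup>+x. ennreal (f x) * indicator {..0} x \<partial>lborel) = ennreal (F 0 - S)" by simp
  have "(\<integral>\<^sup>+x. ennreal (f x) \<partial>lborel) =
      (\<integral>\<^sup>+x. ennreal (f x) * indicator {0..} x + ennreal (f x) * indicator {..0} x \<partial>lborel)"
  proof (rule nn_integral_cong_AE)
    show "AE x in lborel. ennreal (f x) = ennreal (f x) * indicator {0..} x + ennreal (f x) * indicator {..0} x"
      using AE_lborel_singleton[of "0::real"] by eventually_elim (auto split: split_indicator)
  qed
  also have "\<dots> = ennreal (T - F 0) + ennreal (F 0 - S)"
    by (subst nn_integral_add) (auto simp: 1 2)
  also have "\<dots> = ennreal (T - S)"
  proof (subst ennreal_plus[symmetric])
    show "0 \<le> T - F 0"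
      using tendsto_lowerbound[OF top, of "F 0"] mono by (auto simp: eventually_at_top_linorder)
    show "0 \<le> F 0 - S"
      using tendsto_upperbound[OF bot, of "F 0"] mono by (auto simp: eventually_at_bot_linorder)
  qed simp
  finally show ?thesis .
qed

lemma quadratic_pos:
  fixes A B C :: real
  assumes "0 < A" "B\<^sup>2 < A * C"
  shows "0 < A * r\<^sup>2 - 2 * B * r + C"
proof -
  have "A * (A * r\<^sup>2 - 2 * B * r + C) = (A * r - B)\<^sup>2 + (A * C - B\<^sup>2)"
    by (simp add: power2_eq_square algebra_simps)
  also have "\<dots> > 0" using assms by (intro add_nonneg_pos) auto
  finally show ?thesis using assms(1) by (simp add: zero_less_mult_iff)
qed

lemma nn_integral_quadratic_three_halves:
  fixes A B C :: real
  assumes A: "0 < A" and D: "B\<^sup>2 < A * C"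
  shows "(\<integral>\<^sup>+r. ennreal (1 / sqrt (A * r\<^sup>2 - 2 * B * r + C) ^ 3) \<partial>lborel) = ennreal (2 * sqrt A / (A * C - B\<^sup>2))"
proof -
  define Q where "Q r = A * r\<^sup>2 - 2 * B * r + C" for r
  have Q: "0 < Q r" for r unfolding Q_def by (rule quadratic_pos[OF A D])
  \<comment> \<open>The antiderivative rests on
    \<open>A * Q r - (A * r - B)^2 = A * C - B^2\<close>; its limits are plus and minus
    \<open>sqrt A / (A * C - B^2)\<close>.\<close>
  define F where "F r = (A * r - B) / ((A * C - B\<^sup>2) * sqrt (Q r))" for r
  \<comment> \<open>The outcome of the quotient rule, with \<open>S\<close> for
    \<open>sqrt (Q r)\<close> and \<open>v\<close> for \<open>A * r - B\<close>.\<close>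
  have alg: "(A * (K * S) - v * (K * ((2 * v) * (inverse S / 2)))) / ((K * S) * (K * S)) = 1 / S ^ 3"
    if "A * (S * S) - v\<^sup>2 = K" "0 < S" "0 < K" for A K S v :: real
  proof -
    have "A * (K * S) - v * (K * ((2 * v) * (inverse S / 2))) = K * (A * (S * S) - v\<^sup>2) / S"
      using that(2) by (simp add: field_simps power2_eq_square)
    then show ?thesis using that by (simp add: power3_eq_cube)
  qed
  have "(\<integral>\<^sup>+r. ennreal (1 / sqrt (Q r) ^ 3) \<partial>lborel) = ennreal (sqrt A / (A * C - B\<^sup>2) - (- sqrt A / (A * C - B\<^sup>2)))"
  proof (rule nn_integral_FTC_UNIV)
    show "(\<lambda>r. 1 / sqrt (Q r) ^ 3) \<in> borel_measurable borel" unfolding Q_def by measurable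
    show "0 \<le> 1 / sqrt (Q r) ^ 3" for r using Q[of r] by simp
    show "(F has_real_derivative 1 / sqrt (Q r) ^ 3) (at r)" for r
    proof -
      have dQ: "(Q has_real_derivative (2 * (A * r - B))) (at r)"
        unfolding Q_def[abs_def] by (auto intro!: derivative_eq_intros simp: algebra_simps)
      have s: "sqrt (Q r) > 0" "sqrt (Q r) * sqrt (Q r) = Q r" using Q[of r] by auto
      have "(F has_real_derivative
         (A * ((A * C - B\<^sup>2) * sqrt (Q r)) - (A * r - B) * ((A * C - B\<^sup>2) * ((2 * (A * r - B)) * (inverse (sqrt (Q r)) / 2)))) /
          (((A * C - B\<^sup>2) * sqrt (Q r)) * ((A * C - B\<^sup>2) * sqrt (Q r)))) (at r)"
        unfolding F_def[abs_def] using Q[of r] D dQ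
        by (auto intro!: derivative_eq_intros DERIV_chain2[OF DERIV_real_sqrt dQ])
      also have "(A * ((A * C - B\<^sup>2) * sqrt (Q r)) - (A * r - B) * ((A * C - B\<^sup>2) * ((2 * (A * r - B)) * (inverse (sqrt (Q r)) / 2)))) /
          (((A * C - B\<^sup>2) * sqrt (Q r)) * ((A * C - B\<^sup>2) * sqrt (Q r))) = 1 / sqrt (Q r) ^ 3"
      proof -
        have "A * (sqrt (Q r) * sqrt (Q r)) - (A * r - B)\<^sup>2 = A * C - B\<^sup>2"
          unfolding s(2) by (simp add: Q_def power2_eq_square algebra_simps)
        then show ?thesis using s(1) D by (intro alg) auto
      qed
      finally show ?thesis .
    qed
    have sA: "A / sqrt A = sqrt A" using A by (simp add: real_div_sqrt)
    have "((\<lambda>r. (A * r - B) / sqrt (A * r\<^sup>2 - 2 * B * r + C)) \<longlongrightarrow> A / sqrt A) at_top"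
      using A by (real_asymp simp: powr_half_sqrt field_simps)
    moreover have "((\<lambda>r. (A * (- r) - B) / sqrt (A * (- r)\<^sup>2 - 2 * B * (- r) + C)) \<longlongrightarrow> - (A / sqrt A)) at_top"
      using A by (real_asymp simp: powr_half_sqrt field_simps)
    ultimately have lim: "((\<lambda>r. (A * r - B) / sqrt (Q r)) \<longlongrightarrow> sqrt A) at_top"
        "((\<lambda>r. (A * r - B) / sqrt (Q r)) \<longlongrightarrow> - sqrt A) at_bot"
      unfolding Q_def filterlim_at_bot_mirror sA by simp_all
    show "(F \<longlongrightarrow> sqrt A / (A * C - B\<^sup>2)) at_top"
      using tendsto_divide[OF lim(1) tendsto_const, of "A * C - B\<^sup>2"] D by (simp add: F_def[abs_def] mult.commute)
    show "(F \<longlongrightarrow> - sqrt A / (A * C - B\<^sup>2)) at_bot"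
      using tendsto_divide[OF lim(2) tendsto_const, of "A * C - B\<^sup>2"] D by (simp add: F_def[abs_def] mult.commute)
  qed
  then show ?thesis by (simp add: Q_def add_divide_distrib[symmetric])
qed

lemma nn_integral_inverse_quadratic:
  fixes A B C :: real
  assumes A: "0 < A" and D: "B\<^sup>2 < A * C"
  shows "(\<integral>\<^sup>+s. ennreal (1 / (A * s\<^sup>2 - 2 * B * s + C)) \<partial>lborel) = ennreal (pi / sqrt (A * C - B\<^sup>2))"
proof -
  define d where "d = sqrt (A * C - B\<^sup>2)"
  have d: "0 < d" "d\<^sup>2 = A * C - B\<^sup>2" using D by (auto simp: d_def)
  define F where "F s = arctan ((A * s - B) / d) / d" for s
  have "(\<integral>\<^sup>+s. ennreal (1 / (A * s\<^sup>2 - 2 * B * s + C)) \<partial>lborel) = ennreal ((pi / 2) / d - (- (pi / 2)) / d)"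
  proof (rule nn_integral_FTC_UNIV)
    show "0 \<le> 1 / (A * s\<^sup>2 - 2 * B * s + C)" for s using quadratic_pos[OF A D, of s] by simp
    show "(F has_real_derivative 1 / (A * s\<^sup>2 - 2 * B * s + C)) (at s)" for s
    proof -
      have "(F has_real_derivative (inverse (1 + ((A * s - B) / d)\<^sup>2) * (A / d)) / d) (at s)"
        unfolding F_def[abs_def] using d by (auto intro!: derivative_eq_intros)
      also have "1 + ((A * s - B) / d)\<^sup>2 = (d\<^sup>2 + (A * s - B)\<^sup>2) / d\<^sup>2"
        using d(1) by (simp add: power_divide add_divide_distrib)
      also have "inverse ((d\<^sup>2 + (A * s - B)\<^sup>2) / d\<^sup>2) * (A / d) / d = A / (d\<^sup>2 + (A * s - B)\<^sup>2)"
        using d(1) by (simp add: power2_eq_square)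
      also have "d\<^sup>2 + (A * s - B)\<^sup>2 = A * (A * s\<^sup>2 - 2 * B * s + C)"
        unfolding d(2) by (simp add: power2_eq_square algebra_simps)
      finally show ?thesis using A by simp
    qed
    have "filterlim (\<lambda>s. (A * s - B) / d) at_top at_top" "filterlim (\<lambda>s. (A * s - B) / d) at_bot at_bot"
      using A d(1) by real_asymp+
    then show "(F \<longlongrightarrow> (pi / 2) / d) at_top" "(F \<longlongrightarrow> - (pi / 2) / d) at_bot"
      unfolding F_def[abs_def]
      by (intro tendsto_divide tendsto_const filterlim_compose[OF tendsto_arctan_at_top] filterlim_compose[OF tendsto_arctan_at_bot];
          use d in simp)+
  qed measurable
  then show ?thesis by (simp add: d_def add_divide_distrib[symmetric])
qed

text \<open>The Poisson kernel of the half space over a plane, seen from height \<open>h\<close>: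
  integration against it gives harmonic extensions. Points of the plane are pairs, which makes
  Fubini available.\<close>

definition poisson :: "real \<Rightarrow> real \<times> real \<Rightarrow> real" where
  "poisson h \<xi> = h / (2 * pi) * (1 / sqrt ((fst \<xi>)\<^sup>2 + (snd \<xi>)\<^sup>2 + h\<^sup>2) ^ 3)"

lemma poisson_nonneg: "0 \<le> h \<Longrightarrow> 0 \<le> poisson h \<xi>"
  by (simp add: poisson_def)

lemma pair_measurable_fst_snd[measurable]:
  "fst \<in> borel_measurable (borel :: (real \<times> real) measure)" "snd \<in> borel_measurable (borel :: (real \<times> real) measure)"
  by (intro borel_measurable_continuous_onI continuous_intros)+

lemma poisson_measurable[measurable]: "poisson h \<in> borel_measurable borel"
  unfolding poisson_def[abs_def] by measurable

lemma nn_integral_pair_lborel: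
  fixes f :: "real \<times> real \<Rightarrow> ennreal"
  assumes [measurable]: "f \<in> borel_measurable borel"
  shows "(\<integral>\<^sup>+\<xi>. f \<xi> \<partial>lborel) = (\<integral>\<^sup>+a. \<integral>\<^sup>+b. f (a, b) \<partial>lborel \<partial>lborel)"
proof -
  have "f \<in> borel_measurable (lborel \<Otimes>\<^sub>M lborel)" by (simp add: lborel_prod)
  from lborel.nn_integral_fst[OF this] show ?thesis by (simp add: lborel_prod)
qed

text \<open>The marginal is the Cauchy density of scale \<open>h\<close>, from which total mass,
  tails and truncated second moments are obtained.\<close>

lemma nn_integral_poisson_fst:
  assumes h: "0 < h"
  shows "(\<integral>\<^sup>+b. ennreal (poisson h (a, b)) \<partial>lborel) = ennreal (h / pi * (1 / (a\<^sup>2 + h\<^sup>2)))"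
proof -
  have D: "0\<^sup>2 < 1 * (a\<^sup>2 + h\<^sup>2)" using h by (simp add: add_nonneg_pos)
  have "(\<integral>\<^sup>+b. ennreal (poisson h (a, b)) \<partial>lborel) =
      (\<integral>\<^sup>+b. ennreal (h / (2 * pi)) * ennreal (1 / sqrt (1 * b\<^sup>2 - 2 * 0 * b + (a\<^sup>2 + h\<^sup>2)) ^ 3) \<partial>lborel)"
    using h by (intro nn_integral_cong) (simp add: poisson_def ennreal_mult'[symmetric] algebra_simps)
  also have "\<dots> = ennreal (h / (2 * pi)) * ennreal (2 * sqrt 1 / (1 * (a\<^sup>2 + h\<^sup>2) - 0\<^sup>2))"
    unfolding nn_integral_quadratic_three_halves[OF zero_less_one D, symmetric]
    by (rule nn_integral_cmult) measurable
  also have "\<dots> = ennreal (h / pi * (1 / (a\<^sup>2 + h\<^sup>2)))"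
    using h by (subst ennreal_mult'[symmetric]) auto
  finally show ?thesis .
qed

lemma poisson_swap: "poisson h (a, b) = poisson h (b, a)"
  by (simp add: poisson_def add.commute)

lemma nn_integral_poisson:
  assumes h: "0 < h"
  shows "(\<integral>\<^sup>+\<xi>. ennreal (poisson h \<xi>) \<partial>lborel) = 1"
proof -
  have D: "0\<^sup>2 < 1 * h\<^sup>2" using h by simp
  have "(\<integral>\<^sup>+\<xi>. ennreal (poisson h \<xi>) \<partial>lborel) = (\<integral>\<^sup>+a. ennreal (h / pi) * ennreal (1 / (1 * a\<^sup>2 - 2 * 0 * a + h\<^sup>2)) \<partial>lborel)"
    using h by (subst nn_integral_pair_lborel) (auto simp: nn_integral_poisson_fst ennreal_mult'[symmetric] intro!: nn_integral_cong)
  also have "\<dots> = ennreal (h / pi) * ennreal (pi / sqrt (1 * h\<^sup>2 - 0\<^sup>2))"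
    unfolding nn_integral_inverse_quadratic[OF zero_less_one D, symmetric]
    by (rule nn_integral_cmult) measurable
  also have "\<dots> = 1" using h by (simp add: ennreal_mult'[symmetric])
  finally show ?thesis .
qed

text \<open>The right-hand side is the harmonic extension of \<open>1 / norm y\<close> to height
  \<open>h\<close>, so it has to be the Poisson integral; the proof computes it directly.\<close>

lemma nn_integral_poisson_newton_planar:
  fixes y1 y2 h :: real
  assumes h: "0 < h"
  shows "(\<integral>\<^sup>+\<xi>. ennreal (poisson h \<xi>) * (1 / ennreal (sqrt ((y1 + fst \<xi>)\<^sup>2 + (y2 + snd \<xi>)\<^sup>2))) \<partial>lborel) =
    ennreal (1 / sqrt (y1\<^sup>2 + y2\<^sup>2 + h\<^sup>2))"
proof -
  have [measurable]: "(\<lambda>p. poisson h (f p, g p)) \<in> borel_measurable M"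
    if [measurable]: "f \<in> borel_measurable M" "g \<in> borel_measurable M" for f g and M :: "'m measure"
    unfolding poisson_def fst_conv snd_conv by measurable
  text \<open>In the coordinates \<open>\<xi> = -y + (r, r * s)\<close> the area element divided by the distance \<open>norm (y + \<xi>)\<close> is
    \<open>dr ds / sqrt (1 + s\<^sup>2)\<close>: the singularity disappears, and for fixed \<open>s\<close> the Poisson kernel is a power of a
    quadratic polynomial in \<open>r\<close>.\<close>
  let ?g = "\<lambda>r s. ennreal (poisson h (r - y1, r * s - y2)) * ennreal (1 / sqrt (1 + s\<^sup>2))"
  have inner: "(\<integral>\<^sup>+b. ennreal (poisson h (r - y1, b)) * (1 / ennreal (sqrt (r\<^sup>2 + (y2 + b)\<^sup>2))) \<partial>lborel) = (\<integral>\<^sup>+s. ?g r s \<partial>lborel)"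
    if r: "r \<noteq> 0" for r
  proof -
    have "(\<integral>\<^sup>+b. ennreal (poisson h (r - y1, b)) * (1 / ennreal (sqrt (r\<^sup>2 + (y2 + b)\<^sup>2))) \<partial>lborel) =
      (\<integral>\<^sup>+b. ennreal (poisson h (r - y1, b) / sqrt (r\<^sup>2 + (y2 + b)\<^sup>2)) \<partial>lborel)"
    proof (rule nn_integral_cong)
      fix b
      have "0 < sqrt (r\<^sup>2 + (y2 + b)\<^sup>2)" using r by (simp add: add_pos_nonneg)
      then have "1 / ennreal (sqrt (r\<^sup>2 + (y2 + b)\<^sup>2)) = ennreal (1 / sqrt (r\<^sup>2 + (y2 + b)\<^sup>2))"
        using divide_ennreal[of 1 "sqrt (r\<^sup>2 + (y2 + b)\<^sup>2)"] by simp
      then show "ennreal (poisson h (r - y1, b)) * (1 / ennreal (sqrt (r\<^sup>2 + (y2 + b)\<^sup>2))) =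
          ennreal (poisson h (r - y1, b) / sqrt (r\<^sup>2 + (y2 + b)\<^sup>2))"
        using h by (simp add: ennreal_mult'[symmetric] poisson_nonneg)
    qed
    also have "\<dots> = ennreal \<bar>r\<bar> * (\<integral>\<^sup>+s. ennreal (poisson h (r - y1, - y2 + r * s) / sqrt (r\<^sup>2 + (y2 + (- y2 + r * s))\<^sup>2)) \<partial>lborel)"
      by (rule nn_integral_real_affine[OF _ r]) measurable
    also have "\<dots> = (\<integral>\<^sup>+s. ennreal \<bar>r\<bar> * ennreal (poisson h (r - y1, - y2 + r * s) / sqrt (r\<^sup>2 + (y2 + (- y2 + r * s))\<^sup>2)) \<partial>lborel)"
      by (rule nn_integral_cmult[symmetric]) measurable
    also have "\<dots> = (\<integral>\<^sup>+s. ?g r s \<partial>lborel)"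
    proof (rule nn_integral_cong)
      fix s
      have "r\<^sup>2 + (y2 + (- y2 + r * s))\<^sup>2 = r\<^sup>2 * (1 + s\<^sup>2)" by (simp add: power_mult_distrib algebra_simps)
      then have "\<bar>r\<bar> * (poisson h (r - y1, - y2 + r * s) / sqrt (r\<^sup>2 + (y2 + (- y2 + r * s))\<^sup>2)) =
          poisson h (r - y1, r * s - y2) * (1 / sqrt (1 + s\<^sup>2))"
        using r by (simp add: real_sqrt_mult add.commute)
      then show "ennreal \<bar>r\<bar> * ennreal (poisson h (r - y1, - y2 + r * s) / sqrt (r\<^sup>2 + (y2 + (- y2 + r * s))\<^sup>2)) = ?g r s"
        using h by (simp add: ennreal_mult'[symmetric] poisson_nonneg)
    qed
    finally show ?thesis .
  qed
  have outer: "(\<integral>\<^sup>+r. ?g r s \<partial>lborel) =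
      ennreal (h / pi) * ennreal (1 / ((y1\<^sup>2 + h\<^sup>2) * s\<^sup>2 - 2 * (y1 * y2) * s + (y2\<^sup>2 + h\<^sup>2)))" for s
  proof -
    let ?A = "1 + s\<^sup>2" and ?B = "y1 + y2 * s" and ?C = "y1\<^sup>2 + y2\<^sup>2 + h\<^sup>2"
    have A: "0 < ?A" by (simp add: add_pos_nonneg)
    have det: "?A * ?C - ?B\<^sup>2 = (y1\<^sup>2 + h\<^sup>2) * s\<^sup>2 - 2 * (y1 * y2) * s + (y2\<^sup>2 + h\<^sup>2)"
      by (simp add: power2_eq_square algebra_simps)
    have "?A * ?C - ?B\<^sup>2 = (y1 * s - y2)\<^sup>2 + h\<^sup>2 * ?A" by (simp add: power2_eq_square algebra_simps)
    also have "\<dots> > 0" using h A by (intro add_nonneg_pos) auto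
    finally have D: "?B\<^sup>2 < ?A * ?C" by simp
    have "(\<integral>\<^sup>+r. ?g r s \<partial>lborel) =
        (\<integral>\<^sup>+r. ennreal (h / (2 * pi) / sqrt ?A) * ennreal (1 / sqrt (?A * r\<^sup>2 - 2 * ?B * r + ?C) ^ 3) \<partial>lborel)"
    proof (rule nn_integral_cong)
      fix r
      have E: "(r - y1)\<^sup>2 + (r * s - y2)\<^sup>2 + h\<^sup>2 = ?A * r\<^sup>2 - 2 * ?B * r + ?C"
        by (simp add: power2_eq_square algebra_simps)
      have "poisson h (r - y1, r * s - y2) * (1 / sqrt ?A) =
          (h / (2 * pi) / sqrt ?A) * (1 / sqrt (?A * r\<^sup>2 - 2 * ?B * r + ?C) ^ 3)"
        unfolding poisson_def fst_conv snd_conv E by simp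
      then show "?g r s = ennreal (h / (2 * pi) / sqrt ?A) * ennreal (1 / sqrt (?A * r\<^sup>2 - 2 * ?B * r + ?C) ^ 3)"
        using h by (simp add: ennreal_mult'[symmetric] poisson_nonneg)
    qed
    also have "\<dots> = ennreal (h / (2 * pi) / sqrt ?A) * ennreal (2 * sqrt ?A / (?A * ?C - ?B\<^sup>2))"
      unfolding nn_integral_quadratic_three_halves[OF A D, symmetric]
      by (rule nn_integral_cmult) measurable
    also have "\<dots> = ennreal (h / pi * (1 / (?A * ?C - ?B\<^sup>2)))"
      using h A by (subst ennreal_mult'[symmetric]) auto
    also have "\<dots> = ennreal (h / pi) * ennreal (1 / (?A * ?C - ?B\<^sup>2))"
      using h by (intro ennreal_mult') auto
    finally show ?thesis by (simp only: det)
  qed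
  have "(\<integral>\<^sup>+\<xi>. ennreal (poisson h \<xi>) * (1 / ennreal (sqrt ((y1 + fst \<xi>)\<^sup>2 + (y2 + snd \<xi>)\<^sup>2))) \<partial>lborel) =
      (\<integral>\<^sup>+a. \<integral>\<^sup>+b. ennreal (poisson h (a, b)) * (1 / ennreal (sqrt ((y1 + a)\<^sup>2 + (y2 + b)\<^sup>2))) \<partial>lborel \<partial>lborel)"
    by (subst nn_integral_pair_lborel) auto
  also have "\<dots> = (\<integral>\<^sup>+r. \<integral>\<^sup>+b. ennreal (poisson h (- y1 + 1 * r, b)) * (1 / ennreal (sqrt ((y1 + (- y1 + 1 * r))\<^sup>2 + (y2 + b)\<^sup>2))) \<partial>lborel \<partial>lborel)"
    by (subst nn_integral_real_affine[where c=1 and t="- y1"]) auto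
  also have "\<dots> = (\<integral>\<^sup>+r. \<integral>\<^sup>+s. ?g r s \<partial>lborel \<partial>lborel)"
  proof (rule nn_integral_cong_AE)
    show "AE r in lborel. (\<integral>\<^sup>+b. ennreal (poisson h (- y1 + 1 * r, b)) * (1 / ennreal (sqrt ((y1 + (- y1 + 1 * r))\<^sup>2 + (y2 + b)\<^sup>2))) \<partial>lborel) =
        (\<integral>\<^sup>+s. ?g r s \<partial>lborel)"
      using AE_lborel_singleton[of "0::real"] by eventually_elim (simp add: inner add.commute[of "- y1"])
  qed
  \<comment> \<open>The order is exchanged because for a fixed slope \<open>s\<close> the integral
    over \<open>r\<close> is explicit and leaves the reciprocal of a quadratic in
    \<open>s\<close>.\<close>
  also have "\<dots> = (\<integral>\<^sup>+s. \<integral>\<^sup>+r. ?g r s \<partial>lborel \<partial>lborel)"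
    by (rule lborel_pair.Fubini') measurable
  also have "\<dots> = (\<integral>\<^sup>+s. ennreal (h / pi) * ennreal (1 / ((y1\<^sup>2 + h\<^sup>2) * s\<^sup>2 - 2 * (y1 * y2) * s + (y2\<^sup>2 + h\<^sup>2))) \<partial>lborel)"
    by (simp only: outer)
  also have "\<dots> = ennreal (1 / sqrt (y1\<^sup>2 + y2\<^sup>2 + h\<^sup>2))"
  proof -
    let ?A = "y1\<^sup>2 + h\<^sup>2" and ?B = "y1 * y2" and ?C = "y2\<^sup>2 + h\<^sup>2"
    have A: "0 < ?A" using h by (simp add: add_nonneg_pos)
    \<comment> \<open>Its square root is \<open>h\<close> times the wanted denominator, and this
      \<open>h\<close> cancels the factor in front of the integral.\<close>
    have det: "?A * ?C - ?B\<^sup>2 = h\<^sup>2 * (y1\<^sup>2 + y2\<^sup>2 + h\<^sup>2)" by (simp add: power2_eq_square algebra_simps)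
    have pos: "0 < y1\<^sup>2 + y2\<^sup>2 + h\<^sup>2" using h by (simp add: add_nonneg_pos)
    have D: "?B\<^sup>2 < ?A * ?C" using det pos h by (smt (verit) mult_pos_pos zero_less_power)
    have "(\<integral>\<^sup>+s. ennreal (h / pi) * ennreal (1 / (?A * s\<^sup>2 - 2 * ?B * s + ?C)) \<partial>lborel) =
        ennreal (h / pi) * ennreal (pi / sqrt (?A * ?C - ?B\<^sup>2))"
      unfolding nn_integral_inverse_quadratic[OF A D, symmetric]
      by (rule nn_integral_cmult) measurable
    also have "\<dots> = ennreal (h / pi * (pi / sqrt (?A * ?C - ?B\<^sup>2)))"
      using h by (subst ennreal_mult') auto
    also have "h / pi * (pi / sqrt (?A * ?C - ?B\<^sup>2)) = 1 / sqrt (y1\<^sup>2 + y2\<^sup>2 + h\<^sup>2)"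
      unfolding det using h by (simp add: real_sqrt_mult)
    finally show ?thesis .
  qed
  finally show ?thesis .
qed

text \<open>For \<open>b \<le> 0\<close> the right-hand side is 1/0, which is \<infinity> in
  \<open>ennreal\<close>.\<close>

lemma one_over_ennreal_antimono: "b \<le> a \<Longrightarrow> 1 / ennreal a \<le> 1 / ennreal b"
proof (cases "0 < b")
  case True
  assume "b \<le> a"
  then show ?thesis using True divide_ennreal[of 1 a] divide_ennreal[of 1 b]
    by (simp add: ennreal_leI frac_le)
next
  case False
  then show ?thesis by (simp add: ennreal_neg ennreal_divide_zero)
qed

lemma nn_integral_poisson_newton_planar_le:
  assumes h: "0 < h"
  shows "(\<integral>\<^sup>+\<xi>. ennreal (poisson h \<xi>) * (1 / ennreal (sqrt ((y1 + fst \<xi>)\<^sup>2 + (y2 + snd \<xi>)\<^sup>2))) \<partial>lborel) \<le>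
    1 / ennreal (sqrt (y1\<^sup>2 + y2\<^sup>2))"
proof (cases "y1\<^sup>2 + y2\<^sup>2 = 0")
  case True
  then show ?thesis by (simp add: ennreal_divide_zero)
next
  case False
  then have pos: "0 < y1\<^sup>2 + y2\<^sup>2" by (simp add: sum_power2_gt_zero_iff)
  have "1 / sqrt (y1\<^sup>2 + y2\<^sup>2 + h\<^sup>2) \<le> 1 / sqrt (y1\<^sup>2 + y2\<^sup>2)"
    using pos by (intro divide_left_mono) (auto simp: add_pos_nonneg)
  then have "ennreal (1 / sqrt (y1\<^sup>2 + y2\<^sup>2 + h\<^sup>2)) \<le> ennreal (1 / sqrt (y1\<^sup>2 + y2\<^sup>2))" by (rule ennreal_leI)
  also have "\<dots> = 1 / ennreal (sqrt (y1\<^sup>2 + y2\<^sup>2))"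
    using pos divide_ennreal[of 1 "sqrt (y1\<^sup>2 + y2\<^sup>2)"] by simp
  finally show ?thesis by (simp add: nn_integral_poisson_newton_planar[OF h])
qed

text \<open>For a position at height \<open>z\<close> above the plane of the perturbation, the potential \<open>1 / sqrt (norm y\<^sup>2 + z\<^sup>2)\<close>
  is itself a Poisson average of the planar potential, so that the roles of \<open>h\<close> and \<open>z\<close> can be exchanged.\<close>

lemma nn_integral_poisson_newton:
  fixes y1 y2 z h :: real
  assumes h: "0 < h" and z: "0 \<le> z"
  shows "(\<integral>\<^sup>+\<xi>. ennreal (poisson h \<xi>) * (1 / ennreal (sqrt ((y1 + fst \<xi>)\<^sup>2 + (y2 + snd \<xi>)\<^sup>2 + z\<^sup>2))) \<partial>lborel) \<le>
      1 / ennreal (sqrt (y1\<^sup>2 + y2\<^sup>2 + z\<^sup>2))" (is "?I \<le> _")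
    and "(\<integral>\<^sup>+\<xi>. ennreal (poisson h \<xi>) * (1 / ennreal (sqrt ((y1 + fst \<xi>)\<^sup>2 + (y2 + snd \<xi>)\<^sup>2 + z\<^sup>2))) \<partial>lborel) \<le>
      ennreal (1 / h)"
proof -
  \<comment> \<open>Dropping the height \<open>z\<close> only enlarges the integrand, and the planar
    average that remains is largest at \<open>y = 0\<close>, with value
    \<open>1 / h\<close>.\<close>
  have "?I \<le> (\<integral>\<^sup>+\<xi>. ennreal (poisson h \<xi>) * (1 / ennreal (sqrt ((y1 + fst \<xi>)\<^sup>2 + (y2 + snd \<xi>)\<^sup>2))) \<partial>lborel)"
    by (intro nn_integral_mono mult_left_mono one_over_ennreal_antimono real_sqrt_le_mono) auto
  also have "\<dots> = ennreal (1 / sqrt (y1\<^sup>2 + y2\<^sup>2 + h\<^sup>2))"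
    by (rule nn_integral_poisson_newton_planar[OF h])
  also have "\<dots> \<le> ennreal (1 / h)"
  proof (intro ennreal_leI divide_left_mono)
    show "h \<le> sqrt (y1\<^sup>2 + y2\<^sup>2 + h\<^sup>2)" using h by (intro real_le_rsqrt) simp
    then show "0 < sqrt (y1\<^sup>2 + y2\<^sup>2 + h\<^sup>2) * h" using h by (intro mult_pos_pos) linarith+
  qed simp
  finally show "?I \<le> ennreal (1 / h)" .
  show "?I \<le> 1 / ennreal (sqrt (y1\<^sup>2 + y2\<^sup>2 + z\<^sup>2))"
  proof (cases "z = 0")
    case True
    then show ?thesis using nn_integral_poisson_newton_planar_le[OF h] by simp
  next
    case False
    with z have z: "0 < z" by simp
    let ?N = "\<lambda>\<xi> \<zeta>. 1 / ennreal (sqrt ((y1 + fst \<xi> + fst \<zeta>)\<^sup>2 + (y2 + snd \<xi> + snd \<zeta>)\<^sup>2))"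
    have expand: "1 / ennreal (sqrt (u\<^sup>2 + v\<^sup>2 + z\<^sup>2)) =
        (\<integral>\<^sup>+\<zeta>. ennreal (poisson z \<zeta>) * (1 / ennreal (sqrt ((u + fst \<zeta>)\<^sup>2 + (v + snd \<zeta>)\<^sup>2))) \<partial>lborel)" for u v
      using z divide_ennreal[of 1 "sqrt (u\<^sup>2 + v\<^sup>2 + z\<^sup>2)"]
      by (simp add: nn_integral_poisson_newton_planar add_nonneg_pos)
    have "?I = (\<integral>\<^sup>+\<xi>. ennreal (poisson h \<xi>) * (\<integral>\<^sup>+\<zeta>. ennreal (poisson z \<zeta>) * ?N \<xi> \<zeta> \<partial>lborel) \<partial>lborel)"
      by (simp only: expand)
    also have "\<dots> = (\<integral>\<^sup>+\<xi>. \<integral>\<^sup>+\<zeta>. ennreal (poisson h \<xi>) * (ennreal (poisson z \<zeta>) * ?N \<xi> \<zeta>) \<partial>lborel \<partial>lborel)"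
      by (intro nn_integral_cong nn_integral_cmult[symmetric]) measurable
    also have "\<dots> = (\<integral>\<^sup>+\<zeta>. \<integral>\<^sup>+\<xi>. ennreal (poisson h \<xi>) * (ennreal (poisson z \<zeta>) * ?N \<xi> \<zeta>) \<partial>lborel \<partial>lborel)"
      by (rule lborel_pair.Fubini') measurable
    also have "\<dots> = (\<integral>\<^sup>+\<zeta>. ennreal (poisson z \<zeta>) * (\<integral>\<^sup>+\<xi>. ennreal (poisson h \<xi>) *
        (1 / ennreal (sqrt (((y1 + fst \<zeta>) + fst \<xi>)\<^sup>2 + ((y2 + snd \<zeta>) + snd \<xi>)\<^sup>2))) \<partial>lborel) \<partial>lborel)"
      by (subst nn_integral_cmult[symmetric]) (auto intro!: nn_integral_cong simp: mult_ac add_ac)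
    also have "\<dots> \<le> (\<integral>\<^sup>+\<zeta>. ennreal (poisson z \<zeta>) * (1 / ennreal (sqrt ((y1 + fst \<zeta>)\<^sup>2 + (y2 + snd \<zeta>)\<^sup>2))) \<partial>lborel)"
      by (intro nn_integral_mono mult_left_mono nn_integral_poisson_newton_planar_le[OF h]) auto
    also have "\<dots> = 1 / ennreal (sqrt (y1\<^sup>2 + y2\<^sup>2 + z\<^sup>2))" by (rule expand[symmetric])
    finally show ?thesis .
  qed
qed

text \<open>Beyond 1 the Cauchy marginal is below \<open>h / (pi * a^2)\<close>, with integral
  \<open>h / pi\<close> on each side.\<close>

lemma nn_integral_poisson_tail_fst:
  assumes h: "0 < h"
  shows "(\<integral>\<^sup>+\<xi>. ennreal (poisson h \<xi>) * indicator {\<xi>. 1 < \<bar>fst \<xi>\<bar>} \<xi> \<partial>lborel) \<le> ennreal (2 * h / pi)"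
proof -
  have "(\<integral>\<^sup>+\<xi>. ennreal (poisson h \<xi>) * indicator {\<xi>. 1 < \<bar>fst \<xi>\<bar>} \<xi> \<partial>lborel) =
     (\<integral>\<^sup>+a. \<integral>\<^sup>+b. ennreal (poisson h (a, b)) * indicator {a. 1 < \<bar>a\<bar>} a \<partial>lborel \<partial>lborel)"
    by (subst nn_integral_pair_lborel) (auto intro!: nn_integral_cong split: split_indicator)
  also have "\<dots> = (\<integral>\<^sup>+a. ennreal (h / pi * (1 / (a\<^sup>2 + h\<^sup>2))) * indicator {a. 1 < \<bar>a\<bar>} a \<partial>lborel)"
    using h by (intro nn_integral_cong) (auto simp: nn_integral_poisson_fst split: split_indicator)
  also have "\<dots> \<le> (\<integral>\<^sup>+a. ennreal (h / pi) * (ennreal (1 / a\<^sup>2) * indicator {1..} a) +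
      ennreal (h / pi) * (ennreal (1 / a\<^sup>2) * indicator {..-1} a) \<partial>lborel)"
  proof (rule nn_integral_mono)
    fix a :: real
    show "ennreal (h / pi * (1 / (a\<^sup>2 + h\<^sup>2))) * indicator {a. 1 < \<bar>a\<bar>} a \<le>
      ennreal (h / pi) * (ennreal (1 / a\<^sup>2) * indicator {1..} a) + ennreal (h / pi) * (ennreal (1 / a\<^sup>2) * indicator {..-1} a)"
    proof (cases "1 < \<bar>a\<bar>")
      case True
      then have "a \<noteq> 0" by auto
      then have "h / pi * (1 / (a\<^sup>2 + h\<^sup>2)) \<le> h / pi * (1 / a\<^sup>2)"
        using h by (intro mult_left_mono divide_left_mono) (auto simp: add_pos_nonneg)
      then have "ennreal (h / pi * (1 / (a\<^sup>2 + h\<^sup>2))) \<le> ennreal (h / pi) * ennreal (1 / a\<^sup>2)"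
        using h by (simp add: ennreal_mult'[symmetric] ennreal_leI)
      then show ?thesis using True by (cases "1 \<le> a") (auto split: split_indicator)
    qed simp
  qed
  also have "\<dots> = ennreal (h / pi) * (\<integral>\<^sup>+a. ennreal (1 / a\<^sup>2) * indicator {1..} a \<partial>lborel) +
      ennreal (h / pi) * (\<integral>\<^sup>+a. ennreal (1 / a\<^sup>2) * indicator {..-1} a \<partial>lborel)"
    by (subst nn_integral_add) (auto simp: nn_integral_cmult)
  also have "(\<integral>\<^sup>+a. ennreal (1 / a\<^sup>2) * indicator {..-1} a \<partial>lborel) = 
      (\<integral>\<^sup>+a. ennreal (1 / (0 + (-1) * a)\<^sup>2) * indicator {..-1} (0 + (-1) * a) \<partial>(lborel :: real measure))"
    by (subst nn_integral_real_affine[where c="-1" and t=0]) auto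
  also have "(\<integral>\<^sup>+a. ennreal (1 / (0 + (-1) * a)\<^sup>2) * indicator {..-1} (0 + (-1) * a) \<partial>(lborel :: real measure)) =
      (\<integral>\<^sup>+a. ennreal (1 / a\<^sup>2) * indicator {1..} a \<partial>lborel)"
    by (intro nn_integral_cong) (auto split: split_indicator)
  also have "(\<integral>\<^sup>+a. ennreal (1 / a\<^sup>2) * indicator {1..} a \<partial>lborel) = ennreal (0 - (- (1 / 1)))"
  proof (rule nn_integral_FTC_atLeast[where F="\<lambda>a. - (1 / a)" and T=0])
    show "((\<lambda>a. - (1 / a)) has_real_derivative 1 / a\<^sup>2) (at a)" if "1 \<le> a" for a :: real
      using that by (auto intro!: derivative_eq_intros simp: power2_eq_square)
    show "((\<lambda>a::real. - (1 / a)) \<longlongrightarrow> 0) at_top" by real_asymp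
  qed auto
  finally show ?thesis using h by (simp add: ennreal_plus[symmetric] add_divide_distrib[symmetric] del: ennreal_plus)
qed

text \<open>As \<open>a^2 / (a^2 + h^2) \<le> 1\<close>, the Cauchy marginal contributes at most
  \<open>h / pi\<close> per unit length; over the whole line the second moment would be
  infinite.\<close>

lemma nn_integral_poisson_second_moment_fst:
  assumes h: "0 < h"
  shows "(\<integral>\<^sup>+\<xi>. ennreal (poisson h \<xi>) * (ennreal ((fst \<xi>)\<^sup>2) * indicator {\<xi>. \<bar>fst \<xi>\<bar> \<le> 1} \<xi>) \<partial>lborel) \<le> ennreal (2 * h / pi)"
proof -
  have "(\<integral>\<^sup>+\<xi>. ennreal (poisson h \<xi>) * (ennreal ((fst \<xi>)\<^sup>2) * indicator {\<xi>. \<bar>fst \<xi>\<bar> \<le> 1} \<xi>) \<partial>lborel) =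
     (\<integral>\<^sup>+a. \<integral>\<^sup>+b. ennreal (poisson h (a, b)) * (ennreal (a\<^sup>2) * indicator {a. \<bar>a\<bar> \<le> 1} a) \<partial>lborel \<partial>lborel)"
    by (subst nn_integral_pair_lborel) (auto intro!: nn_integral_cong split: split_indicator)
  also have "\<dots> = (\<integral>\<^sup>+a. ennreal (h / pi * (1 / (a\<^sup>2 + h\<^sup>2))) * (ennreal (a\<^sup>2) * indicator {a. \<bar>a\<bar> \<le> 1} a) \<partial>lborel)"
  proof (rule nn_integral_cong)
    fix a :: real
    have "(\<lambda>b. ennreal (poisson h (a, b))) \<in> borel_measurable lborel"
      unfolding poisson_def fst_conv snd_conv by measurable
    then show "(\<integral>\<^sup>+b. ennreal (poisson h (a, b)) * (ennreal (a\<^sup>2) * indicator {a. \<bar>a\<bar> \<le> 1} a) \<partial>lborel) =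
        ennreal (h / pi * (1 / (a\<^sup>2 + h\<^sup>2))) * (ennreal (a\<^sup>2) * indicator {a. \<bar>a\<bar> \<le> 1} a)"
      by (simp only: nn_integral_multc nn_integral_poisson_fst[OF h])
  qed
  also have "\<dots> \<le> (\<integral>\<^sup>+a. ennreal (h / pi) * indicator {-1..1::real} a \<partial>lborel)"
  proof (rule nn_integral_mono)
    fix a :: real
    have "1 / (a\<^sup>2 + h\<^sup>2) * a\<^sup>2 \<le> 1" using h by (simp add: divide_le_eq add_nonneg_pos)
    then have "h / pi * (1 / (a\<^sup>2 + h\<^sup>2) * a\<^sup>2) \<le> h / pi * 1" using h by (intro mult_left_mono) auto
    then have "ennreal (h / pi * (1 / (a\<^sup>2 + h\<^sup>2))) * ennreal (a\<^sup>2) \<le> ennreal (h / pi)"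
      by (subst ennreal_mult''[symmetric]) (auto intro!: ennreal_leI simp: mult.assoc)
    then show "ennreal (h / pi * (1 / (a\<^sup>2 + h\<^sup>2))) * (ennreal (a\<^sup>2) * indicator {a. \<bar>a\<bar> \<le> 1} a) \<le> ennreal (h / pi) * indicator {-1..1} a"
      by (auto split: split_indicator)
  qed
  also have "\<dots> = ennreal (h / pi) * 2" by (simp add: nn_integral_cmult_indicator)
  also have "\<dots> = ennreal (2 * h / pi)"
    using h ennreal_mult[of "h / pi" 2] by (simp add: mult.commute)
  finally show ?thesis .
qed

section \<open>Averaged perturbations\<close>

text \<open>Any almost everywhere derivative may replace \<open>vector_derivative\<close>; a
  measurable \<open>g\<close> then allows the action to be split into kinetic and potential
  part.\<close>

lemma action_eq_nn_integral:
  fixes \<gamma> :: "real \<Rightarrow> ('a::euclidean_space, 'n::{finite,linorder}) vec"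
  assumes g: "AE t in lborel. a < t \<and> t < b \<longrightarrow> (\<gamma> has_vector_derivative g t) (at t)"
  shows "action m a b \<gamma> = (\<integral>\<^sup>+t\<in>{a..b}. (ennreal (kinetic m (g t)) + potential m (\<gamma> t)) \<partial>lborel)"
  unfolding action_def lagrangian_def
proof (rule nn_integral_cong_AE)
  show "AE t in lborel. (ennreal (kinetic m (vector_derivative \<gamma> (at t within {a..b}))) + potential m (\<gamma> t)) * indicator {a..b} t =
      (ennreal (kinetic m (g t)) + potential m (\<gamma> t)) * indicator {a..b} t"
    using g AE_lborel_singleton[of a] AE_lborel_singleton[of b]
  proof eventually_elim
    case (elim t)
    show ?case
    proof (cases "t \<in> {a..b}")
      case True
      then have "a < t" "t < b" using elim by auto
      then have "vector_derivative \<gamma> (at t within {a..b}) = g t"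
        using elim by (intro vector_derivative_within_interior) auto
      then show ?thesis by simp
    qed simp
  qed
qed

lemma borel_measurable_vec_nth[measurable]:
  "(\<lambda>x::('a::euclidean_space, 'n::finite) vec. x $ i) \<in> borel_measurable borel"
  by (intro borel_measurable_continuous_onI continuous_intros)

lemma potential_measurable[measurable]:
  "(potential m :: ('a::euclidean_space, 'n::{finite,linorder}) vec \<Rightarrow> ennreal) \<in> borel_measurable borel"
  unfolding potential_def[abs_def] case_prod_unfold by measurable

lemma kinetic_measurable[measurable]:
  "(kinetic m :: ('a::euclidean_space, 'n::finite) vec \<Rightarrow> real) \<in> borel_measurable borel"
  unfolding kinetic_def[abs_def] by measurable

lemma kinetic_parallelogram:
  fixes u v :: "('a::euclidean_space, 'n::finite) vec"
  shows "kinetic m (u + v) + kinetic m (u - v) = 2 * kinetic m u + 2 * kinetic m v"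
proof -
  have "(norm (p + q))\<^sup>2 + (norm (p - q))\<^sup>2 = 2 * (norm p)\<^sup>2 + 2 * (norm q)\<^sup>2" for p q :: 'a
    unfolding power2_norm_eq_inner by (simp add: inner_simps inner_commute)
  then have "m i * (norm (u $ i + v $ i))\<^sup>2 + m i * (norm (u $ i - v $ i))\<^sup>2 =
      2 * (m i * (norm (u $ i))\<^sup>2) + 2 * (m i * (norm (v $ i))\<^sup>2)" for i
    by (metis (no_types, opaque_lifting) distrib_left mult.left_commute)
  then have "(\<Sum>i\<in>UNIV. m i * (norm (u $ i + v $ i))\<^sup>2) + (\<Sum>i\<in>UNIV. m i * (norm (u $ i - v $ i))\<^sup>2) =
      2 * (\<Sum>i\<in>UNIV. m i * (norm (u $ i))\<^sup>2) + 2 * (\<Sum>i\<in>UNIV. m i * (norm (v $ i))\<^sup>2)"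
    by (simp add: sum.distrib[symmetric] sum_distrib_left)
  then show ?thesis by (simp add: kinetic_def)
qed

text \<open>Only body \<open>i\<close> moves, so all its positions relative to the others are
  shifted by the same planar vector, and pairs without \<open>i\<close> are left alone.\<close>

definition planar_shift :: "'n \<Rightarrow> 'a \<Rightarrow> 'a \<Rightarrow> real \<times> real \<Rightarrow> ('a::euclidean_space, 'n::finite) vec" where
  "planar_shift i e1 e2 \<xi> = axis i (fst \<xi> *\<^sub>R e1 + snd \<xi> *\<^sub>R e2)"

lemma planar_shift_alt: "planar_shift i e1 e2 \<xi> = fst \<xi> *\<^sub>R axis i e1 + snd \<xi> *\<^sub>R axis i e2"
  by (simp add: planar_shift_def vec_eq_iff axis_def)

lemma planar_shift_minus: "planar_shift i e1 e2 (- \<xi>) = - planar_shift i e1 e2 \<xi>"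
  by (simp add: planar_shift_alt)

lemma kinetic_planar_shift:
  assumes "e1 \<in> Basis" "e2 \<in> Basis" "e1 \<noteq> e2"
  shows "kinetic m (planar_shift i e1 e2 \<xi>) = m i / 2 * ((fst \<xi>)\<^sup>2 + (snd \<xi>)\<^sup>2)"
proof -
  have "(norm (fst \<xi> *\<^sub>R e1 + snd \<xi> *\<^sub>R e2))\<^sup>2 = (fst \<xi>)\<^sup>2 + (snd \<xi>)\<^sup>2"
    using assms unfolding power2_norm_eq_inner by (simp add: inner_simps inner_Basis power2_eq_square)
  moreover have "(\<Sum>k\<in>UNIV. m k * (norm (axis i v $ k))\<^sup>2) = m i * (norm v)\<^sup>2" for v :: 'a
    by (subst sum.remove[of _ i]) (auto simp: axis_def intro!: sum.neutral)
  ultimately show ?thesis by (simp add: kinetic_def planar_shift_def)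
qed

lemma planar_shift_measurable[measurable]: "planar_shift i e1 e2 \<in> borel_measurable borel"
  unfolding planar_shift_alt[abs_def] by measurable

text \<open>Only the coordinates of \<open>x\<close> along \<open>e1\<close> and \<open>e2\<close>
  and the length of the orthogonal remainder enter. In every dimension the integral is thus the one
  for a point at height \<open>z\<close> over a plane, up to scaling by \<open>c\<close>.\<close>

lemma nn_integral_poisson_shifted_newton:
  fixes x e1 e2 :: "'a::euclidean_space"
  assumes h: "0 < h" and c: "0 < c" and e: "e1 \<in> Basis" "e2 \<in> Basis" "e1 \<noteq> e2"
  shows "(\<integral>\<^sup>+\<xi>. ennreal (poisson h \<xi>) * (1 / ennreal (norm (x + c *\<^sub>R (fst \<xi> *\<^sub>R e1 + snd \<xi> *\<^sub>R e2)))) \<partial>lborel) \<le>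
    min (1 / ennreal (norm x)) (ennreal (1 / (c * h)))"
proof -
  have ee: "e1 \<bullet> e1 = 1" "e2 \<bullet> e2 = 1" "e1 \<bullet> e2 = 0" "e2 \<bullet> e1 = 0"
    using e by (auto simp: inner_Basis)
  define y1 where "y1 = (x \<bullet> e1) / c"
  define y2 where "y2 = (x \<bullet> e2) / c"
  define x' where "x' = x - (x \<bullet> e1) *\<^sub>R e1 - (x \<bullet> e2) *\<^sub>R e2"
  define z where "z = norm x' / c"
  have z: "0 \<le> z" using c by (simp add: z_def)
  have orth: "x' \<bullet> e1 = 0" "x' \<bullet> e2 = 0" "e1 \<bullet> x' = 0" "e2 \<bullet> x' = 0"
    by (auto simp: x'_def inner_simps ee inner_commute)
  have scale: "norm (x + c *\<^sub>R (s *\<^sub>R e1 + r *\<^sub>R e2)) = c * sqrt ((y1 + s)\<^sup>2 + (y2 + r)\<^sup>2 + z\<^sup>2)" for s r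
  proof -
    have xd: "x + c *\<^sub>R (s *\<^sub>R e1 + r *\<^sub>R e2) = x' + (c * (y1 + s)) *\<^sub>R e1 + (c * (y2 + r)) *\<^sub>R e2"
      using c by (simp add: x'_def y1_def y2_def algebra_simps)
    have "(norm (x + c *\<^sub>R (s *\<^sub>R e1 + r *\<^sub>R e2)))\<^sup>2 = (norm x')\<^sup>2 + (c * (y1 + s))\<^sup>2 + (c * (y2 + r))\<^sup>2"
      unfolding xd power2_norm_eq_inner by (simp add: inner_simps ee orth power2_eq_square)
    also have "norm x' = c * z" using c by (simp add: z_def)
    also have "(c * z)\<^sup>2 + (c * (y1 + s))\<^sup>2 + (c * (y2 + r))\<^sup>2 = c\<^sup>2 * ((y1 + s)\<^sup>2 + (y2 + r)\<^sup>2 + z\<^sup>2)"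
      unfolding power_mult_distrib by (simp add: distrib_left[of "c\<^sup>2"])
    also have "\<dots> = (c * sqrt ((y1 + s)\<^sup>2 + (y2 + r)\<^sup>2 + z\<^sup>2))\<^sup>2"
      by (simp add: power_mult_distrib)
    finally have sq: "(norm (x + c *\<^sub>R (s *\<^sub>R e1 + r *\<^sub>R e2)))\<^sup>2 = (c * sqrt ((y1 + s)\<^sup>2 + (y2 + r)\<^sup>2 + z\<^sup>2))\<^sup>2" .
    show ?thesis by (rule power2_eq_imp_eq[OF sq]) (use c in auto)
  qed
  \<comment> \<open>At \<open>q = 0\<close> both sides are \<infinity>, so collisions of the shifted
    positions need not be excluded.\<close>
  have div_scale: "1 / ennreal (c * q) = ennreal (1 / c) * (1 / ennreal q)" if "0 \<le> q" for q
  proof (cases "q = 0")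
    case True
    then show ?thesis using c by (simp add: ennreal_divide_zero ennreal_mult_top)
  next
    case False
    then show ?thesis using c that divide_ennreal[of 1 "c * q"] divide_ennreal[of 1 q]
      by (simp add: ennreal_mult'[symmetric])
  qed
  let ?I = "\<integral>\<^sup>+\<xi>. ennreal (poisson h \<xi>) * (1 / ennreal (sqrt ((y1 + fst \<xi>)\<^sup>2 + (y2 + snd \<xi>)\<^sup>2 + z\<^sup>2))) \<partial>lborel"
  have "(\<integral>\<^sup>+\<xi>. ennreal (poisson h \<xi>) * (1 / ennreal (norm (x + c *\<^sub>R (fst \<xi> *\<^sub>R e1 + snd \<xi> *\<^sub>R e2)))) \<partial>lborel) =
      (\<integral>\<^sup>+\<xi>. ennreal (1 / c) * (ennreal (poisson h \<xi>) * (1 / ennreal (sqrt ((y1 + fst \<xi>)\<^sup>2 + (y2 + snd \<xi>)\<^sup>2 + z\<^sup>2)))) \<partial>lborel)"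
    unfolding scale by (intro nn_integral_cong) (simp add: div_scale mult_ac)
  also have "\<dots> = ennreal (1 / c) * ?I"
    by (rule nn_integral_cmult) measurable
  finally have eq: "(\<integral>\<^sup>+\<xi>. ennreal (poisson h \<xi>) * (1 / ennreal (norm (x + c *\<^sub>R (fst \<xi> *\<^sub>R e1 + snd \<xi> *\<^sub>R e2)))) \<partial>lborel) =
      ennreal (1 / c) * ?I" .
  have "ennreal (1 / c) * ?I \<le> ennreal (1 / c) * (1 / ennreal (sqrt (y1\<^sup>2 + y2\<^sup>2 + z\<^sup>2)))"
    by (intro mult_left_mono nn_integral_poisson_newton[OF h z]) simp
  also have "\<dots> = 1 / ennreal (norm x)"
    using scale[of 0 0] by (simp add: div_scale)
  finally have 1: "ennreal (1 / c) * ?I \<le> 1 / ennreal (norm x)" .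
  have "ennreal (1 / c) * ?I \<le> ennreal (1 / c) * ennreal (1 / h)"
    by (intro mult_left_mono nn_integral_poisson_newton[OF h z]) simp
  also have "\<dots> = ennreal (1 / (c * h))" using c h by (simp add: ennreal_mult'[symmetric])
  finally show ?thesis using 1 by (simp add: eq)
qed

text \<open>Pairs without \<open>i\<close> keep their value because the kernel has mass 1, and
  averaging increases no pair containing \<open>i\<close>. The pair of \<open>i\<close> and
  \<open>j\<close> alone gets the improved bound; \<open>min\<close> and \<open>max\<close> put it
  into the order required by the sum.\<close>

lemma nn_integral_poisson_potential:
  fixes x :: "('a::euclidean_space, 'n::{finite,linorder}) vec"
  assumes m: "\<And>i. m i > 0" and h: "0 < h" and c: "0 < c" and e: "e1 \<in> Basis" "e2 \<in> Basis" "e1 \<noteq> e2"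
    and ij: "i \<noteq> j"
  shows "(\<integral>\<^sup>+\<xi>. ennreal (poisson h \<xi>) * potential m (x + c *\<^sub>R planar_shift i e1 e2 \<xi>) \<partial>lborel) \<le>
    (\<Sum>(k, l)\<in>{(k, l). k < l} - {(min i j, max i j)}. ennreal (m k * m l) / ennreal (norm (x $ k - x $ l))) +
    ennreal (m i * m j) * min (1 / ennreal (norm (x $ i - x $ j))) (ennreal (1 / (c * h)))"
proof -
  let ?x = "\<lambda>\<xi>. x + c *\<^sub>R planar_shift i e1 e2 \<xi>"
  let ?P = "{(k, l). k < l} :: ('n \<times> 'n) set"
  have lt: "min i j < max i j" using ij by (auto simp: min_def max_def)
  define J where "J k l = (\<integral>\<^sup>+\<xi>. ennreal (poisson h \<xi>) * (1 / ennreal (norm (?x \<xi> $ k - ?x \<xi> $ l))) \<partial>lborel)" for k l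
  have J_sym: "J k l = J l k" for k l by (simp add: J_def norm_minus_commute)
  have J_i: "J i l \<le> min (1 / ennreal (norm (x $ i - x $ l))) (ennreal (1 / (c * h)))" if "l \<noteq> i" for l
  proof -
    have E: "?x \<xi> $ i - ?x \<xi> $ l = (x $ i - x $ l) + c *\<^sub>R (fst \<xi> *\<^sub>R e1 + snd \<xi> *\<^sub>R e2)" for \<xi>
      using that by (simp add: planar_shift_def axis_def)
    show ?thesis unfolding J_def E by (rule nn_integral_poisson_shifted_newton[OF h c e])
  qed
  have J_le: "J k l \<le> 1 / ennreal (norm (x $ k - x $ l))" if "k < l" for k l
  proof -
    consider "k = i" | "l = i" | "k \<noteq> i" "l \<noteq> i" by blast
    then show ?thesis
    proof cases
      case 1
      then show ?thesis using J_i[of l] that by auto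
    next
      case 2
      then show ?thesis using J_i[of k] that J_sym[of k l] by (auto simp: norm_minus_commute)
    next
      case 3
      have "J k l = (\<integral>\<^sup>+\<xi>. ennreal (poisson h \<xi>) * (1 / ennreal (norm (x $ k - x $ l))) \<partial>lborel)"
        using 3 by (simp add: J_def planar_shift_def axis_def)
      also have "\<dots> = 1 / ennreal (norm (x $ k - x $ l))"
        by (simp add: nn_integral_multc nn_integral_poisson[OF h])
      finally show ?thesis by simp
    qed
  qed
  have "(\<integral>\<^sup>+\<xi>. ennreal (poisson h \<xi>) * potential m (?x \<xi>) \<partial>lborel) =
      (\<integral>\<^sup>+\<xi>. (\<Sum>(k, l)\<in>?P. ennreal (m k * m l) * (ennreal (poisson h \<xi>) * (1 / ennreal (norm (?x \<xi> $ k - ?x \<xi> $ l))))) \<partial>lborel)"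
    by (intro nn_integral_cong)
       (simp add: potential_def sum_distrib_left case_prod_unfold ennreal_times_divide mult_ac)
  also have "\<dots> = (\<Sum>(k, l)\<in>?P. ennreal (m k * m l) * J k l)"
    unfolding J_def case_prod_unfold by (subst nn_integral_sum) (auto intro!: sum.cong nn_integral_cmult)
  also have "\<dots> = (\<Sum>(k, l)\<in>?P - {(min i j, max i j)}. ennreal (m k * m l) * J k l) +
      ennreal (m (min i j) * m (max i j)) * J (min i j) (max i j)"
    using lt by (subst sum.remove[of _ "(min i j, max i j)"]) (auto simp: add.commute)
  also have "\<dots> \<le> (\<Sum>(k, l)\<in>?P - {(min i j, max i j)}. ennreal (m k * m l) / ennreal (norm (x $ k - x $ l))) +
    ennreal (m i * m j) * min (1 / ennreal (norm (x $ i - x $ j))) (ennreal (1 / (c * h)))"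
  proof (rule add_mono)
    show "(\<Sum>(k, l)\<in>?P - {(min i j, max i j)}. ennreal (m k * m l) * J k l) \<le>
        (\<Sum>(k, l)\<in>?P - {(min i j, max i j)}. ennreal (m k * m l) / ennreal (norm (x $ k - x $ l)))"
    proof (rule sum_mono)
      fix p assume "p \<in> ?P - {(min i j, max i j)}"
      then obtain k l where p: "p = (k, l)" and "k < l" by auto
      then have "ennreal (m k * m l) * J k l \<le> ennreal (m k * m l) * (1 / ennreal (norm (x $ k - x $ l)))"
        by (intro mult_left_mono J_le) auto
      then show "(case p of (k, l) \<Rightarrow> ennreal (m k * m l) * J k l) \<le> (case p of (k, l) \<Rightarrow> ennreal (m k * m l) / ennreal (norm (x $ k - x $ l)))"
        by (simp add: ennreal_times_divide p)
    qed
    have "J (min i j) (max i j) = J i j" "m (min i j) * m (max i j) = m i * m j"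
      using J_sym[of i j] by (auto simp: min_def max_def mult.commute)
    then show "ennreal (m (min i j) * m (max i j)) * J (min i j) (max i j) \<le>
        ennreal (m i * m j) * min (1 / ennreal (norm (x $ i - x $ j))) (ennreal (1 / (c * h)))"
      using J_i[of j] ij by (auto intro!: mult_left_mono simp del: min_less_iff_conj)
  qed
  finally show ?thesis .
qed

text \<open>Outside the square one coordinate exceeds 1 in absolute value, so two tails, exchanged
  by the symmetry of the kernel, bound the missing mass. The second moment is bounded by those of
  the two coordinates in the same way.\<close>

lemma nn_integral_poisson_square:
  assumes h: "0 < h"
  shows "1 \<le> (\<integral>\<^sup>+\<xi>. ennreal (poisson h \<xi>) * indicator {\<xi>. \<bar>fst \<xi>\<bar> \<le> 1 \<and> \<bar>snd \<xi>\<bar> \<le> 1} \<xi> \<partial>lborel) + ennreal (4 * h / pi)"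
    and "(\<integral>\<^sup>+\<xi>. ennreal (poisson h \<xi>) * (ennreal ((fst \<xi>)\<^sup>2 + (snd \<xi>)\<^sup>2) * indicator {\<xi>. \<bar>fst \<xi>\<bar> \<le> 1 \<and> \<bar>snd \<xi>\<bar> \<le> 1} \<xi>) \<partial>lborel)
      \<le> ennreal (4 * h / pi)"
proof -
  have swap: "(\<integral>\<^sup>+\<xi>. f (snd \<xi>, fst \<xi>) \<partial>lborel) = (\<integral>\<^sup>+\<xi>. f \<xi> \<partial>lborel)"
    if [measurable]: "f \<in> borel_measurable borel" for f :: "real \<times> real \<Rightarrow> ennreal"
  proof -
    have m2: "(\<lambda>\<xi>. f (snd \<xi>, fst \<xi>)) \<in> borel_measurable borel" by measurable
    have "(\<lambda>p. f p) \<in> borel_measurable (lborel \<Otimes>\<^sub>M lborel)" by (simp add: lborel_prod)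
    then show ?thesis
      unfolding nn_integral_pair_lborel[OF m2] nn_integral_pair_lborel[OF that]
      using lborel_pair.Fubini'[of "\<lambda>b a. f (b, a)"] by simp
  qed
  have two: "ennreal (2 * h / pi) + ennreal (2 * h / pi) = ennreal (4 * h / pi)"
    using h by (subst ennreal_plus[symmetric]) auto
  let ?S = "{\<xi>::real \<times> real. \<bar>fst \<xi>\<bar> \<le> 1 \<and> \<bar>snd \<xi>\<bar> \<le> 1}"
  have [measurable]: "{\<xi>::real \<times> real. 1 < \<bar>fst \<xi>\<bar>} \<in> sets borel" "{\<xi>::real \<times> real. 1 < \<bar>snd \<xi>\<bar>} \<in> sets borel"
    by (intro borel_open open_Collect_less continuous_intros)+
  have [measurable]: "?S \<in> sets borel"
    by (intro borel_closed closed_Collect_conj closed_Collect_le continuous_intros)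
  have psw: "poisson h (snd \<xi>, fst \<xi>) = poisson h \<xi>" for \<xi> by (cases \<xi>) (simp add: poisson_swap)
  have tail_snd: "(\<integral>\<^sup>+\<xi>. ennreal (poisson h \<xi>) * indicator {\<xi>. 1 < \<bar>snd \<xi>\<bar>} \<xi> \<partial>lborel) \<le> ennreal (2 * h / pi)"
    using swap[of "\<lambda>\<xi>. ennreal (poisson h \<xi>) * indicator {\<xi>. 1 < \<bar>fst \<xi>\<bar>} \<xi>"] nn_integral_poisson_tail_fst[OF h]
    by (simp add: psw indicator_def)
  have moment_snd: "(\<integral>\<^sup>+\<xi>. ennreal (poisson h \<xi>) * (ennreal ((snd \<xi>)\<^sup>2) * indicator {\<xi>. \<bar>snd \<xi>\<bar> \<le> 1} \<xi>) \<partial>lborel) \<le> ennreal (2 * h / pi)"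
    using swap[of "\<lambda>\<xi>. ennreal (poisson h \<xi>) * (ennreal ((fst \<xi>)\<^sup>2) * indicator {\<xi>. \<bar>fst \<xi>\<bar> \<le> 1} \<xi>)"]
      nn_integral_poisson_second_moment_fst[OF h]
    by (simp add: psw indicator_def)
  have "1 = (\<integral>\<^sup>+\<xi>. ennreal (poisson h \<xi>) \<partial>lborel)" by (simp add: nn_integral_poisson[OF h])
  also have "\<dots> \<le> (\<integral>\<^sup>+\<xi>. ennreal (poisson h \<xi>) * indicator ?S \<xi> +
      (ennreal (poisson h \<xi>) * indicator {\<xi>. 1 < \<bar>fst \<xi>\<bar>} \<xi> + ennreal (poisson h \<xi>) * indicator {\<xi>. 1 < \<bar>snd \<xi>\<bar>} \<xi>) \<partial>lborel)"
    by (intro nn_integral_mono) (auto simp: indicator_def not_le add_increasing2)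
  also have "\<dots> = (\<integral>\<^sup>+\<xi>. ennreal (poisson h \<xi>) * indicator ?S \<xi> \<partial>lborel) +
      ((\<integral>\<^sup>+\<xi>. ennreal (poisson h \<xi>) * indicator {\<xi>. 1 < \<bar>fst \<xi>\<bar>} \<xi> \<partial>lborel) +
       (\<integral>\<^sup>+\<xi>. ennreal (poisson h \<xi>) * indicator {\<xi>. 1 < \<bar>snd \<xi>\<bar>} \<xi> \<partial>lborel))"
  proof -
    have "(\<lambda>\<xi>. ennreal (poisson h \<xi>) * indicator {\<xi>. 1 < \<bar>fst \<xi>\<bar>} \<xi>) \<in> borel_measurable lborel"
      "(\<lambda>\<xi>. ennreal (poisson h \<xi>) * indicator {\<xi>. 1 < \<bar>snd \<xi>\<bar>} \<xi>) \<in> borel_measurable lborel"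
      "(\<lambda>\<xi>. ennreal (poisson h \<xi>) * indicator ?S \<xi>) \<in> borel_measurable lborel"
      by (simp_all del: split_paired_All)
    then show ?thesis by (simp add: nn_integral_add)
  qed
  also have "\<dots> \<le> (\<integral>\<^sup>+\<xi>. ennreal (poisson h \<xi>) * indicator ?S \<xi> \<partial>lborel) + (ennreal (2 * h / pi) + ennreal (2 * h / pi))"
    by (intro add_mono nn_integral_poisson_tail_fst[OF h] tail_snd order_refl)
  finally show "1 \<le> (\<integral>\<^sup>+\<xi>. ennreal (poisson h \<xi>) * indicator ?S \<xi> \<partial>lborel) + ennreal (4 * h / pi)"
    by (simp only: two)
  have "(\<integral>\<^sup>+\<xi>. ennreal (poisson h \<xi>) * (ennreal ((fst \<xi>)\<^sup>2 + (snd \<xi>)\<^sup>2) * indicator ?S \<xi>) \<partial>lborel) \<le>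
     (\<integral>\<^sup>+\<xi>. ennreal (poisson h \<xi>) * (ennreal ((fst \<xi>)\<^sup>2) * indicator {\<xi>. \<bar>fst \<xi>\<bar> \<le> 1} \<xi>) +
      ennreal (poisson h \<xi>) * (ennreal ((snd \<xi>)\<^sup>2) * indicator {\<xi>. \<bar>snd \<xi>\<bar> \<le> 1} \<xi>) \<partial>lborel)"
    by (intro nn_integral_mono) (auto simp: indicator_def distrib_left)
  also have "\<dots> = (\<integral>\<^sup>+\<xi>. ennreal (poisson h \<xi>) * (ennreal ((fst \<xi>)\<^sup>2) * indicator {\<xi>. \<bar>fst \<xi>\<bar> \<le> 1} \<xi>) \<partial>lborel) +
      (\<integral>\<^sup>+\<xi>. ennreal (poisson h \<xi>) * (ennreal ((snd \<xi>)\<^sup>2) * indicator {\<xi>. \<bar>snd \<xi>\<bar> \<le> 1} \<xi>) \<partial>lborel)"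
    by (rule nn_integral_add) measurable
  also have "\<dots> \<le> ennreal (2 * h / pi) + ennreal (2 * h / pi)"
    by (intro add_mono nn_integral_poisson_second_moment_fst[OF h] moment_snd)
  finally show "(\<integral>\<^sup>+\<xi>. ennreal (poisson h \<xi>) * (ennreal ((fst \<xi>)\<^sup>2 + (snd \<xi>)\<^sup>2) * indicator ?S \<xi>) \<partial>lborel) \<le> ennreal (4 * h / pi)"
    by (simp only: two)
qed

text \<open>Gives the competitors for \<xi> and \<open>- \<xi>\<close> the same average.\<close>

lemma nn_integral_pair_minus:
  fixes f :: "real \<times> real \<Rightarrow> ennreal"
  assumes [measurable]: "f \<in> borel_measurable borel"
  shows "(\<integral>\<^sup>+\<xi>. f (- \<xi>) \<partial>lborel) = (\<integral>\<^sup>+\<xi>. f \<xi> \<partial>lborel)"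
proof -
  have refl: "(\<integral>\<^sup>+a. k (- a) \<partial>lborel) = (\<integral>\<^sup>+a. k a \<partial>lborel)" if [measurable]: "k \<in> borel_measurable borel"
    for k :: "real \<Rightarrow> ennreal"
    using nn_integral_real_affine[of k "-1" 0] by simp
  have m: "(\<lambda>\<xi>. f (- \<xi>)) \<in> borel_measurable borel" by measurable
  have [measurable]: "(\<lambda>a. \<integral>\<^sup>+b. f (a, b) \<partial>lborel) \<in> borel_measurable borel"
    using lborel.borel_measurable_nn_integral_fst[of f borel] by (simp add: borel_prod)
  have "(\<integral>\<^sup>+\<xi>. f (- \<xi>) \<partial>lborel) = (\<integral>\<^sup>+a. \<integral>\<^sup>+b. f (- a, - b) \<partial>lborel \<partial>lborel)"
    by (subst nn_integral_pair_lborel[OF m]) simp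
  also have "\<dots> = (\<integral>\<^sup>+a. \<integral>\<^sup>+b. f (- a, b) \<partial>lborel \<partial>lborel)"
    by (intro nn_integral_cong refl) measurable
  also have "\<dots> = (\<integral>\<^sup>+a. \<integral>\<^sup>+b. f (a, b) \<partial>lborel \<partial>lborel)"
    by (rule refl[of "\<lambda>a. \<integral>\<^sup>+b. f (a, b) \<partial>lborel"]) measurable
  also have "\<dots> = (\<integral>\<^sup>+\<xi>. f \<xi> \<partial>lborel)" by (rule nn_integral_pair_lborel[symmetric]) measurable
  finally show ?thesis .
qed

section \<open>Absence of collisions\<close>

text \<open>The arithmetic-geometric mean inequality with a free parameter. Optimizing the parameter
  later replaces the Cauchy-Schwarz inequality for integrals.\<close>

lemma norm_le_half_square:
  fixes x l :: real
  assumes "0 < l"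
  shows "x \<le> x\<^sup>2 / (2 * l) + l / 2"
proof -
  have "0 \<le> (x - l)\<^sup>2 / (2 * l)" using assms by simp
  also have "(x - l)\<^sup>2 / (2 * l) = x\<^sup>2 / (2 * l) + l / 2 - x"
    using assms by (simp add: power2_diff field_simps power2_eq_square)
  finally show ?thesis by simp
qed

text \<open>Continuity from above of the measure with density \<open>f\<close>, along intervals
  shrinking to \<open>t0\<close>.\<close>

lemma nn_integral_shrinking_interval:
  fixes f :: "real \<Rightarrow> ennreal"
  assumes [measurable]: "f \<in> borel_measurable borel" and fin: "(\<integral>\<^sup>+t. f t \<partial>lborel) < \<infinity>" and \<eta>: "0 < (\<eta>::real)"
    and d: "0 < d"
  obtains l :: real where "0 < l" "l < d" "(\<integral>\<^sup>+t\<in>{t0 - l..t0 + l}. f t \<partial>lborel) < ennreal \<eta>"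
proof -
  define \<nu> where "\<nu> = density lborel f"
  have em: "emeasure \<nu> A = (\<integral>\<^sup>+t\<in>A. f t \<partial>lborel)" if "A \<in> sets borel" for A
    unfolding \<nu>_def using that by (subst emeasure_density) auto
  \<comment> \<open>The shift by 2 keeps every radius strictly below \<open>d\<close>.\<close>
  let ?A = "\<lambda>n::nat. {t0 - d / real (n + 2)..t0 + d / real (n + 2)}"
  have "(\<lambda>n. emeasure \<nu> (?A n)) \<longlonglongrightarrow> emeasure \<nu> (\<Inter>n. ?A n)"
  proof (rule Lim_emeasure_decseq)
    show "range ?A \<subseteq> sets \<nu>" by (auto simp: \<nu>_def)
    show "decseq ?A"
      unfolding decseq_def
    proof (intro allI impI subsetI)
      fix k n :: nat and t assume "k \<le> n" and t: "t \<in> ?A n"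
      then have "d / real (n + 2) \<le> d / real (k + 2)" using d by (intro divide_left_mono) auto
      then show "t \<in> ?A k" using t by auto
    qed
    show "emeasure \<nu> (?A n) \<noteq> \<infinity>" for n
    proof -
      have "emeasure \<nu> (?A n) \<le> (\<integral>\<^sup>+t. f t \<partial>lborel)"
        unfolding em[OF atLeastAtMost_borel] by (intro nn_integral_mono) (auto split: split_indicator)
      then have "emeasure \<nu> (?A n) < \<infinity>" using fin by (rule le_less_trans)
      then show ?thesis by simp
    qed
  qed
  moreover have "(\<Inter>n. ?A n) = {t0}"
  proof (intro equalityI subsetI)
    fix t assume t: "t \<in> (\<Inter>n. ?A n)"
    show "t \<in> {t0}"
    proof (rule ccontr)
      assume "t \<notin> {t0}"
      then have pos: "0 < \<bar>t - t0\<bar>" by simp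
      obtain n :: nat where n: "d / \<bar>t - t0\<bar> < real n" using reals_Archimedean2 by blast
      have "d < real n * \<bar>t - t0\<bar>" using n pos by (simp add: field_simps)
      also have "\<dots> \<le> real (n + 2) * \<bar>t - t0\<bar>" by (intro mult_right_mono) auto
      finally have "d / real (n + 2) < \<bar>t - t0\<bar>" by (simp add: field_simps)
      moreover have "t \<in> ?A n" using t by blast
      ultimately show False by auto
    qed
  qed (use d in auto)
  moreover have "emeasure \<nu> {t0} = 0"
  proof -
    have "emeasure \<nu> {t0} = (\<integral>\<^sup>+t. 0 \<partial>(lborel :: real measure))"
      unfolding em[OF borel_singleton[OF sets.empty_sets]]
      by (rule nn_integral_cong_AE) (use AE_lborel_singleton[of t0] in \<open>eventually_elim, auto\<close>)
    then show ?thesis by simp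
  qed
  ultimately have "(\<lambda>n. emeasure \<nu> (?A n)) \<longlonglongrightarrow> 0" by simp
  then have "eventually (\<lambda>n. emeasure \<nu> (?A n) < ennreal \<eta>) sequentially"
    using \<eta> by (intro order_tendstoD(2)) auto
  then obtain n where "emeasure \<nu> (?A n) < ennreal \<eta>" by (auto simp: eventually_sequentially)
  moreover have "d * 1 < d * real (n + 2)" using d by (intro mult_strict_left_mono) auto
  then have "d / real (n + 2) < d" by (simp add: divide_less_eq)
  ultimately show thesis using d that[of "d / real (n + 2)"] em[OF atLeastAtMost_borel] by simp
qed

text \<open>Averaging the competitors \<open>\<gamma> + \<phi> \<xi>\<close> and \<open>\<gamma> - \<phi> \<xi>\<close> cancels the mixed term of the kinetic energy.\<close>

lemma minimizer_planar_shift_inequality: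
  fixes m :: "'n::{finite,linorder} \<Rightarrow> real" and \<gamma> g :: "real \<Rightarrow> ('a::euclidean_space, 'n) vec" and i :: 'n
  assumes m: "\<And>i. m i > 0" and ab: "a < b" and ac: "abs_continuous_on a b \<gamma>"
    and minim: "action m a b \<gamma> = action_potential m (\<gamma> a) (\<gamma> b)" and fin: "action m a b \<gamma> < \<infinity>"
    and g[measurable]: "g \<in> borel_measurable borel"
    and deriv: "AE t in lborel. a < t \<and> t < b \<longrightarrow> (\<gamma> has_vector_derivative g t) (at t)"
    and \<gamma>'[measurable]: "\<gamma>' \<in> borel_measurable borel" and \<gamma>'_eq: "\<And>t. t \<in> {a..b} \<Longrightarrow> \<gamma>' t = \<gamma> t"
    and e: "e1 \<in> Basis" "e2 \<in> Basis" "e1 \<noteq> e2"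
  defines "P \<equiv> \<lambda>\<xi>. \<integral>\<^sup>+t\<in>{a..b}. potential m (\<gamma>' t + ((t - a) * (b - t)) *\<^sub>R planar_shift i e1 e2 \<xi>) \<partial>lborel"
  shows "2 * (\<integral>\<^sup>+t\<in>{a..b}. potential m (\<gamma>' t) \<partial>lborel) \<le> ennreal (m i * (b - a) ^ 3) * ennreal ((fst \<xi>)\<^sup>2 + (snd \<xi>)\<^sup>2) + P \<xi> + P (- \<xi>)"
proof -
  define T where "T = (\<integral>\<^sup>+t\<in>{a..b}. ennreal (kinetic m (g t)) \<partial>lborel)"
  define U where "U = (\<integral>\<^sup>+t\<in>{a..b}. potential m (\<gamma>' t) \<partial>lborel)"
  define v where "v = planar_shift i e1 e2"
  define \<phi> where "\<phi> t = (t - a) * (b - t)" for t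
  have [measurable]: "\<phi> \<in> borel_measurable borel" unfolding \<phi>_def[abs_def] by measurable
  define d\<phi> where "d\<phi> t = a + b - 2 * t" for t
  have [measurable]: "d\<phi> \<in> borel_measurable borel" unfolding d\<phi>_def[abs_def] by measurable
  have P: "P \<xi> = (\<integral>\<^sup>+t\<in>{a..b}. potential m (\<gamma>' t + \<phi> t *\<^sub>R v \<xi>) \<partial>lborel)" for \<xi>
    by (simp add: P_def v_def \<phi>_def)
  have act: "action m a b \<gamma> = T + U"
    unfolding action_eq_nn_integral[OF deriv] T_def U_def
    by (subst nn_integral_add[symmetric]) (auto intro!: nn_integral_cong simp: distrib_right \<gamma>'_eq split: split_indicator)
  then have T_fin: "T < \<infinity>" using fin by (auto simp: less_top)
  have act_shift: "T + U \<le> (\<integral>\<^sup>+t\<in>{a..b}. ennreal (kinetic m (g t + d\<phi> t *\<^sub>R v \<xi>)) \<partial>lborel) + P \<xi>" for \<xi>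
  proof -
    let ?c = "\<lambda>t. \<gamma> t + \<phi> t *\<^sub>R v \<xi>"
    have lip: "abs_continuous_on a b (\<lambda>t. \<phi> t *\<^sub>R v \<xi>)"
    proof (rule abs_continuous_on_bounded_linear[OF _ bounded_linear_scaleR_left])
      show "abs_continuous_on a b \<phi>"
      proof (rule abs_continuous_on_lipschitz[where C="2 * (b - a)"])
        fix s t assume st: "a \<le> s" "s \<le> t" "t \<le> b"
        have "\<phi> t - \<phi> s = (a + b - s - t) * (t - s)" by (simp add: \<phi>_def algebra_simps)
        also have "norm \<dots> \<le> (2 * (b - a)) * (t - s)"
          unfolding norm_mult using st by (intro mult_mono) auto
        finally show "norm (\<phi> t - \<phi> s) \<le> 2 * (b - a) * (t - s)" .
      qed
    qed
    have ac_c: "abs_continuous_on a b ?c" by (rule abs_continuous_on_add[OF ac lip])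
    have d\<phi>: "(\<phi> has_real_derivative d\<phi> t) (at t)" for t
      unfolding \<phi>_def[abs_def] d\<phi>_def by (auto intro!: derivative_eq_intros)
    have dc: "AE t in lborel. a < t \<and> t < b \<longrightarrow> (?c has_vector_derivative (g t + d\<phi> t *\<^sub>R v \<xi>)) (at t)"
      using deriv
    proof eventually_elim
      case (elim t)
      have "((\<lambda>t. \<phi> t *\<^sub>R v \<xi>) has_vector_derivative d\<phi> t *\<^sub>R v \<xi>) (at t)"
        using has_vector_derivative_scaleR[OF d\<phi> has_vector_derivative_const[of "v \<xi>"]] by simp
      then show ?case using elim by (auto intro: has_vector_derivative_add)
    qed
    have "action m a b \<gamma> \<le> action m a b ?c"
      unfolding minim action_potential_def
      by (rule Inf_lower) (use ab ac_c in \<open>force simp: \<phi>_def\<close>)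
    also have "\<dots> = (\<integral>\<^sup>+t\<in>{a..b}. ennreal (kinetic m (g t + d\<phi> t *\<^sub>R v \<xi>)) \<partial>lborel) + P \<xi>"
      unfolding action_eq_nn_integral[OF dc] P
      by (subst nn_integral_add[symmetric]) (auto intro!: nn_integral_cong simp: distrib_right \<gamma>'_eq split: split_indicator)
    finally show ?thesis by (simp add: act)
  qed
  have kin: "(\<integral>\<^sup>+t\<in>{a..b}. ennreal (kinetic m (g t + d\<phi> t *\<^sub>R v \<xi>)) \<partial>lborel) +
      (\<integral>\<^sup>+t\<in>{a..b}. ennreal (kinetic m (g t + d\<phi> t *\<^sub>R v (- \<xi>))) \<partial>lborel) \<le>
      2 * T + ennreal (m i * (b - a) ^ 3) * ennreal ((fst \<xi>)\<^sup>2 + (snd \<xi>)\<^sup>2)"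
  proof -
    let ?q = "(fst \<xi>)\<^sup>2 + (snd \<xi>)\<^sup>2"
    have vm: "v (- \<xi>) = - v \<xi>" by (simp add: v_def planar_shift_minus)
    have "(\<integral>\<^sup>+t\<in>{a..b}. ennreal (kinetic m (g t + d\<phi> t *\<^sub>R v \<xi>)) \<partial>lborel) +
      (\<integral>\<^sup>+t\<in>{a..b}. ennreal (kinetic m (g t + d\<phi> t *\<^sub>R v (- \<xi>))) \<partial>lborel) =
      (\<integral>\<^sup>+t. ennreal (kinetic m (g t + d\<phi> t *\<^sub>R v \<xi>)) * indicator {a..b} t + ennreal (kinetic m (g t + d\<phi> t *\<^sub>R v (- \<xi>))) * indicator {a..b} t \<partial>lborel)"
      by (rule nn_integral_add[symmetric]) measurable
    also have "\<dots> \<le> (\<integral>\<^sup>+t. 2 * (ennreal (kinetic m (g t)) * indicator {a..b} t) + ennreal (m i * (b - a)\<^sup>2 * ?q) * indicator {a..b} t \<partial>lborel)"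
    proof (rule nn_integral_mono)
      fix t :: real
      show "ennreal (kinetic m (g t + d\<phi> t *\<^sub>R v \<xi>)) * indicator {a..b} t + ennreal (kinetic m (g t + d\<phi> t *\<^sub>R v (- \<xi>))) * indicator {a..b} t \<le>
        2 * (ennreal (kinetic m (g t)) * indicator {a..b} t) + ennreal (m i * (b - a)\<^sup>2 * ?q) * indicator {a..b} t"
      proof (cases "t \<in> {a..b}")
        case True
        \<comment> \<open>The slope of \<phi> is at most \<open>b - a\<close>, so the two
          competitors together pay at most \<open>m i * (b - a)^3\<close> times the squared length
          of \<xi>.\<close>
        have "\<bar>d\<phi> t\<bar> \<le> \<bar>b - a\<bar>" using True by (auto simp: d\<phi>_def)
        then have d2: "(d\<phi> t)\<^sup>2 \<le> (b - a)\<^sup>2" by (simp add: abs_le_square_iff)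
        have "kinetic m (g t + d\<phi> t *\<^sub>R v \<xi>) + kinetic m (g t + d\<phi> t *\<^sub>R v (- \<xi>)) = 2 * kinetic m (g t) + 2 * kinetic m (d\<phi> t *\<^sub>R v \<xi>)"
          using kinetic_parallelogram[of m "g t" "d\<phi> t *\<^sub>R v \<xi>"] by (simp add: vm)
        also have "2 * kinetic m (d\<phi> t *\<^sub>R v \<xi>) = m i * (d\<phi> t)\<^sup>2 * ?q"
          by (simp add: kinetic_scaleR v_def kinetic_planar_shift[OF e])
        also have "\<dots> \<le> m i * (b - a)\<^sup>2 * ?q"
          using d2 m[of i] by (intro mult_right_mono mult_left_mono) auto
        finally have *: "kinetic m (g t + d\<phi> t *\<^sub>R v \<xi>) + kinetic m (g t + d\<phi> t *\<^sub>R v (- \<xi>)) \<le> 2 * kinetic m (g t) + m i * (b - a)\<^sup>2 * ?q"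
          by simp
        have "ennreal (kinetic m (g t + d\<phi> t *\<^sub>R v \<xi>)) + ennreal (kinetic m (g t + d\<phi> t *\<^sub>R v (- \<xi>))) \<le>
            ennreal (2 * kinetic m (g t) + m i * (b - a)\<^sup>2 * ?q)"
          using * by (subst ennreal_plus[symmetric]) (auto intro!: kinetic_nonneg m ennreal_leI)
        also have "\<dots> = 2 * ennreal (kinetic m (g t)) + ennreal (m i * (b - a)\<^sup>2 * ?q)"
          using m[of i] kinetic_nonneg[of m "g t", OF m] by (subst ennreal_plus) (auto simp: ennreal_mult less_imp_le)
        finally show ?thesis using True by simp
      qed simp
    qed
    also have "\<dots> = 2 * T + ennreal (m i * (b - a)\<^sup>2 * ?q) * emeasure lborel {a..b}"
      unfolding T_def by (subst nn_integral_add) (auto simp: nn_integral_cmult nn_integral_cmult_indicator)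
    also have "ennreal (m i * (b - a)\<^sup>2 * ?q) * emeasure lborel {a..b} = ennreal (m i * (b - a) ^ 3) * ennreal ?q"
    proof -
      have "ennreal (m i * (b - a)\<^sup>2 * ?q) * emeasure lborel {a..b} = ennreal (m i * (b - a)\<^sup>2 * ?q) * ennreal (b - a)"
        using ab by simp
      also have "\<dots> = ennreal ((m i * (b - a)\<^sup>2 * ?q) * (b - a))"
        using ab m[of i] by (intro ennreal_mult[symmetric]) auto
      also have "(m i * (b - a)\<^sup>2 * ?q) * (b - a) = (m i * (b - a) ^ 3) * ?q"
        by (simp add: power2_eq_square power3_eq_cube)
      also have "ennreal ((m i * (b - a) ^ 3) * ?q) = ennreal (m i * (b - a) ^ 3) * ennreal ?q"
        using ab m[of i] by (intro ennreal_mult) auto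
      finally show ?thesis .
    qed
    finally show ?thesis .
  qed
  have "2 * T + 2 * U = (T + U) + (T + U)" by (simp add: mult_2 add_ac)
  also have "\<dots> \<le> ((\<integral>\<^sup>+t\<in>{a..b}. ennreal (kinetic m (g t + d\<phi> t *\<^sub>R v \<xi>)) \<partial>lborel) + P \<xi>) +
      ((\<integral>\<^sup>+t\<in>{a..b}. ennreal (kinetic m (g t + d\<phi> t *\<^sub>R v (- \<xi>))) \<partial>lborel) + P (- \<xi>))"
    by (intro add_mono act_shift)
  also have "\<dots> = ((\<integral>\<^sup>+t\<in>{a..b}. ennreal (kinetic m (g t + d\<phi> t *\<^sub>R v \<xi>)) \<partial>lborel) +
      (\<integral>\<^sup>+t\<in>{a..b}. ennreal (kinetic m (g t + d\<phi> t *\<^sub>R v (- \<xi>))) \<partial>lborel)) + (P \<xi> + P (- \<xi>))"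
    by (simp add: add_ac)
  also have "\<dots> \<le> (2 * T + ennreal (m i * (b - a) ^ 3) * ennreal ((fst \<xi>)\<^sup>2 + (snd \<xi>)\<^sup>2)) + (P \<xi> + P (- \<xi>))"
    by (intro add_right_mono kin)
  finally have "2 * T + 2 * U \<le> 2 * T + (ennreal (m i * (b - a) ^ 3) * ennreal ((fst \<xi>)\<^sup>2 + (snd \<xi>)\<^sup>2) + P \<xi> + P (- \<xi>))"
    by (simp add: add_ac)
  \<comment> \<open>Cancellation in \<open>ennreal\<close> requires the kinetic part to be
    finite.\<close>
  then have "2 * U \<le> ennreal (m i * (b - a) ^ 3) * ennreal ((fst \<xi>)\<^sup>2 + (snd \<xi>)\<^sup>2) + P \<xi> + P (- \<xi>)"
    using T_fin by (subst (asm) ennreal_add_left_cancel_le) (auto simp: ennreal_mult_eq_top_iff less_top)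
  then show ?thesis by (simp add: U_def)
qed

lemma FTC_increment:
  fixes f g :: "real \<Rightarrow> 'e::euclidean_space"
  assumes g: "integrable lborel g" and f: "\<And>t. t \<in> {a..b} \<Longrightarrow> f t = f a + (LINT x:{a..t}|lborel. g x)"
    and uv: "a \<le> u" "u \<le> v" "v \<le> b"
  shows "f v - f u = (LINT x:{u..v}|lborel. g x)"
  using f[of u] f[of v] set_integral_Icc_split[OF g uv(1,2)] uv by simp

lemma norm_diff_components_le_kinetic:
  assumes m: "\<And>i. m i > 0"
  shows "(norm (v $ i - v $ j))\<^sup>2 \<le> (4 / m i + 4 / m j) * kinetic m v"
proof -
  have le: "(norm (v $ k))\<^sup>2 \<le> 2 / m k * kinetic m v" for k
  proof -
    have "m k * (norm (v $ k))\<^sup>2 \<le> (\<Sum>i\<in>UNIV. m i * (norm (v $ i))\<^sup>2)"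
      using m by (intro member_le_sum) (auto simp: less_imp_le)
    then show ?thesis using m[of k] by (simp add: kinetic_def field_simps)
  qed
  have "norm (v $ i - v $ j) \<le> norm (v $ i) + norm (v $ j)" by (rule norm_triangle_ineq4)
  then have "(norm (v $ i - v $ j))\<^sup>2 \<le> (norm (v $ i) + norm (v $ j))\<^sup>2" by (intro power_mono) auto
  also have "\<dots> \<le> 2 * (norm (v $ i))\<^sup>2 + 2 * (norm (v $ j))\<^sup>2"
    using sum_squares_bound[of "norm (v $ i)" "norm (v $ j)"] by (simp add: power2_sum)
  also have "\<dots> \<le> 2 * (2 / m i * kinetic m v) + 2 * (2 / m j * kinetic m v)"
    by (intro add_mono mult_left_mono le) auto
  finally show ?thesis by (simp add: algebra_simps)
qed

lemma potential_remove_pair: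
  assumes "i \<noteq> j"
  shows "potential m x = (\<Sum>(k, l)\<in>{(k, l). k < l} - {(min i j, max i j)}. ennreal (m k * m l) / ennreal (norm (x $ k - x $ l))) +
    ennreal (m i * m j) * (1 / ennreal (norm (x $ i - x $ j)))"
proof -
  have lt: "min i j < max i j" using assms by (auto simp: min_def max_def)
  have "ennreal (m (min i j) * m (max i j)) / ennreal (norm (x $ min i j - x $ max i j)) =
      ennreal (m i * m j) / ennreal (norm (x $ i - x $ j))"
    by (auto simp: min_def max_def mult.commute norm_minus_commute)
  then show ?thesis
    unfolding potential_def using lt
    by (subst sum.remove[of _ "(min i j, max i j)"]) (auto simp: add.commute ennreal_times_divide)
qed

text \<open>A curve is known to be continuous on \<open>{a..b}\<close> only; clamping the argument
  gives a Borel function on the line that agrees with it there.\<close>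

lemma clamped_measurable:
  fixes f :: "real \<Rightarrow> 'e::real_normed_vector"
  assumes "continuous_on {a..b} f" "a \<le> b"
  shows "(\<lambda>t. f (max a (min b t))) \<in> borel_measurable borel"
proof (rule borel_measurable_continuous_onI)
  show "continuous_on UNIV (\<lambda>t. f (max a (min b t)))"
    by (rule continuous_on_compose2[OF assms(1)]) (use assms(2) in \<open>auto intro!: continuous_intros\<close>)
qed

text \<open>Here \<open>U\<close> is the potential part of the action and \<open>M\<close> bounds
  its average over the perturbed curves. The collision bounds \<open>U - M\<close> from below,
  minimality bounds it from above, and the two bounds are incompatible.\<close>

theorem minimizer_no_collision:
  fixes m :: "'n::{finite,linorder} \<Rightarrow> real" and \<gamma> :: "real \<Rightarrow> ('a::euclidean_space, 'n) vec" and i j :: 'n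
  assumes dim: "DIM('a) \<ge> 2" and m: "\<And>i. m i > 0" and ac: "abs_continuous_on a b \<gamma>"
    and minim: "action m a b \<gamma> = action_potential m (\<gamma> a) (\<gamma> b)" and t0: "a < t0" "t0 < b" and ij: "i \<noteq> j"
  shows "\<gamma> t0 $ i \<noteq> \<gamma> t0 $ j"
proof
  assume coll: "\<gamma> t0 $ i = \<gamma> t0 $ j"
  have ab: "a < b" using t0 by simp
  have fin: "action m a b \<gamma> < \<infinity>" unfolding minim by (rule action_potential_finite[OF dim m])
  obtain e1 e2 :: 'a where e: "e1 \<in> Basis" "e2 \<in> Basis" "e1 \<noteq> e2" using two_basis_vectors[OF dim] by blast
  obtain g where g: "integrable lborel g" "\<And>t. t \<in> {a..b} \<Longrightarrow> \<gamma> t = \<gamma> a + (LINT x:{a..t}|lborel. g x)"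
    and deriv: "AE t in lborel. a < t \<and> t < b \<longrightarrow> (\<gamma> has_vector_derivative g t) (at t)"
    using abs_continuous_on_FTC[OF ac ab] by blast
  have gm[measurable]: "g \<in> borel_measurable borel" using g(1) by simp
  define \<gamma>' where "\<gamma>' t = \<gamma> (max a (min b t))" for t
  have \<gamma>'m[measurable]: "\<gamma>' \<in> borel_measurable borel"
    unfolding \<gamma>'_def[abs_def] using abs_continuous_on_imp_continuous_on[OF ac] ab by (intro clamped_measurable) auto
  have \<gamma>'_eq: "\<gamma>' t = \<gamma> t" if "t \<in> {a..b}" for t using that by (simp add: \<gamma>'_def)
  define T where "T = (\<integral>\<^sup>+t\<in>{a..b}. ennreal (kinetic m (g t)) \<partial>lborel)"
  define U where "U = (\<integral>\<^sup>+t\<in>{a..b}. potential m (\<gamma>' t) \<partial>lborel)"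
  have "action m a b \<gamma> = T + U"
    unfolding action_eq_nn_integral[OF deriv] T_def U_def
    by (subst nn_integral_add[symmetric]) (auto intro!: nn_integral_cong simp: distrib_right \<gamma>'_eq split: split_indicator)
  then have T_fin: "T < \<infinity>" and U_fin: "U < \<infinity>" using fin by (auto simp: less_top)
  obtain u where u: "0 \<le> u" "U = ennreal u" using U_fin by (cases U) auto
  define c where "c = m i * m j"
  have c: "0 < c" using m by (simp add: c_def)
  define C1 where "C1 = m i * (b - a) ^ 3"
  have C1: "0 < C1" using m ab by (simp add: C1_def)
  define W where "W t = (\<Sum>(k, l)\<in>{(k, l). k < l} - {(min i j, max i j)}. ennreal (m k * m l) / ennreal (norm (\<gamma>' t $ k - \<gamma>' t $ l)))" for t
  define x where "x t = \<gamma>' t $ i - \<gamma>' t $ j" for t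
  have [measurable]: "W \<in> borel_measurable borel" "x \<in> borel_measurable borel"
    unfolding W_def[abs_def] x_def[abs_def] case_prod_unfold by measurable
  have pot: "potential m (\<gamma>' t) = W t + ennreal c * (1 / ennreal (norm (x t)))" for t
    unfolding W_def x_def c_def by (rule potential_remove_pair[OF ij])
  define \<phi> where "\<phi> t = (t - a) * (b - t)" for t
  have [measurable]: "\<phi> \<in> borel_measurable borel" unfolding \<phi>_def[abs_def] by measurable
  \<comment> \<open>Half the distance to the nearer end point, so that
    \<open>\<phi> t \<ge> d^2\<close> throughout the window around \<open>t0\<close>.\<close>
  define d where "d = min (t0 - a) (b - t0) / 2"
  have d: "0 < d" using t0 by (simp add: d_def)
  have near: "a < t \<and> t < b \<and> d\<^sup>2 \<le> \<phi> t" if "t \<in> {t0 - d..t0 + d}" for t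
  proof -
    have 2: "2 * d \<le> t0 - a" "2 * d \<le> b - t0" by (auto simp: d_def)
    then have "d \<le> t - a" "d \<le> b - t" using that by auto
    then show ?thesis using d unfolding \<phi>_def power2_eq_square by (auto intro!: mult_mono)
  qed
  \<comment> \<open>Tuned to the final comparison
    \<open>c * pi \<le> 4 * (C1 + 2 * u) * \<eta> / d^2\<close>, which this value violates by more
    than a factor 2.\<close>
  define \<eta> where "\<eta> = c * pi * d\<^sup>2 / (8 * (C1 + 2 * u + 1))"
  have \<eta>: "0 < \<eta>" using c d C1 u by (simp add: \<eta>_def)
  \<comment> \<open>A multiple of the kinetic energy that dominates the squared relative speed of
    \<open>i\<close> and \<open>j\<close>.\<close>
  define q where "q t = ennreal ((4 / m i + 4 / m j) * kinetic m (g t)) * indicator {a..b} t" for t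
  have [measurable]: "q \<in> borel_measurable borel" unfolding q_def[abs_def] by measurable
  have mm: "0 \<le> 4 / m i + 4 / m j" using m[of i] m[of j] by simp
  have "(\<integral>\<^sup>+t. q t \<partial>lborel) = ennreal (4 / m i + 4 / m j) * T"
    unfolding T_def q_def using mm
    by (subst nn_integral_cmult[symmetric]) (auto intro!: nn_integral_cong simp: ennreal_mult' mult_ac kinetic_nonneg m)
  then have q_fin: "(\<integral>\<^sup>+t. q t \<partial>lborel) < \<infinity>" using T_fin by (simp add: ennreal_mult_less_top)
  obtain l where l: "0 < l" "l < d" "(\<integral>\<^sup>+t\<in>{t0 - l..t0 + l}. q t \<partial>lborel) < ennreal \<eta>"
    using nn_integral_shrinking_interval[OF \<open>q \<in> borel_measurable borel\<close> q_fin \<eta> d] by blast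
  \<comment> \<open>The parameter at which \<open>\<eta> / (2 * \<kappa>) + \<kappa> / 2 * l\<close>
    is smallest; the minimum is the Cauchy-Schwarz bound \<open>sqrt (l * \<eta>)\<close>.\<close>
  define \<kappa> where "\<kappa> = sqrt (\<eta> / l)"
  have \<kappa>: "0 < \<kappa>" "\<eta> / (2 * \<kappa>) + \<kappa> / 2 * l = sqrt (l * \<eta>)"
  proof -
    show "0 < \<kappa>" using \<eta> l by (simp add: \<kappa>_def)
    have "\<kappa> * l = sqrt (l * \<eta>)" "\<eta> / \<kappa> = sqrt (l * \<eta>)"
      using \<eta> l unfolding \<kappa>_def
      by (auto simp: real_sqrt_divide real_sqrt_mult field_simps)
    then show "\<eta> / (2 * \<kappa>) + \<kappa> / 2 * l = sqrt (l * \<eta>)" by simp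
  qed
  have increment: "norm ((\<gamma> v $ i - \<gamma> v $ j) - (\<gamma> w $ i - \<gamma> w $ j)) \<le> sqrt (l * \<eta>)"
    if wv: "t0 - l \<le> w" "w \<le> v" "v \<le> t0 + l" "v - w \<le> l" for v w
  proof -
    have in_ab: "a \<le> w" "v \<le> b" "{w..v} \<subseteq> {a..b}" using wv near[of w] near[of v] l by auto
    interpret L: bounded_linear "\<lambda>z :: ('a, 'n) vec. z $ i - z $ j"
      by (intro bounded_linear_sub bounded_linear_vec_nth)
    have si: "integrable lborel (\<lambda>t. indicator {w..v} t *\<^sub>R g t)"
      using set_integrable_subset[of lborel UNIV g "{w..v}"] g(1) by (simp add: set_integrable_def)
    have "\<gamma> v - \<gamma> w = (LINT t:{w..v}|lborel. g t)"
      using FTC_increment[OF g] in_ab wv by blast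
    then have "(\<gamma> v $ i - \<gamma> v $ j) - (\<gamma> w $ i - \<gamma> w $ j) = (LINT t|lborel. (indicator {w..v} t *\<^sub>R g t) $ i - (indicator {w..v} t *\<^sub>R g t) $ j)"
      using integral_bounded_linear[OF L.bounded_linear_axioms si] L.diff[of "\<gamma> v" "\<gamma> w"]
      by (simp add: set_lebesgue_integral_def)
    then have "ennreal (norm ((\<gamma> v $ i - \<gamma> v $ j) - (\<gamma> w $ i - \<gamma> w $ j))) \<le>
        (\<integral>\<^sup>+t. ennreal (norm ((indicator {w..v} t *\<^sub>R g t) $ i - (indicator {w..v} t *\<^sub>R g t) $ j)) \<partial>lborel)"
      using integral_norm_bound_ennreal[OF integrable_bounded_linear[OF L.bounded_linear_axioms si]] by simp
    also have "\<dots> \<le> (\<integral>\<^sup>+t. ennreal (1 / (2 * \<kappa>)) * (q t * indicator {t0 - l..t0 + l} t) + ennreal (\<kappa> / 2) * indicator {w..v} t \<partial>lborel)"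
    proof (rule nn_integral_mono)
      fix t :: real
      show "ennreal (norm ((indicator {w..v} t *\<^sub>R g t) $ i - (indicator {w..v} t *\<^sub>R g t) $ j)) \<le>
          ennreal (1 / (2 * \<kappa>)) * (q t * indicator {t0 - l..t0 + l} t) + ennreal (\<kappa> / 2) * indicator {w..v} t"
      proof (cases "t \<in> {w..v}")
        case True
        have "norm (g t $ i - g t $ j) \<le> (norm (g t $ i - g t $ j))\<^sup>2 / (2 * \<kappa>) + \<kappa> / 2"
          by (rule norm_le_half_square[OF \<kappa>(1)])
        also have "\<dots> \<le> ((4 / m i + 4 / m j) * kinetic m (g t)) / (2 * \<kappa>) + \<kappa> / 2"
          using \<kappa>(1) norm_diff_components_le_kinetic[of m "g t" i j, OF m] by (intro add_right_mono divide_right_mono) auto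
        finally have "ennreal (norm (g t $ i - g t $ j)) \<le> ennreal (1 / (2 * \<kappa>) * ((4 / m i + 4 / m j) * kinetic m (g t)) + \<kappa> / 2)"
          by (intro ennreal_leI) simp
        also have "\<dots> = ennreal (1 / (2 * \<kappa>)) * ennreal ((4 / m i + 4 / m j) * kinetic m (g t)) + ennreal (\<kappa> / 2)"
        proof -
          have Z: "0 \<le> (4 / m i + 4 / m j) * kinetic m (g t)" using mm kinetic_nonneg[of m "g t", OF m] by (rule mult_nonneg_nonneg)
          have A: "0 \<le> 1 / (2 * \<kappa>)" using \<kappa>(1) by simp
          have B: "0 \<le> \<kappa> / 2" using \<kappa>(1) by simp
          show ?thesis by (simp only: ennreal_plus[OF mult_nonneg_nonneg[OF A Z] B] ennreal_mult[OF A Z])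
        qed
        finally show ?thesis using True wv in_ab by (auto simp: q_def subset_iff)
      qed simp
    qed
    also have "\<dots> = ennreal (1 / (2 * \<kappa>)) * (\<integral>\<^sup>+t\<in>{t0 - l..t0 + l}. q t \<partial>lborel) + ennreal (\<kappa> / 2) * ennreal (v - w)"
      using wv by (subst nn_integral_add) (auto simp: nn_integral_cmult nn_integral_cmult_indicator)
    also have "\<dots> \<le> ennreal (1 / (2 * \<kappa>)) * ennreal \<eta> + ennreal (\<kappa> / 2) * ennreal l"
      using l(3) wv(4) by (intro add_mono mult_left_mono ennreal_leI) (auto simp: less_imp_le)
    also have "\<dots> = ennreal (\<eta> / (2 * \<kappa>) + \<kappa> / 2 * l)"
      using \<kappa>(1) \<eta> l(1) by (simp add: ennreal_mult'[symmetric] ennreal_plus[symmetric] del: ennreal_plus)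
    finally have "ennreal (norm ((\<gamma> v $ i - \<gamma> v $ j) - (\<gamma> w $ i - \<gamma> w $ j))) \<le> ennreal (sqrt (l * \<eta>))" by (simp only: \<kappa>(2))
    then show ?thesis using \<eta> l(1) by (simp add: ennreal_le_iff)
  qed
  have x_small: "norm (x t) \<le> sqrt (l * \<eta>)" if t: "t \<in> {t0 - l..t0 + l}" for t
  proof -
    have "x t = \<gamma> t $ i - \<gamma> t $ j" using near[of t] t l by (auto simp: x_def \<gamma>'_eq)
    then show ?thesis
      using increment[of t0 t] increment[of t t0] t l coll by (cases "t0 \<le> t") (auto simp: norm_minus_commute)
  qed
  \<comment> \<open>With this \<open>h\<close> the bound \<open>1 / (d^2 * h)\<close> is half of
    \<open>1 / sqrt (l * \<eta>)\<close>, hence at most half of \<open>1 / norm (x t)\<close> in the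
    window.\<close>
  define h where "h = 2 * sqrt (l * \<eta>) / d\<^sup>2"
  have h: "0 < h" using l \<eta> d by (simp add: h_def)
  define V where "V t = W t + ennreal c * min (1 / ennreal (norm (x t))) (ennreal (1 / (\<phi> t * h)))" for t
  have [measurable]: "V \<in> borel_measurable borel" unfolding V_def[abs_def] by measurable
  define M where "M = (\<integral>\<^sup>+t\<in>{a..b}. V t \<partial>lborel)"
  \<comment> \<open>In the window averaging removes at least half the potential of the colliding
    pair, in any case no less than \<open>c / (d^2 * h)\<close>, for a time
    \<open>2 * l\<close>.\<close>
  have gain: "M + ennreal (c / (d\<^sup>2 * h)) * ennreal (2 * l) \<le> U"
  proof -
    have "M + ennreal (c / (d\<^sup>2 * h)) * ennreal (2 * l) =
        (\<integral>\<^sup>+t. V t * indicator {a..b} t + ennreal (c / (d\<^sup>2 * h)) * indicator {t0 - l..t0 + l} t \<partial>lborel)"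
      unfolding M_def using l by (subst nn_integral_add) (auto simp: nn_integral_cmult_indicator)
    also have "\<dots> \<le> U"
      unfolding U_def
    proof (rule nn_integral_mono)
      fix t :: real
      show "V t * indicator {a..b} t + ennreal (c / (d\<^sup>2 * h)) * indicator {t0 - l..t0 + l} t \<le> potential m (\<gamma>' t) * indicator {a..b} t"
      proof (cases "t \<in> {t0 - l..t0 + l}")
        case True
        then have t: "a < t" "t < b" "d\<^sup>2 \<le> \<phi> t" using near[of t] l by auto
        have "0 < \<phi> t" using t(3) zero_less_power[OF d, of 2] by linarith
        then have "ennreal (1 / (\<phi> t * h)) + ennreal (1 / (d\<^sup>2 * h)) \<le> ennreal (1 / (d\<^sup>2 * h)) + ennreal (1 / (d\<^sup>2 * h))"
          using t d h by (intro add_right_mono ennreal_leI divide_left_mono mult_right_mono mult_pos_pos) auto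
        also have "\<dots> = ennreal (2 / (d\<^sup>2 * h))"
          using h by (subst ennreal_plus[symmetric]) auto
        also have "2 / (d\<^sup>2 * h) = 1 / sqrt (l * \<eta>)" using d by (simp add: h_def)
        also have "ennreal (1 / sqrt (l * \<eta>)) = 1 / ennreal (sqrt (l * \<eta>))"
          using l \<eta> divide_ennreal[of 1 "sqrt (l * \<eta>)"] by simp
        also have "\<dots> \<le> 1 / ennreal (norm (x t))"
          by (rule one_over_ennreal_antimono[OF x_small[OF True]])
        finally have "min (1 / ennreal (norm (x t))) (ennreal (1 / (\<phi> t * h))) + ennreal (1 / (d\<^sup>2 * h)) \<le> 1 / ennreal (norm (x t))"
          by (rule order_trans[rotated]) (intro add_right_mono min.cobounded2)
        then have "ennreal c * (min (1 / ennreal (norm (x t))) (ennreal (1 / (\<phi> t * h))) + ennreal (1 / (d\<^sup>2 * h))) \<le> ennreal c * (1 / ennreal (norm (x t)))"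
          by (rule mult_left_mono) simp
        moreover have "ennreal c * ennreal (1 / (d\<^sup>2 * h)) = ennreal (c / (d\<^sup>2 * h))"
          using c by (simp add: ennreal_mult'[symmetric])
        ultimately have "V t + ennreal (c / (d\<^sup>2 * h)) \<le> potential m (\<gamma>' t)"
          unfolding pot V_def by (simp add: distrib_left add.assoc add_left_mono)
        then show ?thesis using True t by simp
      next
        case False
        have "V t \<le> potential m (\<gamma>' t)"
          unfolding pot V_def by (intro add_left_mono mult_left_mono) auto
        then show ?thesis using False by (auto split: split_indicator)
      qed
    qed
    finally show ?thesis .
  qed
  let ?S = "{\<xi>::real \<times> real. \<bar>fst \<xi>\<bar> \<le> 1 \<and> \<bar>snd \<xi>\<bar> \<le> 1}"
  have S[measurable]: "?S \<in> sets borel"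
    by (intro borel_closed closed_Collect_conj closed_Collect_le continuous_intros)
  define P where "P \<xi> = (\<integral>\<^sup>+t\<in>{a..b}. potential m (\<gamma>' t + ((t - a) * (b - t)) *\<^sub>R planar_shift i e1 e2 \<xi>) \<partial>lborel)" for \<xi>
  have Pm[measurable]: "P \<in> borel_measurable borel"
    unfolding P_def[abs_def] by measurable
  \<comment> \<open>Fubini reduces the average over \<xi> to an estimate at each time; the end
    points, where \<phi> vanishes, form a null set.\<close>
  have avg: "(\<integral>\<^sup>+\<xi>. ennreal (poisson h \<xi>) * P \<xi> \<partial>lborel) \<le> M"
  proof -
    have "(\<integral>\<^sup>+\<xi>. ennreal (poisson h \<xi>) * P \<xi> \<partial>lborel) =
        (\<integral>\<^sup>+\<xi>. \<integral>\<^sup>+t. ennreal (poisson h \<xi>) * (potential m (\<gamma>' t + \<phi> t *\<^sub>R planar_shift i e1 e2 \<xi>) * indicator {a..b} t) \<partial>lborel \<partial>lborel)"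
      unfolding P_def \<phi>_def[symmetric] by (intro nn_integral_cong nn_integral_cmult[symmetric]) measurable
    also have "\<dots> = (\<integral>\<^sup>+t. \<integral>\<^sup>+\<xi>. ennreal (poisson h \<xi>) * (potential m (\<gamma>' t + \<phi> t *\<^sub>R planar_shift i e1 e2 \<xi>) * indicator {a..b} t) \<partial>lborel \<partial>lborel)"
      by (rule lborel_pair.Fubini') measurable
    also have "\<dots> \<le> M"
      unfolding M_def
    proof (rule nn_integral_mono_AE)
      show "AE t in lborel. (\<integral>\<^sup>+\<xi>. ennreal (poisson h \<xi>) * (potential m (\<gamma>' t + \<phi> t *\<^sub>R planar_shift i e1 e2 \<xi>) * indicator {a..b} t) \<partial>lborel) \<le> V t * indicator {a..b} t"
        using AE_lborel_singleton[of a] AE_lborel_singleton[of b]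
      proof eventually_elim
        case (elim t)
        show ?case
        proof (cases "t \<in> {a..b}")
          case True
          then have "0 < \<phi> t" using elim by (auto simp: \<phi>_def)
          from nn_integral_poisson_potential[of m h "\<phi> t" e1 e2 i j "\<gamma>' t", OF m h this e ij] True show ?thesis
            by (simp add: V_def W_def x_def c_def)
        qed simp
      qed
    qed
    finally show ?thesis .
  qed
  define k where "k = 4 * h / pi"
  have k: "0 \<le> k" using h by (simp add: k_def)
  define p where "p = (\<integral>\<^sup>+\<xi>. ennreal (poisson h \<xi>) * indicator ?S \<xi> \<partial>lborel)"
  \<comment> \<open>The inequality is integrated over the square only, where the kinetic cost is
    controlled; the potential terms are then extended to the plane, which can only increase
    them.\<close>
  have "2 * U * p = (\<integral>\<^sup>+\<xi>. (ennreal (poisson h \<xi>) * indicator ?S \<xi>) * (2 * U) \<partial>lborel)"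
    unfolding p_def by (subst nn_integral_multc) (auto simp: mult.commute)
  also have "\<dots> \<le> (\<integral>\<^sup>+\<xi>. ennreal C1 * (ennreal (poisson h \<xi>) * (ennreal ((fst \<xi>)\<^sup>2 + (snd \<xi>)\<^sup>2) * indicator ?S \<xi>)) +
      (ennreal (poisson h \<xi>) * P \<xi> + ennreal (poisson h (- \<xi>)) * P (- \<xi>)) \<partial>lborel)"
  proof (rule nn_integral_mono)
    fix \<xi> :: "real \<times> real"
    have ph: "poisson h (- \<xi>) = poisson h \<xi>" by (simp add: poisson_def)
    have "2 * U \<le> ennreal C1 * ennreal ((fst \<xi>)\<^sup>2 + (snd \<xi>)\<^sup>2) + P \<xi> + P (- \<xi>)"
      unfolding U_def C1_def P_def
      by (rule minimizer_planar_shift_inequality[OF m ab ac minim fin gm deriv \<gamma>'m \<gamma>'_eq e])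
    then have "ennreal (poisson h \<xi>) * (2 * U) \<le> ennreal (poisson h \<xi>) * (ennreal C1 * ennreal ((fst \<xi>)\<^sup>2 + (snd \<xi>)\<^sup>2) + P \<xi> + P (- \<xi>))"
      by (rule mult_left_mono) simp
    moreover have "indicator ?S \<xi> = (1::ennreal) \<or> indicator ?S \<xi> = (0::ennreal)"
      by (auto simp: indicator_def)
    ultimately show "(ennreal (poisson h \<xi>) * indicator ?S \<xi>) * (2 * U) \<le> ennreal C1 * (ennreal (poisson h \<xi>) * (ennreal ((fst \<xi>)\<^sup>2 + (snd \<xi>)\<^sup>2) * indicator ?S \<xi>)) +
      (ennreal (poisson h \<xi>) * P \<xi> + ennreal (poisson h (- \<xi>)) * P (- \<xi>))"
      by (elim disjE) (simp_all only: ph distrib_left mult_ac add_ac mult_1_right mult_1 mult_zero_left mult_zero_right zero_le)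
  qed
  also have "\<dots> = ennreal C1 * (\<integral>\<^sup>+\<xi>. ennreal (poisson h \<xi>) * (ennreal ((fst \<xi>)\<^sup>2 + (snd \<xi>)\<^sup>2) * indicator ?S \<xi>) \<partial>lborel) +
      ((\<integral>\<^sup>+\<xi>. ennreal (poisson h \<xi>) * P \<xi> \<partial>lborel) + (\<integral>\<^sup>+\<xi>. ennreal (poisson h (- \<xi>)) * P (- \<xi>) \<partial>lborel))"
  proof -
    have "(\<lambda>\<xi>. ennreal (poisson h \<xi>) * (ennreal ((fst \<xi>)\<^sup>2 + (snd \<xi>)\<^sup>2) * indicator ?S \<xi>)) \<in> borel_measurable lborel"
      "(\<lambda>\<xi>. ennreal (poisson h \<xi>) * P \<xi>) \<in> borel_measurable lborel"
      "(\<lambda>\<xi>. ennreal (poisson h (- \<xi>)) * P (- \<xi>)) \<in> borel_measurable lborel"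
      by (simp_all del: split_paired_All)
    then show ?thesis by (simp add: nn_integral_add nn_integral_cmult)
  qed
  also have "(\<integral>\<^sup>+\<xi>. ennreal (poisson h (- \<xi>)) * P (- \<xi>) \<partial>lborel) = (\<integral>\<^sup>+\<xi>. ennreal (poisson h \<xi>) * P \<xi> \<partial>lborel)"
    by (rule nn_integral_pair_minus[of "\<lambda>\<xi>. ennreal (poisson h \<xi>) * P \<xi>"]) (simp del: split_paired_All)
  also have "ennreal C1 * (\<integral>\<^sup>+\<xi>. ennreal (poisson h \<xi>) * (ennreal ((fst \<xi>)\<^sup>2 + (snd \<xi>)\<^sup>2) * indicator ?S \<xi>) \<partial>lborel) +
      ((\<integral>\<^sup>+\<xi>. ennreal (poisson h \<xi>) * P \<xi> \<partial>lborel) + (\<integral>\<^sup>+\<xi>. ennreal (poisson h \<xi>) * P \<xi> \<partial>lborel)) \<le>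
      ennreal C1 * ennreal (4 * h / pi) + (M + M)"
    by (intro add_mono mult_left_mono nn_integral_poisson_square(2)[OF h] avg) auto
  finally have main: "2 * U * p \<le> ennreal C1 * ennreal k + (M + M)" unfolding k_def .
  \<comment> \<open>Finiteness of \<open>M\<close> permits the passage to real numbers.\<close>
  have M_le: "M \<le> U" using gain by (rule order_trans[rotated]) (simp add: add_increasing2)
  then obtain \<mu> where \<mu>: "0 \<le> \<mu>" "M = ennreal \<mu>" using U_fin by (cases M) auto
  \<comment> \<open>The mass missing from the square is at most \<open>k\<close> and is charged at
    the price \<open>2 * U\<close>.\<close>
  have "2 * U * 1 \<le> 2 * U * (p + ennreal k)"
    unfolding p_def k_def by (intro mult_left_mono nn_integral_poisson_square(1)[OF h]) auto
  also have "\<dots> \<le> (ennreal C1 * ennreal k + (M + M)) + 2 * U * ennreal k"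
    unfolding distrib_left by (intro add_right_mono main)
  also have "\<dots> = ennreal (C1 * k + (\<mu> + \<mu>) + 2 * u * k)"
  proof -
    have 0: "0 \<le> C1 * k" "0 \<le> 2 * u * k" "0 \<le> \<mu> + \<mu>" using C1 k u \<mu> by auto
    have "ennreal (C1 * k) = ennreal C1 * ennreal k" using C1 k by (intro ennreal_mult) auto
    moreover have "ennreal (2 * u * k) = 2 * U * ennreal k" using u k by (simp add: ennreal_mult)
    moreover have "ennreal (\<mu> + \<mu>) = M + M" using \<mu> by (simp only: ennreal_plus)
    ultimately show ?thesis
      by (simp only: ennreal_plus[OF add_nonneg_nonneg[OF 0(1,3)] 0(2)] ennreal_plus[OF 0(1,3)])
  qed
  finally have "ennreal (2 * u) \<le> ennreal (C1 * k + (\<mu> + \<mu>) + 2 * u * k)"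
    using u by (simp add: ennreal_mult)
  then have 1: "2 * u \<le> C1 * k + (\<mu> + \<mu>) + 2 * u * k"
    using u \<mu> C1 k by (subst (asm) ennreal_le_iff) auto
  define r where "r = c / (d\<^sup>2 * h)"
  have r: "0 \<le> r" and l2: "0 \<le> 2 * l" using c d h l by (auto simp: r_def)
  have "ennreal (\<mu> + r * (2 * l)) = M + ennreal r * ennreal (2 * l)"
    by (simp only: ennreal_plus[OF \<mu>(1) mult_nonneg_nonneg[OF r l2]] ennreal_mult[OF r l2] \<mu>(2))
  also have "\<dots> \<le> ennreal u" using gain by (simp only: r_def u(2))
  finally have 2: "\<mu> + r * (2 * l) \<le> u"
    using u by (subst (asm) ennreal_le_iff) auto
  define X where "X = C1 + 2 * u"
  have X: "0 < X" using C1 u by (simp add: X_def)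
  have "X * k = C1 * k + 2 * u * k" by (simp add: X_def distrib_right)
  \<comment> \<open>Twice the gain is at most the kinetic cost \<open>C1 * k\<close> plus the cost
    \<open>2 * u * k\<close> of the missing mass.\<close>
  then have "2 * (r * (2 * l)) \<le> X * k" using 1 2 by linarith
  then have "c * l * pi \<le> X * d\<^sup>2 * h\<^sup>2"
    using d h unfolding r_def k_def by (simp add: field_simps power2_eq_square)
  \<comment> \<open>Now both sides become proportional to \<open>l\<close>, which cancels; only
    \<eta> remains.\<close>
  also have "h\<^sup>2 = 4 * (l * \<eta>) / (d\<^sup>2)\<^sup>2"
    using l \<eta> by (simp add: h_def power_divide power_mult_distrib)
  also have "X * d\<^sup>2 * (4 * (l * \<eta>) / (d\<^sup>2)\<^sup>2) = l * (X * 4 * \<eta> / d\<^sup>2)"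
    using d by (simp add: power2_eq_square field_simps)
  finally have "l * (c * pi) \<le> l * (X * 4 * \<eta> / d\<^sup>2)" by (simp only: mult_ac)
  then have "c * pi \<le> X * 4 * \<eta> / d\<^sup>2"
    using l(1) by (simp only: mult_le_cancel_left_pos)
  also have "\<dots> = c * pi * (X / (2 * (X + 1)))"
  proof -
    have "X * 4 * \<eta> / d\<^sup>2 = X * 4 * (c * pi / (8 * (X + 1)))"
      unfolding \<eta>_def X_def[symmetric] using d by simp
    also have "\<dots> = c * pi * (X / (2 * (X + 1)))" using X by (simp add: divide_simps)
    finally show ?thesis .
  qed
  also have "\<dots> < c * pi * 1"
    using c X by (intro mult_strict_left_mono) (auto simp: divide_less_eq)
  finally show False by simp
qed

section \<open>Newton's equation\<close>

text \<open>Two almost everywhere derivatives coincide almost everywhere, so a given measurable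
  \<open>k\<close> may replace the density from \<open>abs_continuous_on_FTC\<close>.\<close>

lemma abs_continuous_on_integral_derivative:
  fixes f k :: "real \<Rightarrow> 'e::euclidean_space"
  assumes f: "abs_continuous_on a b f" and ab: "a < b" and k[measurable]: "k \<in> borel_measurable borel"
    and deriv: "AE t in lborel. a < t \<and> t < b \<longrightarrow> (f has_vector_derivative k t) (at t)"
  shows "set_integrable lborel {a..b} k" and "\<And>t. t \<in> {a..b} \<Longrightarrow> f t = f a + (LINT x:{a..t}|lborel. k x)"
proof -
  obtain g where g: "integrable lborel g" "\<And>t. t \<in> {a..b} \<Longrightarrow> f t = f a + (LINT x:{a..t}|lborel. g x)"
    and dg: "AE t in lborel. a < t \<and> t < b \<longrightarrow> (f has_vector_derivative g t) (at t)"
    using abs_continuous_on_FTC[OF f ab] by blast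
  have [measurable]: "g \<in> borel_measurable borel" using g(1) by simp
  have eq: "AE x in lborel. indicator A x *\<^sub>R g x = indicator A x *\<^sub>R k x" if "A \<subseteq> {a..b}" for A
    using deriv dg AE_lborel_singleton[of a] AE_lborel_singleton[of b]
  proof eventually_elim
    case (elim x)
    show ?case
    proof (cases "x \<in> A")
      case True
      then have "a < x \<and> x < b" using elim that by auto
      then have "g x = k x" using elim vector_derivative_unique_at by blast
      then show ?thesis by simp
    qed simp
  qed
  have "set_integrable lborel {a..b} g"
    using set_integrable_subset[of lborel UNIV g "{a..b}"] g(1) by (simp add: set_integrable_def)
  then show "set_integrable lborel {a..b} k"
    unfolding set_integrable_def using eq[of "{a..b}"] by (subst integrable_cong_AE[symmetric]) auto
  show "f t = f a + (LINT x:{a..t}|lborel. k x)" if t: "t \<in> {a..b}" for t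
  proof -
    have "(LINT x:{a..t}|lborel. g x) = (LINT x:{a..t}|lborel. k x)"
      unfolding set_lebesgue_integral_def using eq[of "{a..t}"] t by (intro integral_cong_AE) auto
    then show ?thesis using g(2)[OF t] by simp
  qed
qed

text \<open>The polarization of twice the kinetic energy; with respect to it
  \<open>newton_acceleration m\<close> is the gradient of the potential.\<close>

definition mass_inner :: "('n \<Rightarrow> real) \<Rightarrow> ('a::euclidean_space, 'n::finite) vec \<Rightarrow> ('a, 'n) vec \<Rightarrow> real" where
  "mass_inner m u v = (\<Sum>i\<in>UNIV. m i * (u $ i \<bullet> v $ i))"

lemma kinetic_eq_mass_inner: "kinetic m v = mass_inner m v v / 2"
  by (simp add: kinetic_def mass_inner_def power2_norm_eq_inner)

lemma bounded_bilinear_mass_inner: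
  "bounded_bilinear (mass_inner m :: ('a::euclidean_space, 'n::finite) vec \<Rightarrow> _)"
proof
  fix u v w :: "('a, 'n) vec" and r :: real
  show "mass_inner m (u + v) w = mass_inner m u w + mass_inner m v w"
    by (simp add: mass_inner_def inner_add_left distrib_left sum.distrib)
  show "mass_inner m u (v + w) = mass_inner m u v + mass_inner m u w"
    by (simp add: mass_inner_def inner_add_right distrib_left sum.distrib)
  show "mass_inner m (r *\<^sub>R u) v = r *\<^sub>R mass_inner m u v"
    by (simp add: mass_inner_def sum_distrib_left mult_ac)
  show "mass_inner m u (r *\<^sub>R v) = r *\<^sub>R mass_inner m u v"
    by (simp add: mass_inner_def sum_distrib_left mult_ac)
  show "\<exists>K. \<forall>u v :: ('a, 'n) vec. norm (mass_inner m u v) \<le> norm u * norm v * K"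
  proof (intro exI allI)
    fix u v :: "('a, 'n) vec"
    have "norm (mass_inner m u v) \<le> (\<Sum>i\<in>UNIV. norm (m i * (u $ i \<bullet> v $ i)))"
      unfolding mass_inner_def by (rule norm_sum)
    also have "\<dots> \<le> (\<Sum>i\<in>UNIV. norm u * norm v * \<bar>m i\<bar>)"
    proof (rule sum_mono)
      fix i
      have "\<bar>u $ i \<bullet> v $ i\<bar> \<le> norm (u $ i) * norm (v $ i)" by (rule Cauchy_Schwarz_ineq2)
      also have "\<dots> \<le> norm u * norm v" by (intro mult_mono Finite_Cartesian_Product.norm_nth_le) auto
      finally show "norm (m i * (u $ i \<bullet> v $ i)) \<le> norm u * norm v * \<bar>m i\<bar>"
        by (simp add: abs_mult mult.commute mult_left_mono)
    qed
    also have "\<dots> = norm u * norm v * (\<Sum>i\<in>UNIV. \<bar>m i\<bar>)" by (simp add: sum_distrib_left)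
    finally show "norm (mass_inner m u v) \<le> norm u * norm v * (\<Sum>i\<in>UNIV. \<bar>m i\<bar>)" .
  qed
qed

interpretation mass_inner: bounded_bilinear "mass_inner m :: ('a::euclidean_space, 'n::finite) vec \<Rightarrow> _"
  by (rule bounded_bilinear_mass_inner)

lemma mass_inner_commute: "mass_inner m u v = mass_inner m v u"
  by (simp add: mass_inner_def inner_commute)

lemma mass_inner_measurable[measurable]:
  assumes [measurable]: "f \<in> borel_measurable M" "g \<in> borel_measurable M"
  shows "(\<lambda>t. mass_inner m (f t) (g t)) \<in> borel_measurable M"
  unfolding mass_inner_def by measurable

section \<open>Second-order expansion of kinetic and potential energy\<close>

lemma kinetic_diff_scaleR: "kinetic m (u - e *\<^sub>R v) = kinetic m u - e * mass_inner m u v + e\<^sup>2 * kinetic m v"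
  by (simp add: kinetic_eq_mass_inner mass_inner.diff_left mass_inner.diff_right mass_inner.scaleR_left
      mass_inner.scaleR_right mass_inner_commute[of m v u] power2_eq_square field_simps)

text \<open>With \<open>v = norm (x + z) / norm x\<close> and \<open>v^2 = 1 + u\<close> this rests
  on \<open>1 / v \<le> 1 - u / 2 + 2 * u^2\<close>, valid for \<open>v \<ge> 1 / 2\<close>. The
  part of \<open>- u / 2\<close> quadratic in \<open>z\<close> is nonpositive and dropped;
  \<open>2 * u^2\<close> contributes the factor 25/2, rounded up to 13.\<close>

lemma inverse_norm_upper_bound:
  fixes x z :: "'a::real_inner"
  assumes x: "x \<noteq> 0" and z: "norm z \<le> norm x / 2"
  shows "1 / norm (x + z) \<le> 1 / norm x - (x \<bullet> z) / norm x ^ 3 + 13 * (norm z)\<^sup>2 / norm x ^ 3"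
proof -
  define r where "r = norm x"
  have r: "0 < r" using x by (simp add: r_def)
  have nz: "r / 2 \<le> norm (x + z)"
    using z norm_triangle_ineq4[of "x + z" z] by (simp add: r_def)
  define v where "v = norm (x + z) / r"
  have v: "1 / 2 \<le> v" using nz r by (simp add: v_def field_simps)
  define u where "u = (2 * (x \<bullet> z) + (norm z)\<^sup>2) / r\<^sup>2"
  have "(norm (x + z))\<^sup>2 = r\<^sup>2 + 2 * (x \<bullet> z) + (norm z)\<^sup>2"
    by (simp add: r_def power2_norm_eq_inner inner_simps inner_commute)
  then have uv: "v\<^sup>2 = 1 + u" using r by (simp add: v_def u_def power_divide field_simps)
  have "1 / v \<le> 1 - u / 2 + 2 * u\<^sup>2"
  proof -
    \<comment> \<open>The double zero at \<open>v = 1\<close> reflects agreement to first order;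
      \<open>v^2 - 1\<close> vanishes there too, so its square can absorb the error.\<close>
    have "1 - v + v * (v\<^sup>2 - 1) / 2 = (v - 1)\<^sup>2 * ((v + 2) / 2)" by (simp add: power2_eq_square field_simps)
    also have "\<dots> \<le> (v - 1)\<^sup>2 * (2 * v * (v + 1)\<^sup>2)"
    proof (rule mult_left_mono)
      have "1 \<le> 2 * v" using v by simp
      then have "1 * (v + 1)\<^sup>2 \<le> 2 * v * (v + 1)\<^sup>2" by (intro mult_right_mono) auto
      moreover have "(v + 2) / 2 \<le> (v + 1)\<^sup>2" using v by (simp add: power2_eq_square field_simps)
      ultimately show "(v + 2) / 2 \<le> 2 * v * (v + 1)\<^sup>2" by simp
    qed simp
    also have "\<dots> = 2 * v * (v\<^sup>2 - 1)\<^sup>2" by (simp add: power2_eq_square algebra_simps)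
    finally have "1 \<le> v * (1 - u / 2 + 2 * u\<^sup>2)" unfolding uv by (simp add: algebra_simps)
    then show ?thesis using v by (simp add: divide_le_eq mult.commute)
  qed
  moreover have "u\<^sup>2 \<le> (25 / 4) * (norm z)\<^sup>2 / r\<^sup>2"
  proof -
    have "\<bar>2 * (x \<bullet> z) + (norm z)\<^sup>2\<bar> \<le> 2 * (r * norm z) + (norm z)\<^sup>2"
      using Cauchy_Schwarz_ineq2[of x z] zero_le_power2[of "norm z"] unfolding r_def by linarith
    also have "(norm z)\<^sup>2 \<le> (r / 2) * norm z"
      unfolding power2_eq_square using z by (intro mult_right_mono) (auto simp: r_def)
    finally have "\<bar>2 * (x \<bullet> z) + (norm z)\<^sup>2\<bar> \<le> (5 / 2) * (r * norm z)" by simp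
    then have "\<bar>2 * (x \<bullet> z) + (norm z)\<^sup>2\<bar>\<^sup>2 \<le> ((5 / 2) * (r * norm z))\<^sup>2" by (rule power_mono) simp
    then have "(2 * (x \<bullet> z) + (norm z)\<^sup>2)\<^sup>2 / (r\<^sup>2)\<^sup>2 \<le> ((5 / 2) * (r * norm z))\<^sup>2 / (r\<^sup>2)\<^sup>2"
      by (intro divide_right_mono) auto
    also have "((5 / 2) * (r * norm z))\<^sup>2 / (r\<^sup>2)\<^sup>2 = (25 / 4) * (norm z)\<^sup>2 / r\<^sup>2"
      using r by (simp add: power2_eq_square field_simps)
    finally show ?thesis by (simp add: u_def power_divide)
  qed
  moreover have "- u / 2 \<le> - (x \<bullet> z) / r\<^sup>2"
    using r by (simp add: u_def field_simps)
  ultimately have "1 / v \<le> 1 - (x \<bullet> z) / r\<^sup>2 + 13 * (norm z)\<^sup>2 / r\<^sup>2"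
  proof -
    assume 1: "1 / v \<le> 1 - u / 2 + 2 * u\<^sup>2" and 2: "u\<^sup>2 \<le> (25 / 4) * (norm z)\<^sup>2 / r\<^sup>2" and 3: "- u / 2 \<le> - (x \<bullet> z) / r\<^sup>2"
    have "(25 / 2) * ((norm z)\<^sup>2 / r\<^sup>2) \<le> 13 * ((norm z)\<^sup>2 / r\<^sup>2)" by (rule mult_right_mono) auto
    then have "2 * ((25 / 4) * (norm z)\<^sup>2 / r\<^sup>2) \<le> 13 * (norm z)\<^sup>2 / r\<^sup>2" by simp
    with 1 2 3 show ?thesis by simp
  qed
  then have "(1 / v) / r \<le> (1 - (x \<bullet> z) / r\<^sup>2 + 13 * (norm z)\<^sup>2 / r\<^sup>2) / r"
    using r by (intro divide_right_mono) auto
  moreover have "(1 / v) / r = 1 / norm (x + z)" using r by (simp add: v_def)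
  moreover have "(1 - (x \<bullet> z) / r\<^sup>2 + 13 * (norm z)\<^sup>2 / r\<^sup>2) / r = 1 / r - (x \<bullet> z) / r ^ 3 + 13 * (norm z)\<^sup>2 / r ^ 3"
    by (simp add: diff_divide_distrib add_divide_distrib power2_eq_square power3_eq_cube mult_ac)
  ultimately show ?thesis by (simp add: r_def)
qed

lemma sum_pairs:
  fixes f :: "'n::{finite,linorder} \<Rightarrow> 'n \<Rightarrow> real"
  shows "(\<Sum>i\<in>UNIV. \<Sum>j\<in>UNIV - {i}. f i j) = (\<Sum>(i, j)\<in>{(i, j). i < j}. f i j + f j i)"
proof -
  have "(\<Sum>i\<in>UNIV. \<Sum>j\<in>UNIV - {i}. f i j) = (\<Sum>(i, j)\<in>Sigma UNIV (\<lambda>i. UNIV - {i}). f i j)"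
    by (rule sum.Sigma) auto
  also have "Sigma UNIV (\<lambda>i::'n. UNIV - {i}) = {(i, j). i < j} \<union> {(i, j). j < i}" by auto
  also have "(\<Sum>(i, j)\<in>{(i, j). i < j} \<union> {(i, j). j < i}. f i j) =
      (\<Sum>(i, j)\<in>{(i, j). i < j}. f i j) + (\<Sum>(i, j)\<in>{(i, j). j < i}. f i j)"
    by (rule sum.union_disjoint) (auto intro: finite_subset[OF subset_UNIV])
  also have "(\<Sum>(i, j)\<in>{(i, j). j < i}. f i j) = (\<Sum>(i, j)\<in>{(i, j). i < j}. f j i)"
    by (rule sum.reindex_bij_witness[of _ "\<lambda>(i, j). (j, i)" "\<lambda>(i, j). (j, i)"]) auto
  finally show ?thesis by (simp add: sum.distrib[symmetric] case_prod_unfold)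
qed

text \<open>By Newton's third law the terms \<open>(i, j)\<close> and \<open>(j, i)\<close> combine
  into one, which exhibits the derivative of the potential at \<open>x\<close> in direction
  \<open>y\<close>.\<close>

lemma mass_inner_newton_acceleration:
  fixes x y :: "('a::euclidean_space, 'n::{finite,linorder}) vec"
  shows "mass_inner m (newton_acceleration m x) y =
    - (\<Sum>(i, j)\<in>{(i, j). i < j}. m i * m j * ((x $ i - x $ j) \<bullet> (y $ i - y $ j)) / norm (x $ i - x $ j) ^ 3)"
proof -
  have "mass_inner m (newton_acceleration m x) y =
      (\<Sum>i\<in>UNIV. \<Sum>j\<in>UNIV - {i}. m i * (m j / norm (x $ i - x $ j) ^ 3) * ((x $ j - x $ i) \<bullet> y $ i))"
    by (simp add: mass_inner_def newton_acceleration_def inner_sum_left sum_distrib_left mult.assoc)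
  also have "\<dots> = (\<Sum>(i, j)\<in>{(i, j). i < j}. m i * (m j / norm (x $ i - x $ j) ^ 3) * ((x $ j - x $ i) \<bullet> y $ i) +
      m j * (m i / norm (x $ j - x $ i) ^ 3) * ((x $ i - x $ j) \<bullet> y $ j))"
    by (rule sum_pairs)
  also have "\<dots> = (\<Sum>(i, j)\<in>{(i, j). i < j}. - (m i * m j * ((x $ i - x $ j) \<bullet> (y $ i - y $ j)) / norm (x $ i - x $ j) ^ 3))"
  proof (rule sum.cong, simp, clarify)
    fix i j
    have "norm (x $ j - x $ i) = norm (x $ i - x $ j)" by (rule norm_minus_commute)
    then show "m i * (m j / norm (x $ i - x $ j) ^ 3) * ((x $ j - x $ i) \<bullet> y $ i) +
      m j * (m i / norm (x $ j - x $ i) ^ 3) * ((x $ i - x $ j) \<bullet> y $ j) =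
      - (m i * m j * ((x $ i - x $ j) \<bullet> (y $ i - y $ j)) / norm (x $ i - x $ j) ^ 3)"
      by (simp add: inner_diff_left inner_diff_right diff_divide_distrib add_divide_distrib algebra_simps)
  qed
  finally show ?thesis by (simp add: sum_negf case_prod_unfold)
qed

text \<open>An upper bound suffices, since only the action of a competitor is estimated. The
  condition on \<open>e\<close> keeps relative displacements at most \<open>\<delta> / 2\<close>, as
  \<open>inverse_norm_upper_bound\<close> needs; its 13 times the square of 2 from
  \<open>norm (y $ i - y $ j) \<le> 2 * K\<close> gives 52.\<close>

lemma real_potential_upper_bound:
  fixes x y :: "('a::euclidean_space, 'n::{finite,linorder}) vec"
  assumes m: "\<And>i. m i > 0" and \<delta>: "0 < \<delta>" and x: "\<And>i j. i \<noteq> j \<Longrightarrow> \<delta> \<le> norm (x $ i - x $ j)"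
    and y: "norm y \<le> K" and e: "0 \<le> e" "4 * e * K \<le> \<delta>"
  shows "(\<forall>i j. i \<noteq> j \<longrightarrow> (x - e *\<^sub>R y) $ i \<noteq> (x - e *\<^sub>R y) $ j) \<and>
    real_potential m (x - e *\<^sub>R y) \<le> real_potential m x - e * mass_inner m (newton_acceleration m x) y +
      e\<^sup>2 * (\<Sum>(i, j)\<in>{(i, j). i < j}. m i * m j * (52 * K\<^sup>2 / \<delta> ^ 3))"
proof -
  have K: "0 \<le> K" using y norm_ge_zero order_trans by blast
  have pair: "x $ i - x $ j \<noteq> 0 \<and> norm (- (e *\<^sub>R (y $ i - y $ j))) \<le> norm (x $ i - x $ j) / 2 \<and>
      (norm (- (e *\<^sub>R (y $ i - y $ j))))\<^sup>2 \<le> e\<^sup>2 * (4 * K\<^sup>2)" if "i \<noteq> j" for i j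
  proof -
    have "norm (y $ i - y $ j) \<le> norm (y $ i) + norm (y $ j)" by (rule norm_triangle_ineq4)
    also have "\<dots> \<le> 2 * K" using y Finite_Cartesian_Product.norm_nth_le[of y i] Finite_Cartesian_Product.norm_nth_le[of y j] by simp
    finally have yK: "norm (y $ i - y $ j) \<le> 2 * K" .
    then have n: "norm (- (e *\<^sub>R (y $ i - y $ j))) \<le> e * (2 * K)" using e by (simp add: mult_left_mono)
    then have "(norm (- (e *\<^sub>R (y $ i - y $ j))))\<^sup>2 \<le> (e * (2 * K))\<^sup>2" by (rule power_mono) simp
    also have "(e * (2 * K))\<^sup>2 = e\<^sup>2 * (4 * K\<^sup>2)" by (simp add: power_mult_distrib)
    finally show ?thesis using n x[OF that] \<delta> e by auto
  qed
  have ne: "(x - e *\<^sub>R y) $ i \<noteq> (x - e *\<^sub>R y) $ j" if "i \<noteq> j" for i j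
  proof
    assume "(x - e *\<^sub>R y) $ i = (x - e *\<^sub>R y) $ j"
    then have "x $ i - x $ j = e *\<^sub>R (y $ i - y $ j)" by (simp add: algebra_simps)
    then have "norm (- (e *\<^sub>R (y $ i - y $ j))) = norm (x $ i - x $ j)" by (simp only: norm_minus_cancel)
    then show False using pair[OF that] x[OF that] \<delta> by linarith
  qed
  have "real_potential m (x - e *\<^sub>R y) \<le> (\<Sum>(i, j)\<in>{(i, j). i < j}. m i * m j / norm (x $ i - x $ j) +
      e * (m i * m j * ((x $ i - x $ j) \<bullet> (y $ i - y $ j)) / norm (x $ i - x $ j) ^ 3) + e\<^sup>2 * (m i * m j * (52 * K\<^sup>2 / \<delta> ^ 3)))"
    unfolding real_potential_def
  proof (rule sum_mono, clarify)
    fix i j :: 'n assume "i < j"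
    then have ij: "i \<noteq> j" by simp
    let ?X = "x $ i - x $ j" and ?Y = "y $ i - y $ j"
    have mm: "0 \<le> m i * m j" using m[of i] m[of j] by simp
    have E: "(x - e *\<^sub>R y) $ i - (x - e *\<^sub>R y) $ j = ?X + - (e *\<^sub>R ?Y)" by (simp add: algebra_simps)
    have "1 / norm ((x - e *\<^sub>R y) $ i - (x - e *\<^sub>R y) $ j) \<le>
        1 / norm ?X - (?X \<bullet> - (e *\<^sub>R ?Y)) / norm ?X ^ 3 + 13 * (norm (- (e *\<^sub>R ?Y)))\<^sup>2 / norm ?X ^ 3"
      unfolding E using pair[OF ij] by (intro inverse_norm_upper_bound) blast+
    also have "13 * (norm (- (e *\<^sub>R ?Y)))\<^sup>2 / norm ?X ^ 3 \<le> 13 * (e\<^sup>2 * (4 * K\<^sup>2)) / \<delta> ^ 3"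
      using pair[OF ij] x[OF ij] \<delta> by (intro frac_le mult_left_mono power_mono) auto
    finally have "1 / norm ((x - e *\<^sub>R y) $ i - (x - e *\<^sub>R y) $ j) \<le>
        1 / norm ?X + e * ((?X \<bullet> ?Y) / norm ?X ^ 3) + e\<^sup>2 * (52 * K\<^sup>2 / \<delta> ^ 3)" by (simp add: mult_ac)
    from mult_left_mono[OF this mm]
    show "m i * m j / norm ((x - e *\<^sub>R y) $ i - (x - e *\<^sub>R y) $ j) \<le> m i * m j / norm ?X +
      e * (m i * m j * (?X \<bullet> ?Y) / norm ?X ^ 3) + e\<^sup>2 * (m i * m j * (52 * K\<^sup>2 / \<delta> ^ 3))"
      by (simp add: distrib_left mult_ac)
  qed
  also have "\<dots> = real_potential m x - e * mass_inner m (newton_acceleration m x) y +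
      e\<^sup>2 * (\<Sum>(i, j)\<in>{(i, j). i < j}. m i * m j * (52 * K\<^sup>2 / \<delta> ^ 3))"
    unfolding mass_inner_newton_acceleration real_potential_def
    by (simp add: sum.distrib sum_distrib_left case_prod_unfold)
  finally show ?thesis using ne by blast
qed

section \<open>Continuity and integrability along collision-free curves\<close>

lemma newton_acceleration_continuous:
  fixes \<gamma> :: "real \<Rightarrow> ('a::euclidean_space, 'n::{finite,linorder}) vec"
  assumes "continuous_on S \<gamma>" and "\<And>t i j. t \<in> S \<Longrightarrow> i \<noteq> j \<Longrightarrow> \<gamma> t $ i \<noteq> \<gamma> t $ j"
  shows "continuous_on S (\<lambda>t. newton_acceleration m (\<gamma> t))"
proof -
  have c: "continuous_on S (\<lambda>t. \<gamma> t $ i)" for i by (intro continuous_intros assms(1))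
  show ?thesis
    unfolding newton_acceleration_def
    using assms(2)
    by (intro continuous_on_vec_lambda continuous_on_sum continuous_on_scaleR continuous_on_divide continuous_on_power
        continuous_on_norm continuous_on_diff continuous_on_const c) auto
qed

lemma real_potential_continuous:
  fixes \<gamma> :: "real \<Rightarrow> ('a::euclidean_space, 'n::{finite,linorder}) vec"
  assumes "continuous_on S \<gamma>" and "\<And>t i j. t \<in> S \<Longrightarrow> i \<noteq> j \<Longrightarrow> \<gamma> t $ i \<noteq> \<gamma> t $ j"
  shows "continuous_on S (\<lambda>t. real_potential m (\<gamma> t))"
proof -
  have c: "continuous_on S (\<lambda>t. \<gamma> t $ i)" for i by (intro continuous_intros assms(1))
  show ?thesis
    unfolding real_potential_def case_prod_unfold
    using assms(2)
    by (intro continuous_on_sum continuous_on_divide continuous_on_norm continuous_on_diff continuous_on_const c) auto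
qed

lemma collision_free_curve_separation:
  fixes \<gamma> :: "real \<Rightarrow> ('a::euclidean_space, 'n::{finite,linorder}) vec"
  assumes cont: "continuous_on {a..b} \<gamma>" and ne: "\<And>t i j. t \<in> {a..b} \<Longrightarrow> i \<noteq> j \<Longrightarrow> \<gamma> t $ i \<noteq> \<gamma> t $ j"
  obtains \<delta> where "0 < \<delta>" "\<And>t i j. t \<in> {a..b} \<Longrightarrow> i \<noteq> j \<Longrightarrow> \<delta> \<le> norm (\<gamma> t $ i - \<gamma> t $ j)"
proof (cases "a \<le> b")
  case False
  then show thesis using that[of 1] by auto
next
  case True
  have "\<exists>\<delta>>0. \<forall>t\<in>{a..b}. \<delta> \<le> norm (\<gamma> t $ i - \<gamma> t $ j)" if "i \<noteq> j" for i j
  proof -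
    have "continuous_on {a..b} (\<lambda>t. norm (\<gamma> t $ i - \<gamma> t $ j))" by (intro continuous_intros cont)
    then obtain s where "s \<in> {a..b}" "\<And>t. t \<in> {a..b} \<Longrightarrow> norm (\<gamma> s $ i - \<gamma> s $ j) \<le> norm (\<gamma> t $ i - \<gamma> t $ j)"
      using continuous_attains_inf[of "{a..b}" "\<lambda>t. norm (\<gamma> t $ i - \<gamma> t $ j)"] True by auto
    then show ?thesis using ne[of s i j] that by (intro exI[of _ "norm (\<gamma> s $ i - \<gamma> s $ j)"]) auto
  qed
  then obtain D where D: "\<And>i j. i \<noteq> j \<Longrightarrow> 0 < D i j"
    "\<And>i j t. i \<noteq> j \<Longrightarrow> t \<in> {a..b} \<Longrightarrow> D i j \<le> norm (\<gamma> t $ i - \<gamma> t $ j)" by metis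
  \<comment> \<open>The element 1 keeps the set nonempty when there is only one body.\<close>
  define A where "A = insert 1 ((\<lambda>(i, j). D i j) ` {(i, j). i \<noteq> j})"
  have A: "finite A" "A \<noteq> {}" unfolding A_def by (auto intro: finite_subset[OF subset_UNIV])
  show thesis
  proof (rule that[of "Min A"])
    show "0 < Min A" using A D(1) by (subst Min_gr_iff) (auto simp: A_def)
    fix t i j assume "t \<in> {a..b}" "i \<noteq> (j::'n)"
    moreover have "D i j \<in> A" using \<open>i \<noteq> j\<close> by (auto simp: A_def)
    ultimately show "Min A \<le> norm (\<gamma> t $ i - \<gamma> t $ j)" using A Min_le[of A "D i j"] D(2)[of i j t] by linarith
  qed
qed

lemma set_integrable_continuous_indicator:
  fixes f :: "real \<Rightarrow> 'e::euclidean_space"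
  assumes "continuous_on {a..b} f"
  shows "set_integrable lborel {a..b} f"
  using borel_integrable_compact[OF _ assms] by (simp add: set_integrable_def indicator_def if_distrib cong: if_cong)

lemma set_integrable_kinetic:
  fixes v :: "real \<Rightarrow> ('a::euclidean_space, 'n::finite) vec"
  assumes m: "\<And>i. m i > 0" and [measurable]: "v \<in> borel_measurable borel"
    and fin: "(\<integral>\<^sup>+t\<in>{a..b}. ennreal (kinetic m (v t)) \<partial>lborel) < \<infinity>"
  shows "set_integrable lborel {a..b} (\<lambda>t. kinetic m (v t))"
  unfolding set_integrable_def
proof (rule integrableI_nonneg)
  show "AE t in lborel. 0 \<le> indicat_real {a..b} t *\<^sub>R kinetic m (v t)"
    by (rule AE_I2) (simp add: kinetic_nonneg m)
  have "(\<integral>\<^sup>+t. ennreal (indicat_real {a..b} t *\<^sub>R kinetic m (v t)) \<partial>lborel) = (\<integral>\<^sup>+t\<in>{a..b}. ennreal (kinetic m (v t)) \<partial>lborel)"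
    by (intro nn_integral_cong) (auto split: split_indicator)
  then show "(\<integral>\<^sup>+t. ennreal (indicat_real {a..b} t *\<^sub>R kinetic m (v t)) \<partial>lborel) < \<infinity>" using fin by simp
qed measurable

lemma set_nn_integral_eq_set_integral:
  fixes f :: "real \<Rightarrow> real"
  assumes "set_integrable lborel A f" "\<And>t. t \<in> A \<Longrightarrow> 0 \<le> f t"
  shows "(\<integral>\<^sup>+t\<in>A. ennreal (f t) \<partial>lborel) = ennreal (LINT t:A|lborel. f t)"
proof -
  have "(\<integral>\<^sup>+t\<in>A. ennreal (f t) \<partial>lborel) = (\<integral>\<^sup>+t. ennreal (indicator A t *\<^sub>R f t) \<partial>lborel)"
    by (intro nn_integral_cong) (auto split: split_indicator)
  also have "\<dots> = ennreal (LINT t:A|lborel. f t)"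
    unfolding set_lebesgue_integral_def
    using assms by (intro nn_integral_eq_integral) (auto simp: set_integrable_def split: split_indicator)
  finally show ?thesis .
qed

text \<open>The single variation \<open>\<eta>\<close>, the deviation of \<open>\<gamma>\<close> from a solution of the linear equation
  \<open>x'' = newton_acceleration m \<circ> \<gamma>\<close>, suffices: the first variation in this direction is the integral
  of \<open>2 * kinetic m \<eta>'\<close>.\<close>

theorem minimizer_solves_newton:
  fixes m :: "'n::{finite,linorder} \<Rightarrow> real" and \<gamma> :: "real \<Rightarrow> ('a::euclidean_space, 'n) vec"
  assumes m: "\<And>i. m i > 0" and ab: "a < b" and ac: "abs_continuous_on a b \<gamma>"
    and minim: "action m a b \<gamma> = action_potential m (\<gamma> a) (\<gamma> b)" and fin: "action m a b \<gamma> < \<infinity>"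
    and ne: "\<And>t i j. t \<in> {a..b} \<Longrightarrow> i \<noteq> j \<Longrightarrow> \<gamma> t $ i \<noteq> \<gamma> t $ j"
  shows "\<exists>v. \<forall>t\<in>{a<..<b}. (\<gamma> has_vector_derivative v t) (at t) \<and>
    (v has_vector_derivative newton_acceleration m (\<gamma> t)) (at t)"
proof -
  have cont: "continuous_on {a..b} \<gamma>" by (rule abs_continuous_on_imp_continuous_on[OF ac])
  define A where "A t = newton_acceleration m (\<gamma> t)" for t
  have A_cont: "continuous_on {a..b} A"
    unfolding A_def[abs_def] by (rule newton_acceleration_continuous[OF cont ne])
  define F where "F t = integral {a..t} A" for t
  have dF: "(F has_vector_derivative A t) (at t)" if "a < t" "t < b" for t
  proof -
    have "(F has_vector_derivative A t) (at t within {a..b})"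
      unfolding F_def[abs_def] using that by (intro integral_has_vector_derivative A_cont) auto
    then show ?thesis using that by (simp add: at_within_Icc_at)
  qed
  have F_cont: "continuous_on {a..b} F"
    unfolding F_def[abs_def] by (intro indefinite_integral_continuous_1 integrable_continuous_real A_cont)
  define p where "p t = integral {a..t} F" for t
  have dp: "(p has_vector_derivative F t) (at t)" if "a < t" "t < b" for t
  proof -
    have "(p has_vector_derivative F t) (at t within {a..b})"
      unfolding p_def[abs_def] using that by (intro integral_has_vector_derivative F_cont) auto
    then show ?thesis using that by (simp add: at_within_Icc_at)
  qed
  have lip: "abs_continuous_on a b (\<lambda>t. integral {a..t} f)" if f: "continuous_on {a..b} f"
    for f :: "real \<Rightarrow> ('a, 'n) vec"
  proof -
    have "compact (f ` {a..b})" by (rule compact_continuous_image[OF f compact_Icc])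
    then obtain B where B: "\<And>t. t \<in> {a..b} \<Longrightarrow> norm (f t) \<le> B"
      using compact_imp_bounded bounded_iff by (metis imageI)
    show ?thesis
    proof (rule abs_continuous_on_lipschitz[where C=B])
      fix u v assume uv: "a \<le> u" "u \<le> v" "v \<le> b"
      have "integral {a..u} f + integral {u..v} f = integral {a..v} f"
        using uv f by (intro Henstock_Kurzweil_Integration.integral_combine integrable_continuous_real)
          (auto intro: continuous_on_subset)
      then have "integral {a..v} f - integral {a..u} f = integral {u..v} f" by (simp add: algebra_simps)
      also have "norm \<dots> \<le> B * (v - u)"
        using uv f B by (intro integral_bound) (auto intro: continuous_on_subset)
      finally show "norm (integral {a..v} f - integral {a..u} f) \<le> B * (v - u)" .
    qed
  qed
  \<comment> \<open>The slope for which \<open>p\<close> plus an affine term meets \<gamma> at both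
    end points, so that \<eta> is an admissible variation.\<close>
  define c where "c = ((\<gamma> b - p b) - (\<gamma> a - p a)) /\<^sub>R (b - a)"
  define \<eta> where "\<eta> t = \<gamma> t + - (p t + ((\<gamma> a - p a) + (t - a) *\<^sub>R c))" for t
  have \<eta>_ends: "\<eta> a = 0" "\<eta> b = 0" using ab by (auto simp: \<eta>_def c_def)
  have \<eta>_ac: "abs_continuous_on a b \<eta>"
    unfolding \<eta>_def[abs_def]
  proof (intro abs_continuous_on_add ac abs_continuous_on_bounded_linear[OF _ bounded_linear_minus[OF bounded_linear_ident]])
    show "abs_continuous_on a b p" unfolding p_def[abs_def] by (rule lip[OF F_cont])
    show "abs_continuous_on a b (\<lambda>t. \<gamma> a - p a)" by (rule abs_continuous_on_lipschitz[where C=0]) simp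
    show "abs_continuous_on a b (\<lambda>t. (t - a) *\<^sub>R c)"
      by (rule abs_continuous_on_lipschitz[where C="norm c"]) (simp add: scaleR_diff_left[symmetric])
  qed
  have \<eta>_cont: "continuous_on {a..b} \<eta>" by (rule abs_continuous_on_imp_continuous_on[OF \<eta>_ac])
  obtain g where g: "integrable lborel g"
    and deriv: "AE t in lborel. a < t \<and> t < b \<longrightarrow> (\<gamma> has_vector_derivative g t) (at t)"
    using abs_continuous_on_FTC[OF ac ab] by blast
  have gm[measurable]: "g \<in> borel_measurable borel" using g by simp
  \<comment> \<open>The derivative of the corrected \<open>p\<close>, set to 0 outside
    \<open>{a..b}\<close> to be Borel on the line.\<close>
  define G where "G t = indicator {a..b} t *\<^sub>R (F t + c)" for t
  have Fc_cont: "continuous_on {a..b} (\<lambda>t. F t + c)" by (intro continuous_intros F_cont)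
  have Gm[measurable]: "G \<in> borel_measurable borel"
    unfolding G_def[abs_def] using Fc_cont by (intro borel_measurable_continuous_on_indicator) auto
  define k where "k t = g t - G t" for t
  have km[measurable]: "k \<in> borel_measurable borel" unfolding k_def[abs_def] by measurable
  have dk: "AE t in lborel. a < t \<and> t < b \<longrightarrow> (\<eta> has_vector_derivative k t) (at t)"
    using deriv
  proof eventually_elim
    case (elim t)
    show ?case
    proof
      assume t: "a < t \<and> t < b"
      have "((\<lambda>t. p t + ((\<gamma> a - p a) + (t - a) *\<^sub>R c)) has_vector_derivative F t + (0 + c)) (at t)"
        using t by (intro has_vector_derivative_add dp has_vector_derivative_const) (auto intro!: derivative_eq_intros)
      from has_vector_derivative_add[OF elim[rule_format, OF t] has_vector_derivative_minus[OF this]]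
      have "(\<eta> has_vector_derivative g t + - (F t + (0 + c))) (at t)"
        unfolding \<eta>_def[abs_def] .
      moreover have "k t = g t + - (F t + (0 + c))" using t by (simp add: k_def G_def)
      ultimately show "(\<eta> has_vector_derivative k t) (at t)" by (simp only:)
    qed
  qed
  have act: "action m a b \<gamma> = (\<integral>\<^sup>+t\<in>{a..b}. (ennreal (kinetic m (g t)) + potential m (\<gamma> t)) \<partial>lborel)"
    by (rule action_eq_nn_integral[OF deriv])
  have "(\<integral>\<^sup>+t\<in>{a..b}. ennreal (kinetic m (g t)) \<partial>lborel) \<le> action m a b \<gamma>"
    unfolding act by (intro nn_integral_mono mult_right_mono) auto
  then have Tg: "set_integrable lborel {a..b} (\<lambda>t. kinetic m (g t))"
    using fin by (intro set_integrable_kinetic m gm) (auto intro: le_less_trans)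
  have kinetic_cont: "continuous_on {a..b} (\<lambda>t. kinetic m (F t + c))"
    unfolding kinetic_def by (intro continuous_intros F_cont)
  have TG: "set_integrable lborel {a..b} (\<lambda>t. kinetic m (G t))"
  proof -
    have E: "indicat_real {a..b} t *\<^sub>R kinetic m (G t) = indicat_real {a..b} t *\<^sub>R kinetic m (F t + c)" for t
      by (auto simp: G_def split: split_indicator)
    show ?thesis
      using set_integrable_continuous_indicator[OF kinetic_cont] unfolding set_integrable_def E .
  qed
  \<comment> \<open>By the parallelogram law, \<open>k\<close> being the difference of two functions
    of finite kinetic energy.\<close>
  have Tk: "set_integrable lborel {a..b} (\<lambda>t. kinetic m (k t))"
    unfolding set_integrable_def
  proof (rule Bochner_Integration.integrable_bound)
    show "integrable lborel (\<lambda>t. indicat_real {a..b} t *\<^sub>R (2 * kinetic m (g t) + 2 * kinetic m (G t)))"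
      using set_integral_add(1)[OF set_integrable_mult_right[OF Tg, of 2] set_integrable_mult_right[OF TG, of 2]]
      by (simp add: set_integrable_def)
    show "AE t in lborel. norm (indicat_real {a..b} t *\<^sub>R kinetic m (k t)) \<le> norm (indicat_real {a..b} t *\<^sub>R (2 * kinetic m (g t) + 2 * kinetic m (G t)))"
    proof (rule AE_I2)
      fix t
      have "kinetic m (k t) \<le> 2 * kinetic m (g t) + 2 * kinetic m (G t)"
        using kinetic_parallelogram[of m "g t" "G t"] kinetic_nonneg[of m "g t + G t", OF m] by (simp add: k_def)
      then show "norm (indicat_real {a..b} t *\<^sub>R kinetic m (k t)) \<le> norm (indicat_real {a..b} t *\<^sub>R (2 * kinetic m (g t) + 2 * kinetic m (G t)))"
        using kinetic_nonneg[of m "k t", OF m] by (auto split: split_indicator)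
    qed
  qed measurable
  \<comment> \<open>Polarization with \<open>g t - k t = G t\<close>: integrability of the mixed
    term follows from that of three kinetic energies.\<close>
  have polar: "mass_inner m (g t) (k t) = kinetic m (g t) + kinetic m (k t) - kinetic m (G t)" for t
    using kinetic_diff_scaleR[of m "g t" 1 "k t"] by (simp add: k_def)
  have Igk: "set_integrable lborel {a..b} (\<lambda>t. mass_inner m (g t) (k t))"
    unfolding polar by (intro set_integral_diff set_integral_add Tg Tk TG)
  have A\<eta>_cont: "continuous_on {a..b} (\<lambda>t. mass_inner m (A t) (\<eta> t))"
    by (rule mass_inner.continuous_on[OF A_cont \<eta>_cont])
  have IA\<eta>: "set_integrable lborel {a..b} (\<lambda>t. mass_inner m (A t) (\<eta> t))"
    by (rule set_integrable_continuous_indicator[OF A\<eta>_cont])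
  \<comment> \<open>The integrand of the first variation in direction \<eta>; below,
    \<open>l0\<close> is the Lagrangian along \<gamma> and \<open>l2\<close> bounds the coefficient
    of \<open>e^2\<close>.\<close>
  define l1 where "l1 t = mass_inner m (g t) (k t) + mass_inner m (A t) (\<eta> t)" for t
  have Il1: "set_integrable lborel {a..b} l1"
    unfolding l1_def[abs_def] by (intro set_integral_add Igk IA\<eta>)
  obtain \<delta> where \<delta>: "0 < \<delta>" "\<And>t i j. t \<in> {a..b} \<Longrightarrow> i \<noteq> j \<Longrightarrow> \<delta> \<le> norm (\<gamma> t $ i - \<gamma> t $ j)"
    using collision_free_curve_separation[OF cont ne] by blast
  have "compact (\<eta> ` {a..b})" by (rule compact_continuous_image[OF \<eta>_cont compact_Icc])
  then obtain K0 where K0: "\<And>t. t \<in> {a..b} \<Longrightarrow> norm (\<eta> t) \<le> K0"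
    using compact_imp_bounded bounded_iff by (metis imageI)
  define K where "K = max K0 1"
  have K: "0 < K" "\<And>t. t \<in> {a..b} \<Longrightarrow> norm (\<eta> t) \<le> K" using K0 by (auto simp: K_def le_max_iff_disj)
  define C where "C = (\<Sum>(i, j)\<in>{(i, j). i < j}. m i * m j * (52 * K\<^sup>2 / \<delta> ^ 3))"
  define l0 where "l0 t = kinetic m (g t) + real_potential m (\<gamma> t)" for t
  define l2 where "l2 t = kinetic m (k t) + C" for t
  have Ur_cont: "continuous_on {a..b} (\<lambda>t. real_potential m (\<gamma> t))"
    by (rule real_potential_continuous[OF cont ne])
  have Il0: "set_integrable lborel {a..b} l0"
    unfolding l0_def[abs_def] by (intro set_integral_add Tg set_integrable_continuous_indicator Ur_cont)
  have Il2: "set_integrable lborel {a..b} l2"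
    unfolding l2_def[abs_def] by (intro set_integral_add Tk set_integrable_continuous_indicator continuous_intros)
  have pot: "potential m (\<gamma> t) = ennreal (real_potential m (\<gamma> t))" if "t \<in> {a..b}" for t
    using ne[OF that] by (intro potential_eq_real_potential m) auto
  have act0: "action m a b \<gamma> = ennreal (LINT t:{a..b}|lborel. l0 t)"
  proof -
    have "action m a b \<gamma> = (\<integral>\<^sup>+t\<in>{a..b}. ennreal (l0 t) \<partial>lborel)"
      unfolding act
    proof (intro nn_integral_cong)
      fix t
      show "(ennreal (kinetic m (g t)) + potential m (\<gamma> t)) * indicator {a..b} t = ennreal (l0 t) * indicator {a..b} t"
        by (cases "t \<in> {a..b}") (auto simp: pot l0_def ennreal_plus kinetic_nonneg m real_potential_nonneg)
    qed
    also have "\<dots> = ennreal (LINT t:{a..b}|lborel. l0 t)"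
      by (rule set_nn_integral_eq_set_integral[OF Il0]) (simp add: l0_def kinetic_nonneg m real_potential_nonneg)
    finally show ?thesis .
  qed
  let ?I = "\<lambda>f. LINT t:{a..b}|lborel. f t"
  \<comment> \<open>The competitor is \<open>\<gamma> t - e *\<^sub>R \<eta> t\<close>; after
    division by \<open>e\<close> the first variation is bounded by \<open>e\<close> times the
    second-order term.\<close>
  have step: "?I l1 \<le> e * ?I l2" if e: "0 < e" "4 * e * K \<le> \<delta>" for e
  proof -
    let ?c = "\<lambda>t. \<gamma> t + (- e) *\<^sub>R \<eta> t"
    let ?le = "\<lambda>t. l0 t - e * l1 t + e\<^sup>2 * l2 t"
    have ac_c: "abs_continuous_on a b ?c"
      by (intro abs_continuous_on_add ac abs_continuous_on_bounded_linear[OF \<eta>_ac] bounded_linear_scaleR_right)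
    have dc: "AE t in lborel. a < t \<and> t < b \<longrightarrow> (?c has_vector_derivative (g t + (- e) *\<^sub>R k t)) (at t)"
      using deriv dk
    proof eventually_elim
      case (elim t)
      have "((\<lambda>t. (- e) *\<^sub>R \<eta> t) has_vector_derivative (- e) *\<^sub>R k t) (at t)" if "a < t \<and> t < b"
        using elim(2)[rule_format, OF that] by (rule bounded_linear.has_vector_derivative[OF bounded_linear_scaleR_right])
      then show ?case using elim(1) has_vector_derivative_add by blast
    qed
    have bound: "ennreal (kinetic m (g t + (- e) *\<^sub>R k t)) + potential m (?c t) \<le> ennreal (?le t) \<and> 0 \<le> ?le t" if t: "t \<in> {a..b}" for t
    proof -
      have e0: "0 \<le> e" using e by simp
      note ub = real_potential_upper_bound[of m \<delta> "\<gamma> t" "\<eta> t" K e, OF m \<delta>(1) \<delta>(2)[OF t] K(2)[OF t] e0 e(2)]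
      have cc: "\<gamma> t - e *\<^sub>R \<eta> t = ?c t" by simp
      have "potential m (?c t) = ennreal (real_potential m (?c t))"
        using ub[unfolded cc] by (intro potential_eq_real_potential m) blast
      moreover have le: "kinetic m (g t + (- e) *\<^sub>R k t) + real_potential m (?c t) \<le> ?le t"
        using ub[unfolded cc] kinetic_diff_scaleR[of m "g t" e "k t"]
        by (simp add: l0_def l1_def l2_def A_def C_def algebra_simps)
      moreover have "0 \<le> kinetic m (g t + (- e) *\<^sub>R k t)" "0 \<le> real_potential m (?c t)"
        by (auto intro: kinetic_nonneg m real_potential_nonneg)
      ultimately show ?thesis by (simp add: ennreal_plus[symmetric] ennreal_leI del: ennreal_plus)
    qed
    have Ile: "set_integrable lborel {a..b} ?le"
      by (intro set_integral_add set_integral_diff set_integrable_mult_right Il0 Il1 Il2)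
    have "ennreal (?I l0) \<le> action m a b ?c"
      unfolding act0[symmetric] minim action_potential_def
      by (rule Inf_lower) (use ab ac_c \<eta>_ends in force)
    also have "\<dots> \<le> (\<integral>\<^sup>+t\<in>{a..b}. ennreal (?le t) \<partial>lborel)"
      unfolding action_eq_nn_integral[OF dc]
    proof (rule nn_integral_mono)
      fix t
      show "(ennreal (kinetic m (g t + (- e) *\<^sub>R k t)) + potential m (?c t)) * indicator {a..b} t \<le> ennreal (?le t) * indicator {a..b} t"
        using bound[of t] by (cases "t \<in> {a..b}") auto
    qed
    also have "\<dots> = ennreal (?I ?le)"
      by (rule set_nn_integral_eq_set_integral[OF Ile]) (use bound in blast)
    finally have "ennreal (?I l0) \<le> ennreal (?I ?le)" .
    moreover have "0 \<le> ?I ?le"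
      unfolding set_lebesgue_integral_def using bound by (intro integral_nonneg_AE AE_I2) (auto split: split_indicator)
    ultimately have "?I l0 \<le> ?I ?le" by (simp add: ennreal_le_iff)
    also have "?I ?le = ?I l0 - e * ?I l1 + e\<^sup>2 * ?I l2"
      by (simp add: set_integral_add set_integral_diff set_integrable_mult_right Il0 Il1 Il2 set_integral_mult_right)
    finally have "e * ?I l1 \<le> e * (e * ?I l2)" by (simp add: power2_eq_square mult_ac)
    then show ?thesis using e(1) by (simp add: mult_le_cancel_left_pos)
  qed
  have I1: "?I l1 \<le> 0"
  proof (rule tendsto_lowerbound)
    show "((\<lambda>e. e * ?I l2) \<longlongrightarrow> 0) (at_right 0)" by (auto intro!: tendsto_eq_intros)
    have "eventually (\<lambda>e. e \<in> {0<..<\<delta> / (4 * K)}) (at_right 0)"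
      using \<delta>(1) K(1) by (intro eventually_at_right_real) simp
    then show "eventually (\<lambda>e. ?I l1 \<le> e * ?I l2) (at_right 0)"
    proof eventually_elim
      case (elim e)
      then show ?case using K(1) by (intro step) (auto simp: field_simps)
    qed
  qed simp
  \<comment> \<open>Integration by parts: the derivative of \<psi> is
    \<open>l1 t - 2 * kinetic m (k t)\<close>, and \<psi> vanishes at the end points together with
    \<eta>.\<close>
  define \<psi> where "\<psi> t = mass_inner m (F t + c) (\<eta> t)" for t
  have \<psi>_ac: "abs_continuous_on a b \<psi>"
  proof -
    obtain B where B: "\<And>u v :: ('a, 'n) vec. norm (mass_inner m u v) \<le> norm u * norm v * B" "0 < B"
      using mass_inner.pos_bounded by blast
    have "compact ((\<lambda>t. F t + c) ` {a..b})" by (rule compact_continuous_image[OF Fc_cont compact_Icc])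
    then obtain B1 where B1: "\<And>t. t \<in> {a..b} \<Longrightarrow> norm (F t + c) \<le> B1"
      using compact_imp_bounded bounded_iff by (metis imageI)
    have F_ac: "abs_continuous_on a b F" unfolding F_def[abs_def] by (rule lip[OF A_cont])
    \<comment> \<open>Both factors of \<psi> are combined into one curve, whose increments dominate
      those of the product up to a constant.\<close>
    define H where "H t = (F t, \<eta> t)" for t
    have H_ac: "abs_continuous_on a b H"
    proof -
      have "abs_continuous_on a b (\<lambda>t. (F t, 0) + (0, \<eta> t))"
        by (intro abs_continuous_on_add abs_continuous_on_bounded_linear[OF F_ac] abs_continuous_on_bounded_linear[OF \<eta>_ac]
            bounded_linear_Pair bounded_linear_ident bounded_linear_zero)
      then show ?thesis by (simp add: H_def[abs_def])
    qed
    show ?thesis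
    proof (rule abs_continuous_on_dominated[OF H_ac, where C="(max B1 0 + K) * B + 1"])
      show "0 < (max B1 0 + K) * B + 1" using B(2) K(1) by (intro add_nonneg_pos mult_nonneg_nonneg) auto
      fix u v assume uv: "a \<le> u" "u \<le> v" "v \<le> b"
      let ?N = "norm (H v - H u)"
      have N: "norm (F v - F u) \<le> ?N" "norm (\<eta> v - \<eta> u) \<le> ?N"
        using norm_fst_le[of "F v - F u" "\<eta> v - \<eta> u"] norm_snd_le[of "\<eta> v - \<eta> u" "F v - F u"] by (auto simp: H_def)
      have "\<psi> v - \<psi> u = mass_inner m (F v + c) (\<eta> v - \<eta> u) + mass_inner m (F v - F u) (\<eta> u)"
        by (simp add: \<psi>_def mass_inner.diff_right mass_inner.diff_left mass_inner.add_left)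
      then have "norm (\<psi> v - \<psi> u) \<le> norm (mass_inner m (F v + c) (\<eta> v - \<eta> u)) + norm (mass_inner m (F v - F u) (\<eta> u))"
        by (simp add: norm_triangle_ineq)
      also have "\<dots> \<le> norm (F v + c) * norm (\<eta> v - \<eta> u) * B + norm (F v - F u) * norm (\<eta> u) * B"
        by (intro add_mono B)
      also have "\<dots> \<le> max B1 0 * ?N * B + ?N * K * B"
        using B1[of v] K uv N B(2) by (intro add_mono mult_mono) (auto simp: le_max_iff_disj)
      also have "\<dots> \<le> ((max B1 0 + K) * B + 1) * ?N" by (simp add: algebra_simps)
      finally show "norm (\<psi> v - \<psi> u) \<le> ((max B1 0 + K) * B + 1) * ?N" .
    qed
  qed
  define k\<psi> where "k\<psi> t = l1 t - 2 * kinetic m (k t)" for t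
  have k\<psi>m: "(\<lambda>t. indicator {a..b} t *\<^sub>R k\<psi> t) \<in> borel_measurable borel"
  proof -
    have "set_integrable lborel {a..b} k\<psi>"
      unfolding k\<psi>_def[abs_def] by (intro set_integral_diff set_integrable_mult_right Il1 Tk)
    then show ?thesis by (auto simp: set_integrable_def)
  qed
  have k\<psi>_eq: "k\<psi> t = mass_inner m (F t + c) (k t) + mass_inner m (A t) (\<eta> t)" if "t \<in> {a..b}" for t
  proof -
    have "g t = k t + (F t + c)" using that by (simp add: k_def G_def)
    then have "mass_inner m (g t) (k t) = mass_inner m (k t) (k t) + mass_inner m (F t + c) (k t)"
      by (simp only: mass_inner.add_left)
    then show ?thesis by (simp add: k\<psi>_def l1_def kinetic_eq_mass_inner)
  qed
  have d\<psi>: "AE t in lborel. a < t \<and> t < b \<longrightarrow> (\<psi> has_vector_derivative indicator {a..b} t *\<^sub>R k\<psi> t) (at t)"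
    using dk
  proof eventually_elim
    case (elim t)
    show ?case
    proof
      assume t: "a < t \<and> t < b"
      have "((\<lambda>t. F t + c) has_vector_derivative A t + 0) (at t)"
        using t by (intro has_vector_derivative_add dF has_vector_derivative_const) auto
      from mass_inner.has_vector_derivative[OF this elim[rule_format, OF t]]
      show "(\<psi> has_vector_derivative indicator {a..b} t *\<^sub>R k\<psi> t) (at t)"
        unfolding \<psi>_def[abs_def] using t by (simp add: k\<psi>_eq)
    qed
  qed
  have "?I k\<psi> = 0"
  proof -
    have "\<psi> b = \<psi> a + (LINT t:{a..b}|lborel. indicator {a..b} t *\<^sub>R k\<psi> t)"
      using ab by (intro abs_continuous_on_integral_derivative(2)[OF \<psi>_ac ab k\<psi>m d\<psi>]) auto
    moreover have "(LINT t:{a..b}|lborel. indicator {a..b} t *\<^sub>R k\<psi> t) = ?I k\<psi>"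
      unfolding set_lebesgue_integral_def by (intro Bochner_Integration.integral_cong) (auto split: split_indicator)
    ultimately show ?thesis by (simp add: \<psi>_def \<eta>_ends mass_inner.zero_right)
  qed
  \<comment> \<open>The first variation is at most 0 and equals twice the integrated kinetic energy
    of \<open>k\<close>, which therefore vanishes.\<close>
  then have "?I l1 = 2 * ?I (\<lambda>t. kinetic m (k t))"
    unfolding k\<psi>_def[abs_def] by (simp add: set_integral_diff set_integrable_mult_right Il1 Tk set_integral_mult_right)
  then have "?I (\<lambda>t. kinetic m (k t)) \<le> 0" using I1 by simp
  moreover have "0 \<le> ?I (\<lambda>t. kinetic m (k t))"
    unfolding set_lebesgue_integral_def by (intro integral_nonneg_AE AE_I2) (simp add: kinetic_nonneg m)
  ultimately have "?I (\<lambda>t. kinetic m (k t)) = 0" by simp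
  then have k0: "AE t in lborel. indicat_real {a..b} t *\<^sub>R kinetic m (k t) = 0"
    unfolding set_lebesgue_integral_def
    using Tk by (subst (asm) integral_nonneg_eq_0_iff_AE) (auto simp: set_integrable_def kinetic_nonneg m)
  have \<eta>0: "\<eta> t = 0" if t: "t \<in> {a..b}" for t
  proof -
    have "AE t in lborel. a < t \<and> t < b \<longrightarrow> (\<eta> has_vector_derivative 0) (at t)"
      using dk k0
    proof eventually_elim
      case (elim t)
      show ?case
      proof
        assume t: "a < t \<and> t < b"
        then have "kinetic m (k t) = 0" using elim(2) by simp
        then have "(\<Sum>i\<in>UNIV. m i * (norm (k t $ i))\<^sup>2) = 0" by (simp add: kinetic_def)
        then have "\<forall>i\<in>UNIV. m i * (norm (k t $ i))\<^sup>2 = 0"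
          using m by (subst (asm) sum_nonneg_eq_0_iff) (auto simp: less_imp_le)
        then have "k t = 0" using m by (simp add: vec_eq_iff) (metis less_irrefl)
        then show "(\<eta> has_vector_derivative 0) (at t)" using elim(1) t by simp
      qed
    qed
    from abs_continuous_on_integral_derivative(2)[OF \<eta>_ac ab _ this t] show ?thesis
      by (simp add: \<eta>_ends set_lebesgue_integral_def)
  qed
  have \<gamma>_eq: "\<gamma> t = p t + ((\<gamma> a - p a) + (t - a) *\<^sub>R c)" if "t \<in> {a..b}" for t
    using \<eta>0[OF that] unfolding \<eta>_def by (simp only: diff_conv_add_uminus[symmetric] right_minus_eq)
  show ?thesis
  proof (intro exI[of _ "\<lambda>t. F t + c"] ballI conjI)
    fix t assume t: "t \<in> {a<..<b}"
    have "((\<lambda>t. p t + ((\<gamma> a - p a) + (t - a) *\<^sub>R c)) has_vector_derivative F t + (0 + c)) (at t)"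
      using t by (intro has_vector_derivative_add dp has_vector_derivative_const) (auto intro!: derivative_eq_intros)
    then have "((\<lambda>t. p t + ((\<gamma> a - p a) + (t - a) *\<^sub>R c)) has_vector_derivative F t + c) (at t)" by simp
    then show "(\<gamma> has_vector_derivative F t + c) (at t)"
      by (rule has_vector_derivative_transform_within_open[where S="{a<..<b}"]) (use t in \<open>auto simp: \<gamma>_eq[symmetric]\<close>)
    have "((\<lambda>t. F t + c) has_vector_derivative A t + 0) (at t)"
      using t by (intro has_vector_derivative_add dF has_vector_derivative_const) auto
    then show "((\<lambda>t. F t + c) has_vector_derivative newton_acceleration m (\<gamma> t)) (at t)" by (simp add: A_def)
  qed
qed

section \<open>Vanishing energy\<close>

lemma continuous_on_has_vector_derivative:
  assumes "\<And>t. t \<in> S \<Longrightarrow> (f has_vector_derivative f' t) (at t)"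
  shows "continuous_on S f"
proof (rule continuous_at_imp_continuous_on, rule ballI)
  fix t assume "t \<in> S"
  show "continuous (at t) f" by (rule has_vector_derivative_continuous[OF assms[OF \<open>t \<in> S\<close>]])
qed

text \<open>Comparison with the reparametrized curves \<open>\<lambda>t. \<gamma> (r * t)\<close>, whose action is
  \<open>r * (\<integral> kinetic) + (1 / r) * (\<integral> potential)\<close>.\<close>

lemma minimizer_virial:
  fixes m :: "'n::{finite,linorder} \<Rightarrow> real" and \<gamma> v :: "real \<Rightarrow> ('a::euclidean_space, 'n) vec"
  assumes m: "\<And>i. m i > 0" and ab: "a < b"
    and minim: "action m a b \<gamma> = action_potential m (\<gamma> a) (\<gamma> b)"
    and ne: "\<And>t i j. t \<in> {a..b} \<Longrightarrow> i \<noteq> j \<Longrightarrow> \<gamma> t $ i \<noteq> \<gamma> t $ j"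
    and deriv: "\<And>t. t \<in> {a..b} \<Longrightarrow> (\<gamma> has_vector_derivative v t) (at t)" and v_cont: "continuous_on {a..b} v"
  shows "integral {a..b} (\<lambda>t. kinetic m (v t) - real_potential m (\<gamma> t)) = 0"
proof -
  have cont: "continuous_on {a..b} \<gamma>"
    using deriv by (rule continuous_on_has_vector_derivative)
  have kin_cont: "continuous_on {a..b} (\<lambda>t. kinetic m (v t))"
    unfolding kinetic_def by (intro continuous_intros v_cont)
  have pot_cont: "continuous_on {a..b} (\<lambda>t. real_potential m (\<gamma> t))"
    by (rule real_potential_continuous[OF cont ne])
  define K where "K = (LINT t:{a..b}|lborel. kinetic m (v t))"
  define P where "P = (LINT t:{a..b}|lborel. real_potential m (\<gamma> t))"
  note IK = set_integrable_continuous_indicator[OF kin_cont]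
  note IP = set_integrable_continuous_indicator[OF pot_cont]
  have pot: "potential m (\<gamma> t) = ennreal (real_potential m (\<gamma> t))" if "t \<in> {a..b}" for t
    using ne[OF that] by (intro potential_eq_real_potential m) auto
  have K0: "0 \<le> K" and P0: "0 \<le> P"
    unfolding K_def P_def set_lebesgue_integral_def
    by (auto intro!: integral_nonneg_AE AE_I2 simp: kinetic_nonneg m real_potential_nonneg)
  \<comment> \<open>The Lagrangian for velocities multiplied by \<open>r\<close>, on the original
    time axis; composed with \<open>t \<mapsto> r * t\<close> it is the Lagrangian of the
    reparametrized curve.\<close>
  define H where "H r t = ennreal (indicator {a..b} t *\<^sub>R (r\<^sup>2 * kinetic m (v t) + real_potential m (\<gamma> t)))" for r t
  have Hm: "H r \<in> borel_measurable borel" for r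
  proof -
    have "(\<lambda>t. indicator {a..b} t *\<^sub>R (r\<^sup>2 * kinetic m (v t) + real_potential m (\<gamma> t))) \<in> borel_measurable borel"
      by (intro borel_measurable_continuous_on_indicator continuous_intros kin_cont pot_cont) auto
    then show ?thesis unfolding H_def[abs_def] by measurable
  qed
  have H_int: "(\<integral>\<^sup>+t. H r t \<partial>lborel) = ennreal (r\<^sup>2 * K + P)" for r
  proof -
    have "(\<integral>\<^sup>+t. H r t \<partial>lborel) = (\<integral>\<^sup>+t\<in>{a..b}. ennreal (r\<^sup>2 * kinetic m (v t) + real_potential m (\<gamma> t)) \<partial>lborel)"
      unfolding H_def by (intro nn_integral_cong) (auto split: split_indicator)
    also have "\<dots> = ennreal (LINT t:{a..b}|lborel. r\<^sup>2 * kinetic m (v t) + real_potential m (\<gamma> t))"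
      by (intro set_nn_integral_eq_set_integral set_integral_add set_integrable_mult_right IK IP)
         (auto intro!: add_nonneg_nonneg mult_nonneg_nonneg kinetic_nonneg m real_potential_nonneg)
    also have "(LINT t:{a..b}|lborel. r\<^sup>2 * kinetic m (v t) + real_potential m (\<gamma> t)) = r\<^sup>2 * K + P"
      by (simp add: set_integral_add set_integrable_mult_right IK IP set_integral_mult_right K_def P_def)
    finally show ?thesis .
  qed
  have act: "action m a b \<gamma> = ennreal (K + P)"
  proof -
    have "AE t in lborel. a < t \<and> t < b \<longrightarrow> (\<gamma> has_vector_derivative v t) (at t)"
      using deriv by (intro AE_I2) auto
    from action_eq_nn_integral[OF this]
    have "action m a b \<gamma> = (\<integral>\<^sup>+t. H 1 t \<partial>lborel)"
      unfolding H_def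
      by (simp, intro nn_integral_cong)
         (auto simp: pot ennreal_plus kinetic_nonneg m real_potential_nonneg split: split_indicator)
    then show ?thesis by (simp add: H_int)
  qed
  \<comment> \<open>The comparison of actions multiplied by \<open>r\<close>, which avoids a
    division in \<open>ennreal\<close>.\<close>
  have scale: "r * (K + P) \<le> r\<^sup>2 * K + P" if r: "0 < r" for r
  proof -
    let ?c = "\<lambda>t. \<gamma> (r * t)"
    have arb: "a / r < b / r" using ab r by (simp add: divide_strict_right_mono)
    have dc: "(?c has_vector_derivative r *\<^sub>R v (r * t)) (at t)" if "a / r \<le> t" "t \<le> b / r" for t
    proof -
      have "r * t \<in> {a..b}" using that r by (simp add: field_simps)
      moreover have "((\<lambda>t. r * t) has_vector_derivative r) (at t)"
        by (auto intro!: derivative_eq_intros simp: has_real_derivative_iff_has_vector_derivative[symmetric])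
      ultimately show ?thesis
        using vector_diff_chain_at[of "\<lambda>t. r * t" r t \<gamma> "v (r * t)"] deriv by (simp add: o_def)
    qed
    have "compact (v ` {a..b})" by (rule compact_continuous_image[OF v_cont compact_Icc])
    then obtain B where B: "\<And>t. t \<in> {a..b} \<Longrightarrow> norm (v t) \<le> B"
      using compact_imp_bounded bounded_iff by (metis imageI)
    have ac: "abs_continuous_on (a / r) (b / r) ?c"
    proof (rule abs_continuous_on_lipschitz[where C="r * B"])
      fix s t assume st: "a / r \<le> s" "s \<le> t" "t \<le> b / r"
      show "norm (?c t - ?c s) \<le> r * B * (t - s)"
      proof (cases "s = t")
        case False
        then have lt: "s < t" using st by simp
        have "continuous_on {s..t} ?c"
          by (rule continuous_on_has_vector_derivative[OF dc]) (use st in auto)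
        moreover have "(?c has_derivative (\<lambda>h. h *\<^sub>R r *\<^sub>R v (r * x))) (at x)" if "s < x" "x < t" for x
          using dc[of x] that st by (simp add: has_vector_derivative_def)
        ultimately obtain x where x: "x \<in> {s<..<t}" "norm (?c t - ?c s) \<le> norm ((t - s) *\<^sub>R r *\<^sub>R v (r * x))"
          using mvt_general[OF lt, of ?c "\<lambda>x h. h *\<^sub>R r *\<^sub>R v (r * x)"] by blast
        have "a \<le> r * s" "r * t \<le> b" using st r by (auto simp: field_simps)
        moreover have "r * s < r * x" "r * x < r * t" using x(1) r by auto
        ultimately have "r * x \<in> {a..b}" by auto
        then have "norm (v (r * x)) \<le> B" by (rule B)
        then have "(t - s) * (r * norm (v (r * x))) \<le> (t - s) * (r * B)"
          using lt r by (intro mult_left_mono) auto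
        moreover have "norm ((t - s) *\<^sub>R r *\<^sub>R v (r * x)) = (t - s) * (r * norm (v (r * x)))"
          unfolding norm_scaleR using lt r by simp
        ultimately have "norm (?c t - ?c s) \<le> (t - s) * (r * B)" using x(2) by linarith
        then show ?thesis by (simp only: mult_ac)
      qed simp
    qed
    have "AE t in lborel. a / r < t \<and> t < b / r \<longrightarrow> (?c has_vector_derivative r *\<^sub>R v (r * t)) (at t)"
      using dc by (intro AE_I2) auto
    from action_eq_nn_integral[OF this]
    have "action m (a / r) (b / r) ?c = (\<integral>\<^sup>+t. H r (0 + r * t) \<partial>lborel)"
    proof (simp, intro nn_integral_cong)
      fix t
      have "t \<in> {a / r..b / r} \<longleftrightarrow> r * t \<in> {a..b}" using r by (auto simp: field_simps)
      then show "(ennreal (kinetic m (r *\<^sub>R v (r * t))) + potential m (\<gamma> (r * t))) * indicator {a / r..b / r} t = H r (r * t)"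
        by (cases "r * t \<in> {a..b}")
           (auto simp: H_def pot kinetic_scaleR ennreal_plus kinetic_nonneg m real_potential_nonneg)
    qed
    moreover have "ennreal (r\<^sup>2 * K + P) = ennreal r * (\<integral>\<^sup>+t. H r (0 + r * t) \<partial>lborel)"
      using nn_integral_real_affine[OF Hm, of r r 0] r by (simp add: H_int)
    moreover have "action m a b \<gamma> \<le> action m (a / r) (b / r) ?c"
      unfolding minim action_potential_def
      by (rule Inf_lower) (use arb ac r in force)
    ultimately have "ennreal r * ennreal (K + P) \<le> ennreal (r\<^sup>2 * K + P)"
      using mult_left_mono[of "action m a b \<gamma>" "action m (a / r) (b / r) ?c" "ennreal r"] by (simp add: act)
    then have "ennreal (r * (K + P)) \<le> ennreal (r\<^sup>2 * K + P)"
      using r by (simp add: ennreal_mult')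
    then show ?thesis using K0 P0 by (subst (asm) ennreal_le_iff) auto
  qed
  \<comment> \<open>The first factor changes sign at \<open>r = 1\<close>: letting \<open>r\<close>
    approach 1 from below gives \<open>K \<le> P\<close>, from above
    \<open>P \<le> K\<close>.\<close>
  have factor: "0 \<le> (r - 1) * (r * K - P)" if "0 < r" for r
    using scale[OF that] by (simp add: power2_eq_square algebra_simps)
  have "K \<le> P"
  proof (rule field_le_mult_one_interval)
    fix z :: real assume "0 < z" "z < 1"
    then show "z * K \<le> P" using factor[of z] by (simp add: zero_le_mult_iff)
  qed
  moreover have "P \<le> K"
  proof (rule field_le_mult_one_interval)
    fix z :: real assume z: "0 < z" "z < 1"
    then have "1 < 1 / z" by simp
    then have "P \<le> (1 / z) * K" using factor[of "1 / z"] z by (auto simp: zero_le_mult_iff)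
    then show "z * P \<le> K" using z by (simp add: field_simps)
  qed
  ultimately have "(LINT t:{a..b}|lborel. kinetic m (v t) - real_potential m (\<gamma> t)) = 0"
    by (simp add: set_integral_diff IK IP K_def P_def)
  then show ?thesis
    using set_borel_integral_eq_integral(2)[OF set_integral_diff(1)[OF IK IP]] by simp
qed

text \<open>Everything is local: each point of the open set \<open>J\<close> has a compact interval
  around it inside \<open>J\<close>, and \<gamma> minimizes on that interval.\<close>

theorem lemma15:
  fixes m :: "'n::{finite,linorder} \<Rightarrow> real"
    and J :: "real set"
    and \<gamma> :: "real \<Rightarrow> ('a::euclidean_space, 'n) vec"
  assumes "CARD('n) \<ge> 2"
    and "DIM('a) \<ge> 2"
    and "\<And>i. m i > 0"
    and "open J" and "is_interval J"
    and "free_time_minimizer m J \<gamma>"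
  shows "trajectory m J \<gamma> \<and> (\<forall>t\<in>J. energy m (\<gamma> t) (vector_derivative \<gamma> (at t)) = 0)"
proof -
  note m = assms(3)
  have sub: "abs_continuous_on a b \<gamma>" "action m a b \<gamma> = action_potential m (\<gamma> a) (\<gamma> b)" "action m a b \<gamma> < \<infinity>"
    if "a < b" "{a..b} \<subseteq> J" for a b
  proof -
    show ac: "abs_continuous_on a b \<gamma>" and minim: "action m a b \<gamma> = action_potential m (\<gamma> a) (\<gamma> b)"
      using assms(6) that unfolding free_time_minimizer_def by blast+
    show "action m a b \<gamma> < \<infinity>" unfolding minim by (rule action_potential_finite[OF assms(2) m])
  qed
  have nbhd: "\<exists>d>0. {t - d..t + d} \<subseteq> J" if "t \<in> J" for t
    using assms(4) that unfolding open_contains_cball cball_eq_atLeastAtMost by blast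
  have ne: "\<gamma> t $ i \<noteq> \<gamma> t $ j" if t: "t \<in> J" and ij: "i \<noteq> j" for t i j
  proof -
    obtain d where d: "0 < d" "{t - d..t + d} \<subseteq> J" using nbhd[OF t] by blast
    have "t - d < t + d" using d by simp
    from minimizer_no_collision[OF assms(2) m sub(1,2)[OF this d(2)] _ _ ij, of t] d(1)
    show ?thesis by simp
  qed
  \<comment> \<open>\<open>trajectory\<close> asks for one velocity on all of \<open>J\<close>; the
    derivative of \<gamma> glues the velocities obtained on the small intervals.\<close>
  define v where "v t = vector_derivative \<gamma> (at t)" for t
  have newton: "(\<gamma> has_vector_derivative v t) (at t)" "(v has_vector_derivative newton_acceleration m (\<gamma> t)) (at t)"
    if t: "t \<in> J" for t
  proof -
    obtain d where d: "0 < d" "{t - d..t + d} \<subseteq> J" using nbhd[OF t] by blast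
    have lt: "t - d < t + d" using d by simp
    have "\<gamma> s $ i \<noteq> \<gamma> s $ j" if "s \<in> {t - d..t + d}" "i \<noteq> j" for s i j
      using ne that d(2) by blast
    from minimizer_solves_newton[OF m lt sub[OF lt d(2)] this]
    obtain w where w: "\<And>s. s \<in> {t - d<..<t + d} \<Longrightarrow> (\<gamma> has_vector_derivative w s) (at s)"
      "\<And>s. s \<in> {t - d<..<t + d} \<Longrightarrow> (w has_vector_derivative newton_acceleration m (\<gamma> s)) (at s)"
      by blast
    have vw: "w s = v s" if "s \<in> {t - d<..<t + d}" for s
      using vector_derivative_at[OF w(1)[OF that]] by (simp add: v_def)
    have t': "t \<in> {t - d<..<t + d}" using d by simp
    show "(\<gamma> has_vector_derivative v t) (at t)" using w(1)[OF t'] vw[OF t'] by simp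
    show "(v has_vector_derivative newton_acceleration m (\<gamma> t)) (at t)"
      by (rule has_vector_derivative_transform_within_open[OF w(2)[OF t'] open_greaterThanLessThan t' vw])
  qed
  have cf: "\<gamma> t \<in> collision_free m" if "t \<in> J" for t
    using ne[OF that] by (simp add: collision_free_iff[OF m])
  have "trajectory m J \<gamma>"
    unfolding trajectory_def
    using cf has_vector_derivative_at_within[OF newton(1)] has_vector_derivative_at_within[OF newton(2)] by blast
  moreover have "energy m (\<gamma> t) (vector_derivative \<gamma> (at t)) = 0" if t: "t \<in> J" for t
  proof -
    obtain d where d: "0 < d" "{t - d..t + d} \<subseteq> J" using nbhd[OF t] by blast
    let ?f = "\<lambda>s. kinetic m (v s) - real_potential m (\<gamma> s)"
    have J: "{t..t + d} \<subseteq> J" using d by auto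
    have v_cont: "continuous_on {t..t + d} v"
      by (rule continuous_on_has_vector_derivative[OF newton(2)]) (use J in blast)
    have \<gamma>_cont: "continuous_on {t..t + d} \<gamma>"
      by (rule continuous_on_has_vector_derivative[OF newton(1)]) (use J in blast)
    have "continuous_on {t..t + d} (\<lambda>s. kinetic m (v s))"
      unfolding kinetic_def by (intro continuous_intros v_cont)
    moreover have "continuous_on {t..t + d} (\<lambda>s. real_potential m (\<gamma> s))"
      by (rule real_potential_continuous[OF \<gamma>_cont]) (use ne J in blast)
    ultimately have f_cont: "continuous_on {t..t + d} ?f" by (rule continuous_on_diff)
    \<comment> \<open>By the virial identity on every interval starting at \<open>t\<close> this
      primitive vanishes identically, so its derivative at \<open>t\<close>, the energy, is
      0.\<close>
    have "integral {t..s} ?f = 0" if s: "s \<in> {t..t + d}" for s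
    proof (cases "s = t")
      case False
      then have ts: "t < s" "{t..s} \<subseteq> J" "{t..s} \<subseteq> {t..t + d}" using s J by auto
      show ?thesis
      proof (rule minimizer_virial[OF m ts(1) sub(2)[OF ts(1,2)]])
        show "continuous_on {t..s} v" using v_cont ts(3) by (rule continuous_on_subset)
      qed (use ne newton(1) ts(2) in blast)+
    qed simp
    then have "((\<lambda>s. integral {t..s} ?f) has_vector_derivative 0) (at t within {t..t + d})"
      using d(1) by (intro has_vector_derivative_transform[OF _ _ has_vector_derivative_const[of 0]]) auto
    moreover have "((\<lambda>s. integral {t..s} ?f) has_vector_derivative ?f t) (at t within {t..t + d})"
      using d(1) by (intro integral_has_vector_derivative f_cont) auto
    ultimately have "?f t = 0"
      using vector_derivative_unique_within_closed_interval[of t "t + d" t] d(1) by fastforce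
    moreover have "potential m (\<gamma> t) = ennreal (real_potential m (\<gamma> t))"
      using ne[OF t] by (intro potential_eq_real_potential m) auto
    ultimately show ?thesis
      by (simp add: energy_def v_def real_potential_nonneg m)
  qed
  ultimately show ?thesis by blast
qed

end
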